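(* Let $G$ be a finite simple connected graph with blocks $B_1,\dots,B_k$. Then $I_G$ is a complete intersection if and only if (i) all minimal generators of $I_G$, except at most one (up to sign), are of the form $B_w$ with $w$ an even cycle of $G$, and (ii) the ideal $I_{B_i}$ is a complete intersection for every $1\le i\le k$.
   Context: For a finite simple graph $G$ with edges $e_1,\dots,e_m$ and a field $K$, the toric ideal $I_G\subseteq K[e_1,\dots,e_m]$ is the kernel of the $K$-algebra map $e_i=\{v_j,v_k\}\mapsto v_jv_k$; an ideal $I_G$ is a complete intersection if it is generated by $\operatorname{ht}(I_G)$ elements. A block is a maximal biconnected subgraph of $G$. For a block $B$, $I_B=I_G\cap K[e_i : e_i\in E(B)]$ (the toric ideal of the subgraph $B$). A minimal generator of $I_G$ is a binomial belonging to at least one minimal system of binomial generators of $I_G$. For an even cycle $w=(e_{i_1},\dots,e_{i_{2q}})$, $B_w=\prod_{k=1}^q e_{i_{2k-1}}-\prod_{k=1}^q e_{i_{2k}}$. *)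

theory Defs
  imports "HOL-Library.Poly_Mapping" "HOL-Algebra.Ideal" "HOL-Library.Extended_Nat"
begin

section \<open>Graphs\<close>

text \<open>A finite simple graph: vertex set V, edge set E of 2-element subsets of V.\<close>
definition simple_graph :: "'v set \<Rightarrow> 'v set set \<Rightarrow> bool" where
  "simple_graph V E \<longleftrightarrow> finite V \<and> (\<forall>e\<in>E. e \<subseteq> V \<and> card e = 2)"

definition adj_rel :: "'v set set \<Rightarrow> ('v \<times> 'v) set" where
  "adj_rel E = {(u, v). {u, v} \<in> E}"

definition graph_connected :: "'v set \<Rightarrow> 'v set set \<Rightarrow> bool" where
  "graph_connected V E \<longleftrightarrow> V \<noteq> {} \<and> (\<forall>u\<in>V. \<forall>v\<in>V. (u, v) \<in> (adj_rel E)\<^sup>*)"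

definition subgraph :: "'v set \<Rightarrow> 'v set set \<Rightarrow> 'v set \<Rightarrow> 'v set set \<Rightarrow> bool" where
  "subgraph V' E' V E \<longleftrightarrow> V' \<subseteq> V \<and> E' \<subseteq> E \<and> (\<forall>e\<in>E'. e \<subseteq> V')"

text \<open>Biconnected: connected and without a cut vertex (removing any vertex leaves the
  remaining vertices mutually reachable). K1 and K2 count as biconnected.\<close>
definition biconnected :: "'v set \<Rightarrow> 'v set set \<Rightarrow> bool" where
  "biconnected V E \<longleftrightarrow> graph_connected V E \<and>
     (\<forall>x\<in>V. \<forall>u\<in>V - {x}. \<forall>v\<in>V - {x}. (u, v) \<in> (adj_rel {e\<in>E. x \<notin> e})\<^sup>*)"

text \<open>A block of (V,E): a maximal biconnected subgraph.\<close>
definition is_block :: "'v set \<Rightarrow> 'v set set \<Rightarrow> 'v set \<Rightarrow> 'v set set \<Rightarrow> bool" where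
  "is_block V E V' E' \<longleftrightarrow> subgraph V' E' V E \<and> biconnected V' E' \<and>
     \<not> (\<exists>V'' E''. subgraph V'' E'' V E \<and> biconnected V'' E'' \<and>
          V' \<subseteq> V'' \<and> E' \<subseteq> E'' \<and> (V'', E'') \<noteq> (V', E'))"

text \<open>An even cycle, given by its cyclic list of distinct vertices v_0,...,v_{n-1}
  (n even, n \<ge> 3); its k-th edge is {v_k, v_(k+1 mod n)}.\<close>
definition even_cycle :: "'v set \<Rightarrow> 'v set set \<Rightarrow> 'v list \<Rightarrow> bool" where
  "even_cycle V E w \<longleftrightarrow> length w \<ge> 3 \<and> even (length w) \<and> distinct w \<and> set w \<subseteq> V \<and>
     (\<forall>k<length w. {w ! k, w ! ((k + 1) mod length w)} \<in> E)"

definition cycle_edge :: "'v list \<Rightarrow> nat \<Rightarrow> 'v set" where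
  "cycle_edge w k = {w ! k, w ! ((k + 1) mod length w)}"

section \<open>Polynomial rings in the edge variables\<close>

text \<open>Polynomials in variables indexed by edges (sets of vertices), coefficients in 'k.\<close>
type_synonym ('v, 'k) epoly = "('v set \<Rightarrow>\<^sub>0 nat) \<Rightarrow>\<^sub>0 'k"
type_synonym ('v, 'k) vpoly = "('v \<Rightarrow>\<^sub>0 nat) \<Rightarrow>\<^sub>0 'k"

definition evar :: "'v set \<Rightarrow> ('v, 'k::comm_ring_1) epoly" where
  "evar e = Poly_Mapping.single (Poly_Mapping.single e 1) 1"

text \<open>The subring K[e : e \<in> E].\<close>
definition polys_on :: "'v set set \<Rightarrow> ('v, 'k::comm_ring_1) epoly set" where
  "polys_on E = {p. \<forall>m\<in>Poly_Mapping.keys p. Poly_Mapping.keys m \<subseteq> E}"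

definition poly_ring :: "'v set set \<Rightarrow> ('v, 'k::comm_ring_1) epoly ring" where
  "poly_ring E = \<lparr>carrier = polys_on E, mult = (*), one = 1, zero = 0, add = (+)\<rparr>"

text \<open>Image of an edge monomial under e={a,b} \<mapsto> ab (exponents are additive).\<close>
definition mono_img :: "('v set \<Rightarrow>\<^sub>0 nat) \<Rightarrow> ('v \<Rightarrow>\<^sub>0 nat)" where
  "mono_img m = (\<Sum>e\<in>Poly_Mapping.keys m. \<Sum>v\<in>e. Poly_Mapping.single v (Poly_Mapping.lookup m e))"

text \<open>The K-algebra map K[edges] \<rightarrow> K[vertices], e={a,b} \<mapsto> ab.\<close>
definition toric_map :: "('v, 'k::comm_ring_1) epoly \<Rightarrow> ('v, 'k) vpoly" where
  "toric_map p = (\<Sum>m\<in>Poly_Mapping.keys p. Poly_Mapping.single (mono_img m) (Poly_Mapping.lookup p m))"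

text \<open>The toric ideal I_G of the graph with edge set E (kernel of the toric map on K[E]).\<close>
definition toric_ideal :: "'v set set \<Rightarrow> ('v, 'k::comm_ring_1) epoly set" where
  "toric_ideal E = {p \<in> polys_on E. toric_map p = 0}"

definition B_cycle :: "'v list \<Rightarrow> ('v, 'k::comm_ring_1) epoly" where
  "B_cycle w = (\<Prod>k\<in>{k. k < length w \<and> even k}. evar (cycle_edge w k))
             - (\<Prod>k\<in>{k. k < length w \<and> odd k}. evar (cycle_edge w k))"

section \<open>Height, complete intersections, minimal generators\<close>

definition prime_chain :: "('a, 'b) ring_scheme \<Rightarrow> 'a set list \<Rightarrow> bool" where
  "prime_chain R ps \<longleftrightarrow> ps \<noteq> [] \<and> (\<forall>P\<in>set ps. primeideal P R) \<and> sorted_wrt (\<subset>) ps"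

text \<open>Height of a prime P: supremum of lengths of chains of primes ending in P.\<close>
definition prime_height :: "('a, 'b) ring_scheme \<Rightarrow> 'a set \<Rightarrow> enat" where
  "prime_height R P = (SUP ps\<in>{ps. prime_chain R ps \<and> last ps = P}. enat (length ps - 1))"

text \<open>Height of an ideal: infimum of heights of primes containing it.\<close>
definition ideal_height :: "('a, 'b) ring_scheme \<Rightarrow> 'a set \<Rightarrow> enat" where
  "ideal_height R I = (INF P\<in>{P. primeideal P R \<and> I \<subseteq> P}. prime_height R P)"

definition complete_intersection :: "('a, 'b) ring_scheme \<Rightarrow> 'a set \<Rightarrow> bool" where
  "complete_intersection R I \<longleftrightarrow>
     (\<exists>A. finite A \<and> A \<subseteq> carrier R \<and> genideal R A = I \<and> enat (card A) = ideal_height R I)"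

definition is_binomial :: "('v, 'k::comm_ring_1) epoly \<Rightarrow> bool" where
  "is_binomial f \<longleftrightarrow> (\<exists>a b. f = Poly_Mapping.single a 1 - Poly_Mapping.single b 1)"

text \<open>A minimal system of binomial generators: a set of binomials generating I, none of whose
  proper subsets generates I.\<close>
definition minimal_binomial_system ::
  "'v set set \<Rightarrow> ('v, 'k::comm_ring_1) epoly set \<Rightarrow> ('v, 'k) epoly set \<Rightarrow> bool" where
  "minimal_binomial_system E I A \<longleftrightarrow> finite A \<and> A \<subseteq> polys_on E \<and> (\<forall>f\<in>A. is_binomial f) \<and>
     genideal (poly_ring E) A = I \<and> (\<forall>A'. A' \<subset> A \<longrightarrow> genideal (poly_ring E) A' \<noteq> I)"

definition minimal_generator ::
  "'v set set \<Rightarrow> ('v, 'k::comm_ring_1) epoly set \<Rightarrow> ('v, 'k) epoly \<Rightarrow> bool" where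
  "minimal_generator E I f \<longleftrightarrow> (\<exists>A. minimal_binomial_system E I A \<and> f \<in> A)"

end

theory Submission
  imports Defs
begin

text \<open>
  A binomial with exponent vectors \<open>u\<close> and \<open>v\<close> lies in the toric ideal iff \<open>u - v\<close> lies in the kernel
  lattice of the vertex-edge incidence matrix, and the height of the ideal is the rank of that
  lattice. A minimal binomial system always spans the lattice, so the ideal is a complete
  intersection iff the exponent vectors of a minimal system are linearly independent. Induced
  subgraphs, in particular blocks, inherit their minimal systems by restriction.

  If the blocks are complete intersections and all generators but one lie in blocks, a linear
  relation between the exponent vectors would, restricted to the blocks, make the exceptional
  generator redundant.

  Conversely, independence yields for every generator \<open>f\<close> a dual functional \<open>y\<close> on the edges. If the
  degree of \<open>f\<close> is squarefree, \<open>f\<close> is an even cycle. Otherwise \<open>y\<close> vanishes on all even cycles,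
  and it is of the form \<open>y {a, b} = \<phi> a + \<phi> b\<close> on a vertex set exactly when that set does not contain
  the support of \<open>f\<close>. A shortest even closed walk on which \<open>y\<close> does not vanish then shows that the
  support consists of two sets meeting in one vertex \<open>c\<close>, each of them a minimal set forcing the
  value of \<open>\<phi>\<close> at \<open>c\<close>; its lattice has rank one, so \<open>f\<close> is indispensable. For two such generators in a
  connected graph, comparing the values of \<open>\<phi>\<close> along a shortest path between the two cut vertices gives
  a contradiction.
\<close>

text \<open>All linear algebra on exponent vectors is rational, whatever the field \<open>'k\<close>
  is: which monomials share a degree does not depend on the coefficients. The bridge to polynomials
  is a sum of coefficients over a class of monomials. The rank of the lattice appears as
  \<open>card (E - F)\<close>, where the incidence vectors of the edges in \<open>F\<close> form a
  basis of the column space. Even cycles and the exceptional generator are separated by parity.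
  Prescribing \<open>y {a, b}\<close> as a sum over the end points leaves one free constant on a
  bipartite component, while an odd closed walk fixes the constant. An obstruction that no even
  cycle sees must therefore come from two odd closed walks fixing different values at one vertex.
  Condition (i) ranges over all minimal systems at once, so uniqueness of the exception inside one
  system does not suffice; indispensability carries an exceptional generator, up to sign, from one
  system into every other.\<close>

abbreviation keys :: "('a \<Rightarrow>\<^sub>0 'b::zero) \<Rightarrow> 'a set"
  where "keys \<equiv> Poly_Mapping.keys"
abbreviation lookup :: "('a \<Rightarrow>\<^sub>0 'b::zero) \<Rightarrow> 'a \<Rightarrow> 'b"
  where "lookup \<equiv> Poly_Mapping.lookup"
abbreviation single :: "'a \<Rightarrow> 'b \<Rightarrow> 'a \<Rightarrow>\<^sub>0 'b::zero"
  where "single \<equiv> Poly_Mapping.single"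

lemma poly_induct [case_names zero add]:
  fixes p :: "'m \<Rightarrow>\<^sub>0 'k::comm_monoid_add"
  assumes z: "P 0" and s: "\<And>m c q. m \<notin> keys q \<Longrightarrow> P q \<Longrightarrow> P (single m c + q)"
  shows "P p"
proof (induction p rule: Poly_Mapping.update_induct)
  case const then show ?case using z by simp
next
  case (update f a b)
  have "Poly_Mapping.update a b f = single a b + f"
    using update.hyps(1)
    by (intro poly_mapping_eqI) (auto simp: lookup_update lookup_add lookup_single in_keys_iff when_def)
  then show ?case using s update by auto
qed

lemma keys_add_nat: "keys (a + b :: 'a \<Rightarrow>\<^sub>0 nat) = keys a \<union> keys b"
  by (auto simp: in_keys_iff lookup_add)

lemma keys_sum_nat: "finite X \<Longrightarrow> keys (sum f X :: 'a \<Rightarrow>\<^sub>0 nat) = (\<Union>x\<in>X. keys (f x))"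
  by (induction X rule: finite_induct) (auto simp: keys_add_nat)

lemma sum_single_self:
  "finite X \<Longrightarrow> keys p \<subseteq> X \<Longrightarrow> (\<Sum>m\<in>X. single m (lookup p m)) = p"
  by (intro poly_mapping_eqI)
     (auto simp: lookup_sum lookup_single when_def sum.delta' in_keys_iff subset_iff)

section \<open>Gradings, functionals and ideals in the edge variables\<close>

section \<open>Linear functionals on polynomials\<close>

text \<open>With \<open>Q\<close> a fibre of a grading this is one coefficient of the image under
  the corresponding monomial map. Adding a weight condition to \<open>Q\<close> gives the
  functionals that decide which weights the generators detect.\<close>

definition coeff_sum :: "('m \<Rightarrow> bool) \<Rightarrow> ('m \<Rightarrow>\<^sub>0 'k::comm_monoid_add) \<Rightarrow> 'k" where
  "coeff_sum Q p = (\<Sum>m\<in>keys p. if Q m then lookup p m else 0)"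

lemma coeff_sum_superset:
  "finite X \<Longrightarrow> keys p \<subseteq> X \<Longrightarrow> coeff_sum Q p = (\<Sum>m\<in>X. if Q m then lookup p m else 0)"
  unfolding coeff_sum_def by (intro sum.mono_neutral_left) (auto simp: in_keys_iff)

lemma coeff_sum_zero [simp]: "coeff_sum Q 0 = 0"
  by (simp add: coeff_sum_def)

lemma coeff_sum_single [simp]: "coeff_sum Q (single m c) = (if Q m then c else 0)"
  by (subst coeff_sum_superset[of "{m}"]) auto

lemma coeff_sum_add: "coeff_sum Q (p + q) = coeff_sum Q p + coeff_sum Q q"
proof -
  let ?X = "keys p \<union> keys q"
  have "coeff_sum Q (p + q) = (\<Sum>m\<in>?X. if Q m then lookup (p+q) m else 0)"
    using Poly_Mapping.keys_add[of p q] by (intro coeff_sum_superset) auto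
  also have "\<dots> = (\<Sum>m\<in>?X. if Q m then lookup p m else 0) + (\<Sum>m\<in>?X. if Q m then lookup q m else 0)"
    by (subst sum.distrib[symmetric], rule sum.cong) (auto simp: lookup_add)
  also have "\<dots> = coeff_sum Q p + coeff_sum Q q"
    by (intro arg_cong2[where f="(+)"] coeff_sum_superset[symmetric]) auto
  finally show ?thesis .
qed

lemma coeff_sum_sum: "coeff_sum Q (sum f X) = (\<Sum>x\<in>X. coeff_sum Q (f x))"
  by (induction X rule: infinite_finite_induct) (auto simp: coeff_sum_add)

lemma coeff_sum_uminus: "coeff_sum Q (- p) = - coeff_sum Q (p :: _ \<Rightarrow>\<^sub>0 _::ab_group_add)"
  using coeff_sum_add[of Q p "-p"] by (simp add: eq_neg_iff_add_eq_0 add.commute)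

lemma coeff_sum_diff: "coeff_sum Q (p - q) = coeff_sum Q p - coeff_sum Q (q :: _ \<Rightarrow>\<^sub>0 _::ab_group_add)"
  using coeff_sum_add[of Q p "-q"] by (simp add: coeff_sum_uminus)

lemma coeff_sum_single_mult:
  fixes p :: "'m::comm_monoid_add \<Rightarrow>\<^sub>0 'k::comm_ring_1"
  shows "coeff_sum Q (single m c * p) = c * coeff_sum (\<lambda>n. Q (m + n)) p"
  by (induction p rule: poly_induct)
     (auto simp: coeff_sum_add mult_single distrib_left)

lemma coeff_sum_mult:
  fixes p :: "'m::comm_monoid_add \<Rightarrow>\<^sub>0 'k::comm_ring_1"
  shows "coeff_sum Q (p * q) = (\<Sum>m\<in>keys p. lookup p m * coeff_sum (\<lambda>n. Q (m + n)) q)"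
proof -
  have "p * q = (\<Sum>m\<in>keys p. single m (lookup p m) * q)"
    by (subst sum_single_self[of "keys p" p, symmetric]) (auto simp: sum_distrib_right)
  then show ?thesis by (simp add: coeff_sum_sum coeff_sum_single_mult)
qed

lemma lookup_eq_coeff_sum: "lookup p m = coeff_sum (\<lambda>n. n = m) p"
  by (simp add: coeff_sum_def in_keys_iff sum.delta)

text \<open>Natural exponents cannot cancel, so only the pair \<open>(0, 0)\<close> contributes.
  Multiplicativity of constant terms lets syzygies be compared with linear relations over the
  field.\<close>

lemma lookup_mult_0:
  fixes p q :: "('a \<Rightarrow>\<^sub>0 nat) \<Rightarrow>\<^sub>0 'k::comm_ring_1"
  shows "lookup (p * q) 0 = lookup p 0 * lookup q 0"
proof -
  have *: "m + n = 0 \<longleftrightarrow> m = 0 \<and> n = 0" for m n :: "'a \<Rightarrow>\<^sub>0 nat"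
    by (auto simp: poly_mapping_eq_iff fun_eq_iff lookup_add)
  have cs: "coeff_sum (\<lambda>n. m + n = 0) q = (if m = 0 then lookup q 0 else 0)" for m
    unfolding lookup_eq_coeff_sum[of q 0] by (auto simp: * coeff_sum_def)
  have "lookup (p * q) 0 = (\<Sum>m\<in>keys p. lookup p m * coeff_sum (\<lambda>n. m + n = 0) q)"
    unfolding lookup_eq_coeff_sum[of "p * q" 0] by (rule coeff_sum_mult)
  also have "\<dots> = (\<Sum>m\<in>keys p. if m = 0 then lookup p 0 * lookup q 0 else 0)"
    by (rule sum.cong) (auto simp: cs)
  also have "\<dots> = lookup p 0 * lookup q 0"
    by (auto simp: sum.delta in_keys_iff)
  finally show ?thesis .
qed

definition poly_filter :: "('m \<Rightarrow> bool) \<Rightarrow> ('m \<Rightarrow>\<^sub>0 'k::comm_monoid_add) \<Rightarrow> ('m \<Rightarrow>\<^sub>0 'k)" where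
  "poly_filter Q p = (\<Sum>m\<in>keys p. if Q m then single m (lookup p m) else 0)"

lemma lookup_poly_filter: "lookup (poly_filter Q p) m = (if Q m then lookup p m else 0)"
proof -
  have "lookup (poly_filter Q p) m = (\<Sum>n\<in>keys p. if n = m then (if Q m then lookup p m else 0) else 0)"
    unfolding poly_filter_def lookup_sum by (rule sum.cong) (auto simp: lookup_single when_def)
  then show ?thesis by (auto simp: sum.delta in_keys_iff)
qed

lemma keys_poly_filter: "keys (poly_filter Q p) = {m \<in> keys p. Q m}"
  by (auto simp: in_keys_iff lookup_poly_filter split: if_splits)

lemma poly_filter_zero [simp]: "poly_filter Q 0 = 0"
  by (simp add: poly_filter_def)

lemma poly_filter_single [simp]: "poly_filter Q (single m c) = (if Q m then single m c else 0)"
  by (rule poly_mapping_eqI) (auto simp: lookup_poly_filter lookup_single when_def)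

lemma poly_filter_add: "poly_filter Q (p + q) = poly_filter Q p + poly_filter Q q"
  by (rule poly_mapping_eqI) (simp add: lookup_poly_filter lookup_add)

lemma poly_filter_diff:
  "poly_filter Q (p - q) = poly_filter Q p - poly_filter Q (q :: _ \<Rightarrow>\<^sub>0 _::ab_group_add)"
  by (rule poly_mapping_eqI) (simp add: lookup_poly_filter lookup_minus)

lemma poly_filter_sum: "poly_filter Q (sum f X) = (\<Sum>x\<in>X. poly_filter Q (f x))"
  by (induction X rule: infinite_finite_induct) (auto simp: poly_filter_add)

lemma poly_filter_mult_single:
  fixes p :: "'m::comm_monoid_add \<Rightarrow>\<^sub>0 'k::comm_ring_1"
  shows "poly_filter Q (p * single u c) = poly_filter (\<lambda>m. Q (m + u)) p * single u c"
  by (induction p rule: poly_induct)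
     (auto simp: poly_filter_add mult_single distrib_right)

section \<open>Weights and degrees of edge monomials\<close>

text \<open>Rational values for every coefficient ring, so that one linear algebra serves all
  characteristics.\<close>

definition wt :: "('a \<Rightarrow> rat) \<Rightarrow> ('a \<Rightarrow>\<^sub>0 nat) \<Rightarrow> rat" where
  "wt y m = (\<Sum>e\<in>keys m. y e * of_nat (lookup m e))"

lemma wt_superset:
  "finite X \<Longrightarrow> keys m \<subseteq> X \<Longrightarrow> wt y m = (\<Sum>e\<in>X. y e * of_nat (lookup m e))"
  unfolding wt_def by (intro sum.mono_neutral_left) (auto simp: in_keys_iff)

lemma wt_zero [simp]: "wt y 0 = 0"
  by (simp add: wt_def)

lemma wt_add: "wt y (a + b) = wt y a + wt y b"
proof -
  have "wt y (a + b) = (\<Sum>e\<in>keys a \<union> keys b. y e * of_nat (lookup (a + b) e))"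
    by (intro wt_superset) (auto simp: keys_add_nat)
  also have "\<dots> = (\<Sum>e\<in>keys a \<union> keys b. y e * of_nat (lookup a e)) +
                  (\<Sum>e\<in>keys a \<union> keys b. y e * of_nat (lookup b e))"
    by (simp add: lookup_add algebra_simps sum.distrib)
  also have "\<dots> = wt y a + wt y b"
    by (intro arg_cong2[where f="(+)"] wt_superset[symmetric]) auto
  finally show ?thesis .
qed

lemma wt_sum: "wt y (sum f X) = (\<Sum>x\<in>X. wt y (f x))"
  by (induction X rule: infinite_finite_induct) (auto simp: wt_add)

lemma wt_single [simp]: "wt y (single e n) = y e * of_nat n"
  by (subst wt_superset[of "{e}"]) auto

lemma mono_img_superset:
  "finite X \<Longrightarrow> keys m \<subseteq> X \<Longrightarrow> mono_img m = (\<Sum>e\<in>X. \<Sum>v\<in>e. single v (lookup m e))"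
  unfolding mono_img_def by (intro sum.mono_neutral_left) (auto simp: in_keys_iff)

lemma mono_img_zero [simp]: "mono_img 0 = 0"
  by (simp add: mono_img_def)

lemma mono_img_add: "mono_img (a + b) = mono_img a + mono_img b"
proof -
  have "mono_img (a + b) = (\<Sum>e\<in>keys a \<union> keys b. \<Sum>v\<in>e. single v (lookup (a + b) e))"
    by (intro mono_img_superset) (auto simp: keys_add_nat)
  also have "\<dots> = (\<Sum>e\<in>keys a \<union> keys b. \<Sum>v\<in>e. single v (lookup a e)) +
                  (\<Sum>e\<in>keys a \<union> keys b. \<Sum>v\<in>e. single v (lookup b e))"
    by (simp add: lookup_add single_add sum.distrib)
  also have "\<dots> = mono_img a + mono_img b"
    by (intro arg_cong2[where f="(+)"] mono_img_superset[symmetric]) auto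
  finally show ?thesis .
qed

lemma mono_img_sum: "mono_img (sum f X) = (\<Sum>x\<in>X. mono_img (f x))"
  by (induction X rule: infinite_finite_induct) (auto simp: mono_img_add)

lemma mono_img_single: "mono_img (single e n) = (\<Sum>v\<in>e. single v n)"
  by (subst mono_img_superset[of "{e}"]) auto

lemma lookup_mono_img:
  assumes "finite X" "keys m \<subseteq> X" "\<forall>e\<in>X. finite e"
  shows "lookup (mono_img m) v = (\<Sum>e\<in>{e\<in>X. v \<in> e}. lookup m e)"
proof -
  have "lookup (mono_img m) v = (\<Sum>e\<in>X. \<Sum>w\<in>e. lookup (single w (lookup m e)) v)"
    by (simp add: mono_img_superset[OF assms(1,2)] lookup_sum)
  also have "\<dots> = (\<Sum>e\<in>X. if v \<in> e then lookup m e else 0)"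
    using assms(3) by (intro sum.cong) (auto simp: lookup_single when_def sum.delta)
  finally show ?thesis using assms(1) by (simp add: sum.inter_filter)
qed

text \<open>A weight that is a sum over end points factors through the degree and cannot separate
  two monomials of equal degree. Such weights are the trivial ones in all later arguments.\<close>

lemma wt_potential:
  assumes "finite X" "keys m \<subseteq> X" "\<forall>e\<in>X. finite e" "\<forall>e\<in>keys m. y e = (\<Sum>v\<in>e. \<phi> v)"
  shows "wt y m = wt \<phi> (mono_img m)"
proof -
  have "wt \<phi> (mono_img m) = (\<Sum>e\<in>keys m. \<Sum>v\<in>e. \<phi> v * of_nat (lookup m e))"
    by (simp add: mono_img_def wt_sum)
  also have "\<dots> = wt y m"
    unfolding wt_def using assms(4) by (intro sum.cong) (auto simp: sum_distrib_right)
  finally show ?thesis ..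
qed

section \<open>Linear algebra\<close>

text \<open>Gaussian elimination on the equations in \<open>Y\<close>. It serves over the rationals
  for exponent vectors and over \<open>'k\<close> for coefficients of polynomials.\<close>

lemma homogeneous_system_nontrivial:
  fixes M :: "'x \<Rightarrow> 'y \<Rightarrow> 'f::field"
  assumes "finite Y" "finite X" "card Y < card X"
  shows "\<exists>c. (\<exists>x\<in>X. c x \<noteq> 0) \<and> (\<forall>y\<in>Y. (\<Sum>x\<in>X. c x * M x y) = 0)"
  using assms
proof (induction Y arbitrary: X M rule: finite_induct)
  case empty
  then have "X \<noteq> {}" by auto
  then show ?case by (intro exI[of _ "\<lambda>_. 1"]) auto
next
  case (insert y Y)
  show ?case
  proof (cases "\<forall>x\<in>X. M x y = 0")
    case True
    have "card Y < card X" using insert by simp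
    from insert.IH[OF insert.prems(1) this, of M] True show ?thesis by auto
  next
    case False
    then obtain x0 where x0: "x0 \<in> X" "M x0 y \<noteq> 0" by auto
    define X' where "X' = X - {x0}"
    have X': "finite X'" "X = insert x0 X'" "x0 \<notin> X'" using x0 insert.prems by (auto simp: X'_def)
    then have "card Y < card X'" using insert by simp
    \<comment> \<open>\<open>x0\<close> is the pivot: the coefficients of each other unknown are
      corrected by the multiple of those of \<open>x0\<close> that clears equation \<open>y\<close>;
      afterwards \<open>c0\<close> is forced by that equation.\<close>
    from insert.IH[OF X'(1) this, of "\<lambda>x z. M x z - M x y / M x0 y * M x0 z"]
    obtain c where c: "\<exists>x\<in>X'. c x \<noteq> 0"
      "\<forall>z\<in>Y. (\<Sum>x\<in>X'. c x * (M x z - M x y / M x0 y * M x0 z)) = 0" by auto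
    define c0 where "c0 = - (\<Sum>x\<in>X'. c x * M x y) / M x0 y"
    define d where "d = (\<lambda>x. if x = x0 then c0 else c x)"
    have dsum: "(\<Sum>x\<in>X. d x * M x z) = c0 * M x0 z + (\<Sum>x\<in>X'. c x * M x z)" for z
    proof -
      have "(\<Sum>x\<in>X'. d x * M x z) = (\<Sum>x\<in>X'. c x * M x z)"
        using X'(3) by (intro sum.cong) (auto simp: d_def)
      then show ?thesis using X' by (simp add: d_def)
    qed
    have "(\<Sum>x\<in>X. d x * M x z) = 0" if "z \<in> insert y Y" for z
    proof (cases "z = y")
      case True
      then show ?thesis using x0 by (simp add: dsum c0_def)
    next
      case False
      then have "z \<in> Y" using that by simp
      then have "(\<Sum>x\<in>X'. c x * M x z) - (\<Sum>x\<in>X'. c x * M x y) / M x0 y * M x0 z = 0"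
        using c(2) by (simp add: right_diff_distrib sum_subtractf sum_distrib_right sum_divide_distrib mult.assoc)
      then show ?thesis by (simp add: dsum c0_def)
    qed
    moreover have "\<exists>x\<in>X. d x \<noteq> 0" using c(1) X' by (auto simp: d_def)
    ultimately show ?thesis by blast
  qed
qed

lemma clear_denominators:
  fixes c :: "'x \<Rightarrow> rat"
  assumes "finite X"
  shows "\<exists>N::nat. N > 0 \<and> (\<forall>x\<in>X. \<exists>k::int. c x * of_nat N = of_int k)"
  using assms
proof (induction X rule: finite_induct)
  case empty
  then show ?case by (intro exI[of _ 1]) auto
next
  case (insert x X)
  then obtain N where N: "N > 0" "\<forall>x\<in>X. \<exists>k::int. c x * of_nat N = of_int k" by auto
  obtain a b where ab: "c x = of_int a / of_int b" "b > 0"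
    by (metis Fract_of_int_quotient quotient_of_div quotient_of_denom_pos surj_pair)
  have "c z * of_nat (N * nat b) = of_int k * of_int b" if "c z * of_nat N = of_int k" for z k
    using that ab(2) by (simp add: mult.assoc[symmetric])
  then have "\<forall>z\<in>X. \<exists>k::int. c z * of_nat (N * nat b) = of_int k"
    using N(2) by (metis of_int_mult)
  moreover have "c x * of_nat (N * nat b) = of_int (a * int N)"
    using ab by simp
  ultimately show ?case using N(1) ab(2)
    by (intro exI[of _ "N * nat b"]) (auto simp del: of_nat_mult of_int_mult)
qed

section \<open>Ideals of the polynomial ring in the edge variables\<close>

lemma zero_polys_on [simp]: "0 \<in> polys_on E"
  by (simp add: polys_on_def)

lemma single_polys_on: "keys m \<subseteq> E \<Longrightarrow> single m c \<in> polys_on E"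
  by (auto simp: polys_on_def lookup_single in_keys_iff when_def split: if_splits)

lemma one_polys_on [simp]: "1 \<in> polys_on E"
  by (simp add: polys_on_def)

lemma add_polys_on: "p \<in> polys_on E \<Longrightarrow> q \<in> polys_on E \<Longrightarrow> p + q \<in> polys_on E"
  using Poly_Mapping.keys_add[of p q] by (auto simp: polys_on_def)

lemma uminus_polys_on: "p \<in> polys_on E \<Longrightarrow> - p \<in> polys_on E"
  by (auto simp: polys_on_def in_keys_iff)

lemma diff_polys_on: "p \<in> polys_on E \<Longrightarrow> q \<in> polys_on E \<Longrightarrow> p - q \<in> polys_on E"
  using add_polys_on[of p E "-q"] uminus_polys_on[of q E] by simp

lemma mult_polys_on: "p \<in> polys_on E \<Longrightarrow> q \<in> polys_on E \<Longrightarrow> p * q \<in> polys_on E"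
  using Poly_Mapping.keys_mult[of p q] by (fastforce simp: polys_on_def keys_add_nat)

lemma sum_polys_on: "(\<And>x. x \<in> X \<Longrightarrow> f x \<in> polys_on E) \<Longrightarrow> sum f X \<in> polys_on E"
  by (induction X rule: infinite_finite_induct) (auto intro: add_polys_on)

lemma polys_on_mono: "E' \<subseteq> E \<Longrightarrow> polys_on E' \<subseteq> polys_on E"
  by (auto simp: polys_on_def)

lemma poly_filter_polys_on: "p \<in> polys_on E \<Longrightarrow> poly_filter Q p \<in> polys_on E"
  by (auto simp: polys_on_def keys_poly_filter)

lemma poly_ring_simps [simp]:
  "carrier (poly_ring E) = polys_on E" "mult (poly_ring E) = (*)" "one (poly_ring E) = 1"
  "zero (poly_ring E) = 0" "add (poly_ring E) = (+)"
  by (simp_all add: poly_ring_def)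

lemma cring_poly_ring: "cring (poly_ring E :: ('v, 'k::comm_ring_1) epoly ring)"
proof (rule cringI)
  show "abelian_group (poly_ring E :: ('v, 'k) epoly ring)"
    by (rule abelian_groupI)
       (auto intro: add_polys_on simp: algebra_simps intro!: bexI[OF _ uminus_polys_on])
  show "Group.comm_monoid (poly_ring E :: ('v, 'k) epoly ring)"
    by (rule comm_monoidI) (auto intro: mult_polys_on simp: algebra_simps)
qed (auto simp: algebra_simps)

lemma ideal_poly_ringI:
  fixes I :: "('v, 'k::comm_ring_1) epoly set"
  assumes "I \<subseteq> polys_on E" "0 \<in> I" "\<And>x y. x \<in> I \<Longrightarrow> y \<in> I \<Longrightarrow> x + y \<in> I"
    "\<And>a x. a \<in> polys_on E \<Longrightarrow> x \<in> I \<Longrightarrow> a * x \<in> I"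
  shows "ideal I (poly_ring E)"
proof -
  interpret R: cring "poly_ring E :: ('v, 'k) epoly ring" by (rule cring_poly_ring)
  have neg: "- x \<in> I" if "x \<in> I" for x
    using assms(4)[OF uminus_polys_on[OF one_polys_on] that] by simp
  have inv: "\<ominus>\<^bsub>poly_ring E\<^esub> x = - x" if "x \<in> I" for x :: "('v, 'k) epoly"
    using that assms(1) by (intro R.minus_equality) (auto intro: uminus_polys_on)
  have r: "a * x \<in> I" if "a \<in> I" "x \<in> polys_on E" for a x
    using assms(4)[OF that(2,1)] by (simp add: mult.commute)
  show ?thesis
  proof (rule idealI)
    show "subgroup I (add_monoid (poly_ring E))"
      using assms neg inv by (intro subgroup.intro) (auto simp: a_inv_def)
  qed (use assms R.ring_axioms r in auto)
qed

lemma ideal_poly_ringD: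
  fixes I :: "('v, 'k::comm_ring_1) epoly set"
  assumes "ideal I (poly_ring E)"
  shows "I \<subseteq> polys_on E" "0 \<in> I" "\<And>x y. x \<in> I \<Longrightarrow> y \<in> I \<Longrightarrow> x + y \<in> I"
    "\<And>a x. a \<in> polys_on E \<Longrightarrow> x \<in> I \<Longrightarrow> a * x \<in> I"
proof -
  interpret ideal I "poly_ring E" by fact
  show "I \<subseteq> polys_on E" using a_subset by simp
  show "0 \<in> I" using additive_subgroup.zero_closed[OF is_additive_subgroup] by simp
  show "x + y \<in> I" if "x \<in> I" "y \<in> I" for x y using additive_subgroup.a_closed[OF is_additive_subgroup that] by simp
  show "a * x \<in> I" if "a \<in> polys_on E" "x \<in> I" for a x using I_l_closed[of x a] that by simp
qed

lemma ideal_poly_ring_sum: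
  fixes I :: "('v, 'k::comm_ring_1) epoly set"
  assumes "ideal I (poly_ring E)" "\<And>x. x \<in> X \<Longrightarrow> f x \<in> I"
  shows "sum f X \<in> I"
  using assms(2)
  by (induction X rule: infinite_finite_induct) (auto intro: ideal_poly_ringD[OF assms(1)])

lemma ideal_poly_ring_uminus:
  fixes I :: "('v, 'k::comm_ring_1) epoly set"
  assumes "ideal I (poly_ring E)" "x \<in> I"
  shows "- x \<in> I"
  using ideal_poly_ringD(4)[OF assms(1) uminus_polys_on[OF one_polys_on] assms(2)] by simp

text \<open>Generated ideals with explicit coefficients, because syzygies, constant terms and
  projections act on the coefficients \<open>c f\<close>.\<close>

definition comb :: "'v set set \<Rightarrow> ('v, 'k::comm_ring_1) epoly set \<Rightarrow> ('v, 'k) epoly set" where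
  "comb E A = {p. \<exists>c. (\<forall>f\<in>A. c f \<in> polys_on E) \<and> p = (\<Sum>f\<in>A. c f * f)}"

lemma ideal_comb:
  assumes "A \<subseteq> polys_on E"
  shows "ideal (comb E A) (poly_ring E)"
proof (rule ideal_poly_ringI)
  show "comb E A \<subseteq> polys_on E"
    using assms by (auto simp: comb_def intro!: sum_polys_on mult_polys_on)
  show "0 \<in> comb E A" by (auto simp: comb_def intro!: exI[of _ "\<lambda>_. 0"])
  show "x + y \<in> comb E A" if xy: "x \<in> comb E A" "y \<in> comb E A" for x y
  proof -
    obtain c where c: "\<forall>f\<in>A. c f \<in> polys_on E" "x = (\<Sum>f\<in>A. c f * f)"
      using xy(1) unfolding comb_def by blast
    obtain d where d: "\<forall>f\<in>A. d f \<in> polys_on E" "y = (\<Sum>f\<in>A. d f * f)"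
      using xy(2) unfolding comb_def by blast
    show ?thesis unfolding comb_def using c d
      by (auto simp: sum.distrib[symmetric] distrib_right[symmetric]
        intro!: exI[of _ "\<lambda>f. c f + d f"] add_polys_on)
  qed
  show "a * x \<in> comb E A" if xy: "a \<in> polys_on E" "x \<in> comb E A" for a x
  proof -
    obtain c where "\<forall>f\<in>A. c f \<in> polys_on E" "x = (\<Sum>f\<in>A. c f * f)"
      using xy(2) unfolding comb_def by blast
    then show ?thesis using xy(1) by (auto simp: comb_def sum_distrib_left mult.assoc
        intro!: exI[of _ "\<lambda>f. a * c f"] mult_polys_on)
  qed
qed

lemma comb_subset_ideal:
  assumes "ideal I (poly_ring E)" "A \<subseteq> I"
  shows "comb E A \<subseteq> I"
  using assms ideal_poly_ringD[OF assms(1)]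
  by (auto simp: comb_def intro!: ideal_poly_ring_sum[OF assms(1)])

lemma subset_comb: "finite A \<Longrightarrow> A \<subseteq> comb E A"
  by (auto simp: comb_def if_distrib if_distribR sum.delta cong: if_cong
      intro!: exI[of _ "\<lambda>g. if g = _ then 1 else 0"])

lemma genideal_eq_comb:
  assumes "finite A" "A \<subseteq> polys_on E"
  shows "genideal (poly_ring E) A = comb E A"
proof
  show "genideal (poly_ring E) A \<subseteq> comb E A"
    unfolding genideal_def using ideal_comb[OF assms(2)] subset_comb[OF assms(1)] by blast
  show "comb E A \<subseteq> genideal (poly_ring E) A"
    unfolding genideal_def using comb_subset_ideal by blast
qed

section \<open>Toric ideals\<close>

text \<open>The kernel of the linear map sending each monomial to a basis element named by its value
  under \<open>g\<close>. The toric ideal and the auxiliary primes below it all have this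
  form.\<close>

definition graded_kernel ::
  "'v set set \<Rightarrow> (('v set \<Rightarrow>\<^sub>0 nat) \<Rightarrow> 'x) \<Rightarrow> ('v, 'k::comm_ring_1) epoly set" where
  "graded_kernel E g = {p \<in> polys_on E. \<forall>\<gamma>. coeff_sum (\<lambda>m. g m = \<gamma>) p = 0}"

lemma lookup_toric_map: "lookup (toric_map p) \<gamma> = coeff_sum (\<lambda>m. mono_img m = \<gamma>) p"
  by (simp add: toric_map_def lookup_sum coeff_sum_def lookup_single when_def)

lemma toric_ideal_eq_kernel: "toric_ideal E = graded_kernel E mono_img"
  unfolding toric_ideal_def graded_kernel_def
  by (simp add: poly_mapping_eq_iff fun_eq_iff lookup_toric_map)

lemma ideal_graded_kernel:
  fixes g :: "('v set \<Rightarrow>\<^sub>0 nat) \<Rightarrow> 'x::cancel_comm_monoid_add"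
  assumes "\<And>m n. g (m + n) = g m + g n"
  shows "ideal (graded_kernel E g :: ('v, 'k::comm_ring_1) epoly set) (poly_ring E)"
proof (rule ideal_poly_ringI)
  show "a * x \<in> graded_kernel E g" if a: "a \<in> polys_on E" "x \<in> graded_kernel E g"
    for a x :: "('v, 'k) epoly"
  proof -
    have "coeff_sum (\<lambda>n. g (m + n) = \<gamma>) x = 0" for m \<gamma>
    proof (cases "\<exists>\<gamma>'. \<gamma> = g m + \<gamma>'")
      case True
      then obtain \<gamma>' where "\<gamma> = g m + \<gamma>'" by auto
      then show ?thesis using a(2) by (simp add: assms graded_kernel_def)
    next
      case False
      then show ?thesis by (auto simp: assms coeff_sum_def intro!: sum.neutral)
    qed
    then show ?thesis using a by (auto simp: graded_kernel_def coeff_sum_mult intro: mult_polys_on)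
  qed
qed (auto simp: graded_kernel_def coeff_sum_add intro: add_polys_on)

lemma ideal_toric_ideal: "ideal (toric_ideal E :: ('v, 'k::comm_ring_1) epoly set) (poly_ring E)"
  unfolding toric_ideal_eq_kernel by (rule ideal_graded_kernel) (simp add: mono_img_add)

lemma binomial_in_graded_kernel:
  "keys a \<subseteq> E \<Longrightarrow> keys b \<subseteq> E \<Longrightarrow> g a = g b \<Longrightarrow> single a 1 - single b 1 \<in> graded_kernel E g"
  by (auto simp: graded_kernel_def coeff_sum_diff intro!: diff_polys_on single_polys_on)

lemma graded_kernel_subset_ideal:
  fixes J :: "('v, 'k::comm_ring_1) epoly set"
  assumes J: "ideal J (poly_ring E)"
    and bin: "\<And>a b. keys a \<subseteq> E \<Longrightarrow> keys b \<subseteq> E \<Longrightarrow> g a = g b \<Longrightarrow> single a 1 - single b 1 \<in> J"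
  shows "graded_kernel E g \<subseteq> J"
proof
  fix p :: "('v, 'k) epoly"
  assume "p \<in> graded_kernel E g"
  then show "p \<in> J"
  proof (induction "card (keys p)" arbitrary: p rule: less_induct)
    case less
    show ?case
    proof (cases "p = 0")
      case True
      then show ?thesis using ideal_poly_ringD[OF J] by simp
    next
      case False
      then obtain m where m: "m \<in> keys p" by fastforce
      \<comment> \<open>The coefficients in the class of \<open>m\<close> sum to zero and that of
        \<open>m\<close> is not zero, so the class contains a second monomial. Exchanging
        \<open>m\<close> for it shortens \<open>p\<close>.\<close>
      have "\<exists>n\<in>keys p. n \<noteq> m \<and> g n = g m"
      proof (rule ccontr)
        assume "\<not> ?thesis"
        then have "coeff_sum (\<lambda>n. g n = g m) p = coeff_sum (\<lambda>n. n = m) p"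
          unfolding coeff_sum_def by (intro sum.cong) auto
        then show False using less.prems m
          by (auto simp: graded_kernel_def lookup_eq_coeff_sum[symmetric] in_keys_iff)
      qed
      then obtain n where n: "n \<in> keys p" "n \<noteq> m" "g n = g m" by auto
      define c where "c = lookup p m"
      define b :: "('v, 'k) epoly" where "b = single m 1 - single n 1"
      have on: "keys m \<subseteq> E" "keys n \<subseteq> E"
        using less.prems m n by (auto simp: graded_kernel_def polys_on_def)
      have bJ: "single 0 c * b \<in> J"
        unfolding b_def using on n bin ideal_poly_ringD(4)[OF J] single_polys_on[of 0 E c] by auto
      define q where "q = p - single 0 c * b"
      have q: "q = p - single m c + single n c"
        by (simp add: q_def b_def right_diff_distrib mult_single)
      have "keys q \<subseteq> keys p - {m}"
        using n m by (auto simp: q in_keys_iff lookup_add lookup_minus lookup_single when_def c_def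
            split: if_splits)
      then have "card (keys q) < card (keys p)"
        using m by (meson card_Diff1_less card_mono finite_Diff finite_keys le_less_trans)
      moreover have "q \<in> graded_kernel E g"
        using less.prems on n unfolding q graded_kernel_def
        by (auto simp: coeff_sum_add coeff_sum_diff intro!: add_polys_on diff_polys_on single_polys_on)
      ultimately have "q \<in> J" using less.hyps by blast
      then show ?thesis using ideal_poly_ringD(3)[OF J, of q "single 0 c * b"] bJ by (simp add: q_def)
    qed
  qed
qed

section \<open>Binomials\<close>

text \<open>No monomial order is involved: one presentation of the binomial is chosen. In
  characteristic 2 both orders of the two monomials present the same polynomial.\<close>

definition bin_lead :: "('v, 'k::comm_ring_1) epoly \<Rightarrow> 'v set \<Rightarrow>\<^sub>0 nat" where
  "bin_lead f = fst (SOME ab. f = single (fst ab) 1 - single (snd ab) 1)"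
definition bin_trail :: "('v, 'k::comm_ring_1) epoly \<Rightarrow> 'v set \<Rightarrow>\<^sub>0 nat" where
  "bin_trail f = snd (SOME ab. f = single (fst ab) 1 - single (snd ab) 1)"

lemma binomial_eq:
  assumes "is_binomial f"
  shows "f = single (bin_lead f) 1 - single (bin_trail f) 1"
proof -
  have "\<exists>ab. f = single (fst ab) 1 - single (snd ab) 1"
    using assms by (auto simp: is_binomial_def)
  from someI_ex[OF this] show ?thesis by (simp add: bin_lead_def bin_trail_def)
qed

lemma binomial_props:
  fixes f :: "('v, 'k::comm_ring_1) epoly"
  assumes "is_binomial f" "f \<in> toric_ideal E" "f \<noteq> 0"
  shows "keys (bin_lead f) \<subseteq> E" "keys (bin_trail f) \<subseteq> E" "bin_lead f \<noteq> bin_trail f"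
    "mono_img (bin_lead f) = mono_img (bin_trail f)"
proof -
  let ?a = "bin_lead f" and ?b = "bin_trail f"
  have f: "f = single ?a 1 - single ?b 1" by (rule binomial_eq[OF assms(1)])
  show ne: "?a \<noteq> ?b"
  proof
    assume "?a = ?b"
    then have "f = 0" by (subst f) simp
    then show False using assms(3) by simp
  qed
  have "lookup f ?a = 1" "lookup f ?b = - 1"
    using ne by (subst f, simp add: lookup_minus lookup_single when_def)+
  then have "?a \<in> keys f" "?b \<in> keys f" by (simp_all add: in_keys_iff)
  then show "keys ?a \<subseteq> E" "keys ?b \<subseteq> E" using assms(2) by (auto simp: toric_ideal_def polys_on_def)
  have "coeff_sum (\<lambda>m. mono_img m = mono_img ?a) f = 0"
    using assms(2) by (auto simp: toric_ideal_eq_kernel graded_kernel_def)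
  then show "mono_img ?a = mono_img ?b"
    by (subst (asm) f) (auto simp: coeff_sum_diff split: if_splits)
qed

lemma min_system_comb:
  "minimal_binomial_system E I A \<longleftrightarrow> finite A \<and> A \<subseteq> polys_on E \<and> (\<forall>f\<in>A. is_binomial f) \<and>
     comb E A = I \<and> (\<forall>A'. A' \<subset> A \<longrightarrow> comb E A' \<noteq> I)"
proof (cases "finite A \<and> A \<subseteq> polys_on E")
  case True
  then have k: "genideal (poly_ring E) A' = comb E A'" if "A' \<subseteq> A" for A'
    using that by (intro genideal_eq_comb) (auto intro: finite_subset)
  have "(\<forall>A'. A' \<subset> A \<longrightarrow> genideal (poly_ring E) A' \<noteq> I) \<longleftrightarrow> (\<forall>A'. A' \<subset> A \<longrightarrow> comb E A' \<noteq> I)"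
    using k by (intro all_cong1 imp_cong refl) (simp add: less_imp_le)
  then show ?thesis unfolding minimal_binomial_system_def k[OF order_refl] by (intro conj_cong refl)
next
  case False
  then show ?thesis unfolding minimal_binomial_system_def by argo
qed

lemma comb_remove_redundant:
  assumes "finite A" "A \<subseteq> polys_on E" "f \<in> A" "f \<in> comb E (A - {f})"
  shows "comb E (A - {f}) = comb E A"
proof
  have id: "ideal (comb E (A - {f})) (poly_ring E)" using assms(2) by (intro ideal_comb) auto
  show "comb E A \<subseteq> comb E (A - {f})"
    using assms subset_comb[of "A - {f}" E] by (intro comb_subset_ideal[OF id]) auto
  show "comb E (A - {f}) \<subseteq> comb E A"
    using assms subset_comb[of A E] by (intro comb_subset_ideal ideal_comb) auto
qed

lemma min_system_irredundant:
  assumes "minimal_binomial_system E I A" "f \<in> A"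
  shows "f \<notin> comb E (A - {f})"
proof
  assume "f \<in> comb E (A - {f})"
  then have "comb E (A - {f}) = I"
    using comb_remove_redundant[of A E f] assms by (auto simp: min_system_comb)
  moreover have "A - {f} \<subset> A" using assms(2) by auto
  ultimately show False using assms(1) by (auto simp: min_system_comb)
qed

lemma min_system_exists:
  assumes "finite A" "A \<subseteq> polys_on E" "\<forall>f\<in>A. is_binomial f" "comb E A = I"
  shows "\<exists>A'\<subseteq>A. minimal_binomial_system E I A'"
proof -
  define P where "P B \<longleftrightarrow> B \<subseteq> A \<and> comb E B = I" for B
  have "P A" using assms(4) by (simp add: P_def)
  then obtain A' where "P A'" and min: "\<And>B. P B \<Longrightarrow> card A' \<le> card B"
    using ex_has_least_nat[of P A card] by auto
  then have A': "A' \<subseteq> A" "comb E A' = I" by (simp_all add: P_def)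
  have fin: "finite A'" using A'(1) assms(1) finite_subset by blast
  have "minimal_binomial_system E I A'"
    unfolding min_system_comb
  proof (intro conjI allI impI)
    fix B assume B: "B \<subset> A'"
    show "comb E B \<noteq> I"
    proof
      assume "comb E B = I"
      then have "card A' \<le> card B" using A'(1) B by (intro min) (auto simp: P_def)
      then show False using psubset_card_mono[OF fin B] by simp
    qed
  qed (use A' assms fin in auto)
  then show ?thesis using A'(1) by blast
qed

lemma comb_toric_idealI:
  assumes "finite A" "A \<subseteq> toric_ideal E"
    "\<And>a b. keys a \<subseteq> E \<Longrightarrow> keys b \<subseteq> E \<Longrightarrow> mono_img a = mono_img b \<Longrightarrow> single a 1 - single b 1 \<in> comb E A"
  shows "comb E A = toric_ideal E"
proof
  show "comb E A \<subseteq> toric_ideal E"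
    by (rule comb_subset_ideal[OF ideal_toric_ideal assms(2)])
  have "A \<subseteq> polys_on E" using assms(2) by (auto simp: toric_ideal_def)
  then show "toric_ideal E \<subseteq> comb E A"
    unfolding toric_ideal_eq_kernel by (intro graded_kernel_subset_ideal ideal_comb assms(3))
qed

section \<open>The height of a toric ideal as the rank of its relation lattice\<close>

section \<open>Independent edge sets\<close>

text \<open>Linear independence of the incidence vectors of \<open>F\<close>: an integral relation
  is split into its positive and negative parts. Thus \<open>max_indep\<close> describes a basis of
  the column space, and \<open>card (E - F)\<close> is the dimension of the space of
  relations.\<close>

definition mindep :: "'v set set \<Rightarrow> bool" where
  "mindep F \<longleftrightarrow> (\<forall>u v. keys u \<subseteq> F \<longrightarrow> keys v \<subseteq> F \<longrightarrow> mono_img u = mono_img v \<longrightarrow> u = v)"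

definition max_indep :: "'v set set \<Rightarrow> 'v set set \<Rightarrow> bool" where
  "max_indep E F \<longleftrightarrow> F \<subseteq> E \<and> mindep F \<and> (\<forall>e\<in>E - F. \<not> mindep (insert e F))"

lemma mindepD: "mindep F \<Longrightarrow> keys u \<subseteq> F \<Longrightarrow> keys v \<subseteq> F \<Longrightarrow> mono_img u = mono_img v \<Longrightarrow> u = v"
  by (auto simp: mindep_def)

lemma max_indep_exists:
  assumes "finite E"
  shows "\<exists>F. max_indep E F"
proof -
  let ?P = "\<lambda>F. F \<subseteq> E \<and> mindep F"
  have "?P {}" by (auto simp: mindep_def)
  then obtain F where F: "?P F" "\<And>G. ?P G \<Longrightarrow> card G \<le> card F"
    using ex_has_greatest_nat[of ?P "{}" card "Suc (card E)"] assms by (auto simp: card_mono less_Suc_eq_le)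
  have "\<not> mindep (insert e F)" if "e \<in> E - F" for e
  proof
    assume "mindep (insert e F)"
    then have "card (insert e F) \<le> card F" using F that by auto
    then show False using that F(1) assms finite_subset[of F E] by auto
  qed
  then show ?thesis using F(1) by (auto simp: max_indep_def)
qed

lemma split_single: "lookup m e = n \<Longrightarrow> \<exists>m'. m = m' + single e n \<and> keys m' = keys m - {e}"
  for m :: "'a \<Rightarrow>\<^sub>0 nat"
  by (intro exI[of _ "m - single e n"] conjI poly_mapping_eqI)
     (auto simp: lookup_add lookup_minus lookup_single when_def in_keys_iff split: if_splits)

text \<open>The fundamental circuit of \<open>e\<close>. Equal exponents at \<open>e\<close> could
  be cancelled and would leave a nontrivial relation inside \<open>F\<close>.\<close>

lemma max_indep_circuit:
  assumes "max_indep E F" "e \<in> E - F"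
  shows "\<exists>u v. keys u \<subseteq> insert e F \<and> keys v \<subseteq> insert e F \<and> mono_img u = mono_img v \<and>
    lookup u e \<noteq> lookup v e"
proof -
  have "\<not> mindep (insert e F)" using assms by (auto simp: max_indep_def)
  then obtain u v where uv: "keys u \<subseteq> insert e F" "keys v \<subseteq> insert e F" "mono_img u = mono_img v" "u \<noteq> v"
    by (auto simp: mindep_def)
  have "lookup u e \<noteq> lookup v e"
  proof
    assume eq: "lookup u e = lookup v e"
    obtain u' where u': "u = u' + single e (lookup v e)" "keys u' = keys u - {e}"
      using split_single[OF eq] by auto
    obtain v' where v': "v = v' + single e (lookup v e)" "keys v' = keys v - {e}"
      using split_single[OF refl, of v e] by auto
    have "mono_img u = mono_img u' + mono_img (single e (lookup v e))"
      by (subst u'(1)) (rule mono_img_add)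
    moreover have "mono_img v = mono_img v' + mono_img (single e (lookup v e))"
      by (subst v'(1)) (rule mono_img_add)
    ultimately have "mono_img u' = mono_img v'" using uv(3) by simp
    then have "u' = v'" using uv assms u'(2) v'(2) by (intro mindepD[of F]) (auto simp: max_indep_def)
    then show False using u'(1) v'(1) uv(4) by simp
  qed
  then show ?thesis using uv by blast
qed

section \<open>The height of a toric ideal\<close>

text \<open>The induced map \<open>H\<close> is a ring map into polynomials in variables indexed by
  \<open>nat\<close>. Their exponent vectors carry a compatible linear order, so the target is a
  domain and the kernel is prime.\<close>

lemma primeideal_graded_kernel:
  fixes g :: "('v set \<Rightarrow>\<^sub>0 nat) \<Rightarrow> (nat \<Rightarrow>\<^sub>0 nat)"
  assumes add: "\<And>m n. g (m + n) = g m + g n"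
  shows "primeideal (graded_kernel E g :: ('v, 'k::field) epoly set) (poly_ring E)"
proof -
  define H :: "('v, 'k) epoly \<Rightarrow> (nat \<Rightarrow>\<^sub>0 nat) \<Rightarrow>\<^sub>0 'k" where
    "H p = (\<Sum>m\<in>keys p. single (g m) (lookup p m))" for p
  have lookup_H: "lookup (H p) \<gamma> = coeff_sum (\<lambda>m. g m = \<gamma>) p" for p \<gamma>
    by (simp add: H_def lookup_sum coeff_sum_def lookup_single when_def)
  have H_add: "H (p + q) = H p + H q" for p q
    by (rule poly_mapping_eqI) (simp add: lookup_H coeff_sum_add lookup_add)
  have H_single: "H (single m c) = single (g m) c" for m c
    by (rule poly_mapping_eqI) (simp add: lookup_H lookup_single when_def)
  have H_0: "H 0 = 0" by (simp add: H_def)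
  have H_smult: "H (single m c * q) = single (g m) c * H q" for m c q
    by (induction q rule: poly_induct) (auto simp: H_add H_single H_0 mult_single add distrib_left)
  have H_mult: "H (p * q) = H p * H q" for p q
    by (induction p rule: poly_induct) (auto simp: H_add H_single H_0 H_smult distrib_right)
  have ker: "p \<in> graded_kernel E g \<longleftrightarrow> p \<in> polys_on E \<and> H p = 0" for p
    by (simp add: graded_kernel_def poly_mapping_eq_iff fun_eq_iff lookup_H)
  have g0: "g 0 = 0" using add[of 0 0] by simp
  have "H 1 = 1" using H_single[of 0 1] by (simp add: g0)
  then have "(1 :: ('v, 'k) epoly) \<notin> graded_kernel E g" by (simp add: ker)
  then show ?thesis
    by (intro primeidealI ideal_graded_kernel add cring_poly_ring) (auto simp: ker H_mult)
qed

lemma graded_kernel_mono: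
  assumes gg: "\<And>m n. keys m \<subseteq> E \<Longrightarrow> keys n \<subseteq> E \<Longrightarrow> g m = g n \<longleftrightarrow> g' m = g' n"
  shows "graded_kernel E g \<subseteq> (graded_kernel E g' :: ('v, 'k::comm_ring_1) epoly set)"
proof
  fix p :: "('v, 'k) epoly" assume p: "p \<in> graded_kernel E g"
  have on: "keys m \<subseteq> E" if "m \<in> keys p" for m
    using p that by (auto simp: graded_kernel_def polys_on_def)
  have "coeff_sum (\<lambda>m. g' m = \<gamma>) p = 0" for \<gamma>
  proof (cases "\<exists>m0\<in>keys p. g' m0 = \<gamma>")
    case True
    then obtain m0 where m0: "m0 \<in> keys p" "g' m0 = \<gamma>" by auto
    have "coeff_sum (\<lambda>m. g' m = \<gamma>) p = coeff_sum (\<lambda>m. g m = g m0) p"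
      unfolding coeff_sum_def using m0 gg on by (intro sum.cong) auto
    then show ?thesis using p by (simp add: graded_kernel_def)
  next
    case False
    then show ?thesis by (auto simp: coeff_sum_def intro!: sum.neutral)
  qed
  then show "p \<in> graded_kernel E g'" using p by (simp add: graded_kernel_def)
qed

text \<open>Only the partition of the monomials on \<open>E\<close> into fibres matters, so a
  grading may be recoded freely.\<close>

lemma graded_kernel_cong:
  assumes "\<And>m n. keys m \<subseteq> E \<Longrightarrow> keys n \<subseteq> E \<Longrightarrow> g m = g n \<longleftrightarrow> g' m = g' n"
  shows "graded_kernel E g = (graded_kernel E g' :: ('v, 'k::comm_ring_1) epoly set)"
  by (intro equalityI graded_kernel_mono) (simp_all add: assms)

definition box :: "'v set set \<Rightarrow> nat \<Rightarrow> ('v set \<Rightarrow>\<^sub>0 nat) set" where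
  "box E D = {m. keys m \<subseteq> E \<and> (\<forall>e. lookup m e \<le> D)}"

lemma card_box:
  assumes "finite E"
  shows "finite (box E D)" "card (box E D) = (D + 1) ^ card E"
proof -
  have "bij_betw (\<lambda>m. restrict (lookup m) E) (box E D) (PiE E (\<lambda>_. {..D}))"
  proof (rule bij_betw_imageI)
    show "inj_on (\<lambda>m. restrict (lookup m) E) (box E D)"
    proof (rule inj_onI)
      fix m n assume mn: "m \<in> box E D" "n \<in> box E D" "restrict (lookup m) E = restrict (lookup n) E"
      have "lookup m e = lookup n e" for e
      proof (cases "e \<in> E")
        case True
        then show ?thesis using fun_cong[OF mn(3), of e] by simp
      next
        case False
        then have "e \<notin> keys m" "e \<notin> keys n" using mn by (auto simp: box_def)
        then show ?thesis by (simp add: in_keys_iff)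
      qed
      then show "m = n" by (intro poly_mapping_eqI)
    qed
    show "(\<lambda>m. restrict (lookup m) E) ` box E D = PiE E (\<lambda>_. {..D})"
    proof
      show "PiE E (\<lambda>_. {..D}) \<subseteq> (\<lambda>m. restrict (lookup m) E) ` box E D"
      proof
        fix h assume h: "h \<in> PiE E (\<lambda>_. {..D})"
        define m where "m = (\<Sum>e\<in>E. single e (h e))"
        have lm: "lookup m e = (if e \<in> E then h e else 0)" for e
          using assms by (simp add: m_def lookup_sum lookup_single when_def)
        have "m \<in> box E D" using h by (auto simp: box_def in_keys_iff lm split: if_splits)
        moreover have "restrict (lookup m) E = h"
          using h by (auto simp: fun_eq_iff lm PiE_def extensional_def)
        ultimately show "h \<in> (\<lambda>m. restrict (lookup m) E) ` box E D" by blast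
      qed
    qed (auto simp: box_def)
  qed
  then show "card (box E D) = (D + 1) ^ card E" "finite (box E D)"
    using assms by (auto simp: bij_betw_same_card[of _ "box E D"] card_PiE
        bij_betw_finite[of _ "box E D"] intro!: finite_PiE)
qed

text \<open>\<open>ind_mod E P D N\<close>: the residues modulo \<open>P\<close> of the polynomials with all exponents at most
  \<open>D\<close> span a space of dimension at least \<open>N\<close>.\<close>
definition ind_mod ::
  "'v set set \<Rightarrow> ('v, 'k::field) epoly set \<Rightarrow> nat \<Rightarrow> nat \<Rightarrow> bool" where
  "ind_mod E P D N \<longleftrightarrow> (\<exists>b. (\<forall>i<N. keys (b i) \<subseteq> box E D) \<and>
     (\<forall>c. (\<Sum>i<N. single 0 (c i) * b i) \<in> P \<longrightarrow> (\<forall>i<N. c i = 0)))"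

lemma box_mono: "D \<le> D' \<Longrightarrow> box E D \<subseteq> box E D'"
  by (auto simp: box_def intro: order_trans)

lemma ind_mod_mono:
  assumes "ind_mod E Q D N" "P \<subseteq> Q" "D \<le> D'"
  shows "ind_mod E P D' N"
proof -
  obtain b where b: "\<forall>i<N. keys (b i) \<subseteq> box E D"
    "\<forall>c. (\<Sum>i<N. single 0 (c i) * b i) \<in> Q \<longrightarrow> (\<forall>i<N. c i = 0)" using assms(1) by (auto simp: ind_mod_def)
  have "\<forall>i<N. keys (b i) \<subseteq> box E D'" using b(1) box_mono[OF assms(3), of E] by blast
  moreover have "\<forall>c. (\<Sum>i<N. single 0 (c i) * b i) \<in> P \<longrightarrow> (\<forall>i<N. c i = 0)"
    using b(2) subsetD[OF assms(2)] by simp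
  ultimately show ?thesis unfolding ind_mod_def by (intro exI[of _ b] conjI)
qed

lemma ind_mod_le:
  assumes "finite E" "ind_mod E P D N" "0 \<in> P"
  shows "N \<le> (D + 1) ^ card E"
proof (rule ccontr)
  assume "\<not> ?thesis"
  then have "card (box E D) < card {..<N}" using card_box[OF assms(1)] by simp
  moreover obtain b where b: "\<forall>i<N. keys (b i) \<subseteq> box E D"
    "\<forall>c. (\<Sum>i<N. single 0 (c i) * b i) \<in> P \<longrightarrow> (\<forall>i<N. c i = 0)"
    using assms(2) by (auto simp: ind_mod_def)
  ultimately obtain c where c: "\<exists>i\<in>{..<N}. c i \<noteq> 0" "\<forall>m\<in>box E D. (\<Sum>i<N. c i * lookup (b i) m) = 0"
    using homogeneous_system_nontrivial[of "box E D" "{..<N}" "\<lambda>i m. lookup (b i) m"]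
      card_box(1)[OF assms(1)] by auto
  have "(\<Sum>i<N. single 0 (c i) * b i) = 0"
  proof (rule poly_mapping_eqI)
    fix m
    have "lookup (single 0 (c i) * b i) m = c i * lookup (b i) m" for i
      unfolding lookup_eq_coeff_sum[of _ m] by (simp add: coeff_sum_single_mult)
    then have "lookup (\<Sum>i<N. single 0 (c i) * b i) m = (\<Sum>i<N. c i * lookup (b i) m)"
      by (simp add: lookup_sum)
    also have "\<dots> = 0"
    proof (cases "m \<in> box E D")
      case False
      then have "lookup (b i) m = 0" if "i < N" for i using b(1) that by (meson in_keys_iff subsetD)
      then show ?thesis by simp
    qed (use c in auto)
    finally show "lookup (\<Sum>i<N. single 0 (c i) * b i) m = lookup 0 m" by simp
  qed
  then show False using b(2) c(1) assms(3) by auto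
qed

lemma sum_lessThan_add:
  "(\<Sum>i<M + N. f i) = (\<Sum>i<M. f i) + (\<Sum>i<N. f (M + i :: nat))" for f :: "nat \<Rightarrow> 'a::comm_monoid_add"
  by (induction N) (auto simp: add.assoc)

text \<open>The new family consists of the \<open>d i\<close>, independent modulo \<open>Q\<close>,
  and the products \<open>f * b i\<close>. Modulo \<open>Q\<close> the products vanish, so the
  coefficients of the \<open>d i\<close> are zero; modulo the prime \<open>P\<close> the factor
  \<open>f\<close> can then be cancelled.\<close>

lemma ind_mod_step:
  fixes P Q :: "('v, 'k::field) epoly set"
  assumes P: "primeideal P (poly_ring E)" and Q: "ideal Q (poly_ring E)" and PQ: "P \<subseteq> Q"
    and f: "f \<in> Q" "f \<notin> P" "keys f \<subseteq> box E \<delta>"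
    and iP: "ind_mod E P D N" and iQ: "ind_mod E Q (D + \<delta>) M"
  shows "ind_mod E P (D + \<delta>) (M + N)"
proof -
  interpret P: primeideal P "poly_ring E" by (rule P)
  obtain b where b: "\<forall>i<N. keys (b i) \<subseteq> box E D"
    "\<forall>c. (\<Sum>i<N. single 0 (c i) * b i) \<in> P \<longrightarrow> (\<forall>i<N. c i = 0)" using iP by (auto simp: ind_mod_def)
  obtain d where d: "\<forall>i<M. keys (d i) \<subseteq> box E (D + \<delta>)"
    "\<forall>c. (\<Sum>i<M. single 0 (c i) * d i) \<in> Q \<longrightarrow> (\<forall>i<M. c i = 0)" using iQ by (auto simp: ind_mod_def)
  have bE: "b i \<in> polys_on E" if "i < N" for i using b(1) that by (auto simp: polys_on_def box_def)
  have fE: "f \<in> polys_on E" using f(3) by (auto simp: polys_on_def box_def)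
  define a where "a i = (if i < M then d i else f * b (i - M))" for i
  have fb: "keys (f * b i) \<subseteq> box E (D + \<delta>)" if "i < N" for i
  proof
    fix m assume "m \<in> keys (f * b i)"
    then obtain m1 m2 where m: "m = m1 + m2" "m1 \<in> keys f" "m2 \<in> keys (b i)"
      using Poly_Mapping.keys_mult[of f "b i"] by auto
    then have m12: "m1 \<in> box E \<delta>" "m2 \<in> box E D" using f(3) b(1) that by auto
    then have "lookup m1 e + lookup m2 e \<le> D + \<delta>" for e
      using add_mono[of "lookup m1 e" \<delta> "lookup m2 e" D] by (auto simp: box_def add.commute)
    then show "m \<in> box E (D + \<delta>)" using m12 by (auto simp: box_def m keys_add_nat lookup_add)
  qed
  show ?thesis unfolding ind_mod_def
  proof (intro exI[of _ a] conjI allI impI)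
    show "keys (a i) \<subseteq> box E (D + \<delta>)" if "i < M + N" for i
      using that d(1) fb[of "i - M"] by (auto simp: a_def)
    fix c i assume c: "(\<Sum>i<M + N. single 0 (c i) * a i) \<in> P" and i: "i < M + N"
    define s where "s = (\<Sum>i<N. single 0 (c (M + i)) * b i)"
    have sE: "s \<in> polys_on E" unfolding s_def
      by (intro sum_polys_on mult_polys_on) (auto intro: single_polys_on bE)
    have "(\<Sum>i<M + N. single 0 (c i) * a i) = (\<Sum>i<M. single 0 (c i) * d i) + f * s"
      by (simp add: sum_lessThan_add a_def s_def sum_distrib_left mult.left_commute)
    then have tot: "(\<Sum>i<M. single 0 (c i) * d i) + f * s \<in> P" using c by simp
    have fs: "f * s \<in> Q" using ideal_poly_ringD(4)[OF Q sE f(1)] by (simp add: mult.commute)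
    then have "(\<Sum>i<M. single 0 (c i) * d i) \<in> Q"
      using ideal_poly_ringD(3)[OF Q, OF subsetD[OF PQ tot] ideal_poly_ring_uminus[OF Q fs]] by simp
    then have z: "\<forall>i<M. c i = 0" using d(2) by blast
    then have "f * s \<in> P" using tot by simp
    then have "s \<in> P" using P.I_prime[of f s] fE sE f(2) by auto
    then have "\<forall>i<N. c (M + i) = 0" using b(2)[rule_format, of "\<lambda>i. c (M + i)"] by (auto simp: s_def)
    then show "c i = 0" using z i by (metis le_add_diff_inverse less_diff_conv2 not_less add.commute)
  qed
qed

text \<open>Each strict inclusion of primes raises the order of growth by one: a fixed
  \<open>f\<close> in \<open>Q\<close> but not in \<open>P\<close> allows the previous step to be
  repeated about \<open>D\<close> times, each time raising the exponents by a constant only.\<close>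

lemma ind_mod_growth:
  fixes P Q :: "('v, 'k::field) epoly set"
  assumes P: "primeideal P (poly_ring E)" and Q: "ideal Q (poly_ring E)" and PQ: "P \<subset> Q"
    and k: "\<forall>D. ind_mod E Q (k * D) (D ^ t)"
  shows "\<exists>k. \<forall>D. ind_mod E P (k * D) (D ^ Suc t)"
proof -
  obtain f where f: "f \<in> Q" "f \<notin> P" using PQ by auto
  have "\<exists>\<delta>. \<forall>m\<in>keys f. \<forall>e\<in>keys m. lookup m e \<le> \<delta>"
  proof -
    let ?X = "(\<lambda>(m, e). lookup m e) ` (SIGMA m:keys f. keys m)"
    have "finite ?X" by (intro finite_imageI finite_SigmaI) auto
    then have "lookup m e \<le> Max ?X" if "m \<in> keys f" "e \<in> keys m" for m e
      using that by (intro Max_ge) (auto simp: image_iff intro!: bexI[of _ "(m, e)"])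
    then show ?thesis by blast
  qed
  then obtain \<delta> where "\<forall>m\<in>keys f. \<forall>e\<in>keys m. lookup m e \<le> \<delta>" by auto
  then have "lookup m e \<le> \<delta>" if "m \<in> keys f" for m e
    using that by (cases "e \<in> keys m") (auto simp: in_keys_iff)
  moreover have "f \<in> polys_on E" using f(1) ideal_poly_ringD(1)[OF Q] by auto
  ultimately have fb: "keys f \<subseteq> box E \<delta>" by (auto simp: box_def polys_on_def)
  have "ind_mod E P (k * D + j * \<delta>) (Suc j * D ^ t)" for D j
  proof (induction j)
    case 0
    show ?case using ind_mod_mono[OF k[rule_format, of D], of P] PQ by auto
  next
    case (Suc j)
    have "ind_mod E Q (k * D + j * \<delta> + \<delta>) (D ^ t)" using ind_mod_mono[OF k[rule_format, of D], of Q] by auto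
    from ind_mod_step[OF P Q _ f fb Suc this] PQ
    have "ind_mod E P (k * D + j * \<delta> + \<delta>) (D ^ t + Suc j * D ^ t)" by auto
    moreover have "k * D + j * \<delta> + \<delta> = k * D + Suc j * \<delta>" by simp
    moreover have "D ^ t + Suc j * D ^ t = Suc (Suc j) * D ^ t" by simp
    ultimately show ?case by (simp only:)
  qed
  note * = this
  have "ind_mod E P ((k + \<delta>) * D) (D ^ Suc t)" for D
  proof (cases D)
    case 0
    then show ?thesis by (simp add: ind_mod_def)
  next
    case (Suc j)
    \<comment> \<open>With \<open>D = Suc j\<close>, the \<open>j\<close> repetitions yield
      \<open>D\<close> blocks of size \<open>D ^ t\<close> with exponents at most
      \<open>k * D + j * \<delta>\<close>.\<close>
    show ?thesis using ind_mod_mono[OF *[of D j], of P "(k + \<delta>) * D"] Suc by (simp add: algebra_simps)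
  qed
  then show ?thesis by blast
qed

lemma growth_exponent_le:
  fixes a n k :: nat
  assumes "\<forall>D. D ^ a \<le> (k * D + 1) ^ n"
  shows "a \<le> n"
proof (rule ccontr)
  assume "\<not> a \<le> n"
  \<comment> \<open>Large enough that \<open>D ^ Suc n\<close> exceeds
    \<open>((k + 1) * D) ^ n\<close>, which bounds \<open>(k * D + 1) ^ n\<close> for positive
    \<open>D\<close>.\<close>
  define D where "D = (k + 1) ^ n + 1"
  have D1: "D \<ge> 1" by (simp add: D_def)
  have "D ^ Suc n \<le> D ^ a" using \<open>\<not> a \<le> n\<close> D1 by (intro power_increasing) auto
  also have "\<dots> \<le> (k * D + 1) ^ n" using assms by blast
  also have "\<dots> \<le> ((k + 1) * D) ^ n" using D1 by (intro power_mono) auto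
  also have "\<dots> = (k + 1) ^ n * D ^ n" by (rule power_mult_distrib)
  finally have "D * D ^ n \<le> (k + 1) ^ n * D ^ n" by simp
  moreover have "D ^ n > 0" using D1 by simp
  ultimately have "D \<le> (k + 1) ^ n" by (metis mult_le_cancel2)
  then show False by (simp add: D_def)
qed

text \<open>Growth of order \<open>t\<close> modulo the top prime becomes, modulo the bottom one,
  order \<open>t\<close> plus the number of inclusions, while the whole ring grows only like the
  power \<open>card E\<close>. This is the upper bound on heights.\<close>

lemma prime_chain_length_le:
  fixes ps :: "('v, 'k::field) epoly set list"
  assumes "finite E" "prime_chain (poly_ring E) ps" "\<forall>D. ind_mod E (last ps) (k * D) (D ^ t)"
  shows "length ps - 1 + t \<le> card E"
proof -
  have "\<exists>k. \<forall>D. ind_mod E (hd ps) (k * D) (D ^ (length ps - 1 + t))"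
    using assms(2,3)
  proof (induction ps)
    case Nil
    then show ?case by (simp add: prime_chain_def)
  next
    case (Cons P ps)
    show ?case
    proof (cases ps)
      case Nil
      then show ?thesis using Cons.prems by auto
    next
      case (Cons Q qs)
      have pc: "prime_chain (poly_ring E) ps" using Cons.prems(1) Cons by (auto simp: prime_chain_def)
      then obtain k' where k': "\<forall>D. ind_mod E Q (k' * D) (D ^ (length ps - 1 + t))"
        using Cons.IH Cons.prems(2) Cons by auto
      have "primeideal P (poly_ring E)" "primeideal Q (poly_ring E)" "P \<subset> Q"
        using Cons.prems(1) Cons by (auto simp: prime_chain_def)
      from ind_mod_growth[OF this(1) primeideal.axioms(1)[OF this(2)] this(3) k']
      show ?thesis using Cons by simp
    qed
  qed
  then obtain k' where k': "\<forall>D. ind_mod E (hd ps) (k' * D) (D ^ (length ps - 1 + t))" by auto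
  have "hd ps \<in> set ps" using assms(2) by (auto simp: prime_chain_def)
  then have "primeideal (hd ps) (poly_ring E)" using assms(2) by (auto simp: prime_chain_def)
  then have "0 \<in> hd ps" using ideal_poly_ringD(2) primeideal.axioms(1) by blast
  then show ?thesis using ind_mod_le[OF assms(1)] k' by (intro growth_exponent_le) blast
qed

locale edge_set =
  fixes E :: "'v set set"
  assumes fin_E: "finite E" and card_edge: "e \<in> E \<Longrightarrow> card e = 2"
begin

lemma finite_edge: "e \<in> E \<Longrightarrow> finite e"
  using card_edge[of e] by (auto intro: card_ge_0_finite)

lemma lookup_img: "keys m \<subseteq> E \<Longrightarrow> lookup (mono_img m) v = (\<Sum>e\<in>{e\<in>E. v \<in> e}. lookup m e)"
  using fin_E finite_edge by (intro lookup_mono_img) auto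

lemma img_eq_0: "keys m \<subseteq> E \<Longrightarrow> mono_img m = 0 \<longleftrightarrow> m = 0"
proof
  assume m: "keys m \<subseteq> E" and z: "mono_img m = 0"
  show "m = 0"
  proof (rule ccontr)
    assume "m \<noteq> 0"
    then obtain e where e: "e \<in> keys m" by fastforce
    then have "card e = 2" using m card_edge by auto
    then obtain v where v: "v \<in> e" by fastforce
    have "(\<Sum>e\<in>{e\<in>E. v \<in> e}. lookup m e) = 0" using lookup_img[OF m, of v] z by simp
    then have "lookup m e = 0" using e v m fin_E by (auto simp: subset_iff)
    then show False using e by (simp add: in_keys_iff)
  qed
qed auto

lemma keys_img: "keys m \<subseteq> E \<Longrightarrow> keys (mono_img m) = \<Union>(keys m)"
proof -
  assume m: "keys m \<subseteq> E"
  have "v \<in> keys (mono_img m) \<longleftrightarrow> (\<exists>e\<in>E. v \<in> e \<and> e \<in> keys m)" for v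
    using fin_E by (auto simp: in_keys_iff[of v] in_keys_iff[of _ m] lookup_img[OF m])
  then show ?thesis using m by blast
qed

text \<open>The grading of the map sending \<open>e\<close> to the product of its end points, times
  an extra variable for each \<open>e\<close> in \<open>T\<close>. Enlarging \<open>T\<close>
  shrinks the kernel, from the toric ideal at the empty set to 0 at \<open>E - F\<close> for a basis
  \<open>F\<close>.\<close>

definition fine_degree :: "'v set set \<Rightarrow> ('v set \<Rightarrow>\<^sub>0 nat) \<Rightarrow> ('v \<Rightarrow>\<^sub>0 nat) \<times> ('v set \<Rightarrow> nat)" where
  "fine_degree T m = (mono_img m, \<lambda>e. if e \<in> T then lookup m e else 0)"

lemma fine_degree_eq:
  "fine_degree T m = fine_degree T n \<longleftrightarrow> mono_img m = mono_img n \<and> (\<forall>e\<in>T. lookup m e = lookup n e)"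
proof -
  have "(\<lambda>e. if e \<in> T then lookup m e else 0) = (\<lambda>e. if e \<in> T then lookup n e else 0) \<longleftrightarrow>
    (\<forall>e\<in>T. lookup m e = lookup n e)" unfolding fun_eq_iff by (metis (full_types))
  then show ?thesis by (simp add: fine_degree_def)
qed

text \<open>Numbering the vertices and the edges in \<open>T\<close> by \<open>\<iota>\<close> turns
  \<open>fine_degree T\<close> into a grading by exponent vectors over \<open>nat\<close> with the
  same fibres.\<close>

lemma primeideal_fine_kernel:
  assumes "T \<subseteq> E"
  shows "primeideal (graded_kernel E (fine_degree T) :: ('v, 'k::field) epoly set) (poly_ring E)"
proof -
  let ?X = "Inl ` \<Union>E \<union> Inr ` T :: ('v + 'v set) set"
  have fX: "finite ?X" using fin_E finite_edge assms finite_subset[of T E] by auto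
  then obtain \<iota> :: "'v + 'v set \<Rightarrow> nat" where inj: "inj_on \<iota> ?X"
    using finite_imp_inj_to_nat_seg[of ?X] by auto
  define h where "h m x = (case x of Inl v \<Rightarrow> lookup (mono_img m) v | Inr e \<Rightarrow> lookup m e)"
    for m :: "'v set \<Rightarrow>\<^sub>0 nat" and x :: "'v + 'v set"
  define g where "g m = (\<Sum>x\<in>?X. single (\<iota> x) (h m x))" for m
  have add: "g (m + n) = g m + g n" for m n
    by (auto simp: g_def h_def sum.distrib[symmetric] single_add[symmetric] mono_img_add lookup_add
        intro!: sum.cong split: sum.splits)
  have lg: "lookup (g m) (\<iota> x) = h m x" if "x \<in> ?X" for m x
  proof -
    have "lookup (g m) (\<iota> x) = (\<Sum>z\<in>?X. if z = x then h m x else 0)"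
      unfolding g_def lookup_sum using inj that
      by (intro sum.cong) (auto simp: lookup_single when_def dest: inj_onD)
    then show ?thesis using fX that by (simp add: sum.delta)
  qed
  have "g m = g n \<longleftrightarrow> fine_degree T m = fine_degree T n" if mn: "keys m \<subseteq> E" "keys n \<subseteq> E" for m n
  proof
    assume "g m = g n"
    then have eq: "h m x = h n x" if "x \<in> ?X" for x using lg[OF that] by metis
    have "lookup (mono_img m) v = lookup (mono_img n) v" for v
    proof (cases "v \<in> \<Union>E")
      case True
      then show ?thesis using eq[of "Inl v"] by (auto simp: h_def)
    next
      case False
      then have "v \<notin> keys (mono_img m)" "v \<notin> keys (mono_img n)" using keys_img mn by blast+
      then show ?thesis by (simp add: in_keys_iff)
    qed
    moreover have "lookup m e = lookup n e" if "e \<in> T" for e using eq[of "Inr e"] that by (simp add: h_def)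
    ultimately show "fine_degree T m = fine_degree T n"
      by (auto simp: fine_degree_eq intro: poly_mapping_eqI)
  next
    assume "fine_degree T m = fine_degree T n"
    then have "mono_img m = mono_img n" "\<forall>e\<in>T. lookup m e = lookup n e"
      by (simp_all add: fine_degree_eq)
    then have "h m x = h n x" if "x \<in> ?X" for x using that
      by (auto simp: h_def split: sum.splits)
    then show "g m = g n" unfolding g_def by (intro sum.cong) auto
  qed
  then have "graded_kernel E (fine_degree T) = (graded_kernel E g :: ('v, 'k) epoly set)"
    by (intro graded_kernel_cong) auto
  then show ?thesis using primeideal_graded_kernel[OF add] by simp
qed

lemma fine_kernel_empty: "graded_kernel E (fine_degree {}) = (toric_ideal E :: ('v, 'k::comm_ring_1) epoly set)"
  unfolding toric_ideal_eq_kernel by (rule graded_kernel_cong) (simp add: fine_degree_def)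

text \<open>For \<open>e\<close> in \<open>T\<close> but not in \<open>T'\<close>, the circuit of
  \<open>e\<close> uses only \<open>e\<close> and edges of \<open>F\<close>. It has no exponents in
  \<open>T'\<close>, so the coarser grading identifies its two sides, while their exponents at
  \<open>e\<close> differ.\<close>

lemma fine_kernel_psubset:
  assumes F: "max_indep E F" and T: "T' \<subset> T" "T \<subseteq> E - F"
  shows "graded_kernel E (fine_degree T) \<subset> (graded_kernel E (fine_degree T') :: ('v, 'k::field) epoly set)"
proof -
  have T'E: "T' \<subseteq> E" using T by auto
  have "graded_kernel E (fine_degree T) \<subseteq> (graded_kernel E (fine_degree T') :: ('v, 'k) epoly set)"
  proof (rule graded_kernel_subset_ideal)
    show "ideal (graded_kernel E (fine_degree T') :: ('v, 'k) epoly set) (poly_ring E)"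
      using primeideal.axioms(1)[OF primeideal_fine_kernel[OF T'E]] .
    show "single a 1 - single b 1 \<in> graded_kernel E (fine_degree T')"
      if ab: "keys a \<subseteq> E" "keys b \<subseteq> E" "fine_degree T a = fine_degree T b" for a b
    proof (rule binomial_in_graded_kernel[OF ab(1,2)])
      show "fine_degree T' a = fine_degree T' b" using ab(3) T by (auto simp: fine_degree_eq)
    qed
  qed
  moreover obtain e where e: "e \<in> T" "e \<notin> T'" using T by auto
  then obtain u v where uv: "keys u \<subseteq> insert e F" "keys v \<subseteq> insert e F" "mono_img u = mono_img v"
    "lookup u e \<noteq> lookup v e" using max_indep_circuit[OF F, of e] T by blast
  have z: "lookup u e' = 0" "lookup v e' = 0" if "e' \<in> T'" for e'
  proof -
    have "e' \<notin> insert e F" using that T e by auto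
    then have "e' \<notin> keys u" "e' \<notin> keys v" using uv by auto
    then show "lookup u e' = 0" "lookup v e' = 0" by (simp_all add: in_keys_iff)
  qed
  have "F \<subseteq> E" using F by (simp add: max_indep_def)
  then have "single u 1 - single v 1 \<in> (graded_kernel E (fine_degree T') :: ('v, 'k) epoly set)"
    using uv T e z by (intro binomial_in_graded_kernel) (auto simp: fine_degree_eq)
  moreover have "fine_degree T v \<noteq> fine_degree T u"
    using uv(4) e by (auto simp: fine_degree_eq intro!: bexI[of _ e])
  then have "coeff_sum (\<lambda>m. fine_degree T m = fine_degree T u) (single u 1 - single v 1) = (1 :: 'k)"
    by (simp add: coeff_sum_diff)
  then have cs: "coeff_sum (\<lambda>m. fine_degree T m = fine_degree T u) (single u 1 - single v 1) \<noteq> (0 :: 'k)"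
    by simp
  have "single u 1 - single v 1 \<notin> (graded_kernel E (fine_degree T) :: ('v, 'k) epoly set)"
  proof
    assume "single u 1 - single v 1 \<in> (graded_kernel E (fine_degree T) :: ('v, 'k) epoly set)"
    then have "\<forall>\<gamma>. coeff_sum (\<lambda>m. fine_degree T m = \<gamma>) (single u 1 - single v 1) = (0 :: 'k)"
      unfolding graded_kernel_def by blast
    then show False using cs by (rule notE[OF _ spec, rotated])
  qed
  ultimately show ?thesis by blast
qed

lemma primeideal_toric_ideal: "primeideal (toric_ideal E :: ('v, 'k::field) epoly set) (poly_ring E)"
  using primeideal_fine_kernel[of "{}"] by (simp add: fine_kernel_empty)

text \<open>Dropping the edges outside \<open>F\<close> one at a time gives
  \<open>card (E - F)\<close> strict inclusions ending in the toric ideal. As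
  \<open>ideal_height\<close> is an infimum, the bound is wanted at every prime above it; such a
  prime is appended if it is larger.\<close>

lemma prime_height_ge:
  fixes P :: "('v, 'k::field) epoly set"
  assumes F: "max_indep E F" and P: "primeideal P (poly_ring E)" "toric_ideal E \<subseteq> P"
  shows "enat (card (E - F)) \<le> prime_height (poly_ring E) P"
proof -
  obtain es where es: "set es = E - F" "distinct es"
    using finite_distinct_list fin_E by (metis finite_Diff)
  have les: "length es = card (E - F)" using distinct_card[OF es(2)] es(1) by simp
  define K :: "nat \<Rightarrow> ('v, 'k) epoly set" where "K j = graded_kernel E (fine_degree (set (drop j es)))" for j
  define ps where "ps = map K [0..<Suc (length es)]"
  have Kmono: "K i \<subset> K j" if "i < j" "j \<le> length es" for i j
    unfolding K_def
  proof (rule fine_kernel_psubset[OF F])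
    have "es ! i \<notin> set (drop j es)"
      using that es(2) by (auto simp: in_set_conv_nth nth_eq_iff_index_eq)
    moreover have "es ! i \<in> set (drop i es)" using that by (auto simp: in_set_conv_nth intro: exI[of _ 0])
    moreover have "set (drop j es) \<subseteq> set (drop i es)" using that by (intro set_drop_subset_set_drop) auto
    ultimately show "set (drop j es) \<subset> set (drop i es)" by auto
    show "set (drop i es) \<subseteq> E - F" using es(1) set_drop_subset by metis
  qed
  have Kprime: "primeideal (K j) (poly_ring E)" for j
    unfolding K_def using es(1) set_drop_subset[of j es] by (intro primeideal_fine_kernel) auto
  have pc: "prime_chain (poly_ring E) ps"
    unfolding prime_chain_def
  proof (intro conjI)
    show "sorted_wrt (\<subset>) ps"
      unfolding sorted_wrt_iff_nth_less ps_def using Kmono by (auto simp del: upt_Suc)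
    show "\<forall>P\<in>set ps. primeideal P (poly_ring E)" using Kprime by (auto simp: ps_def)
    show "ps \<noteq> []" by (simp add: ps_def)
  qed
  have last: "last ps = toric_ideal E" by (simp add: ps_def K_def fine_kernel_empty)
  have sub: "Q \<subseteq> toric_ideal E" if Q: "Q \<in> set ps" for Q
  proof -
    obtain i where i: "i < length ps" "Q = ps ! i" using Q by (auto simp: in_set_conv_nth)
    then have "Q = K i" "i \<le> length es" by (auto simp: ps_def simp del: upt_Suc)
    then show ?thesis using Kmono[of i "length es"] by (cases "i = length es") (auto simp: K_def fine_kernel_empty)
  qed
  have "\<exists>qs. prime_chain (poly_ring E) qs \<and> last qs = P \<and> card (E - F) \<le> length qs - 1"
  proof (cases "P = toric_ideal E")
    case True
    then show ?thesis using pc last by (intro exI[of _ ps]) (auto simp: ps_def les)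
  next
    case False
    then have "prime_chain (poly_ring E) (ps @ [P])"
      using pc P sub by (auto simp: prime_chain_def sorted_wrt_append)
    then show ?thesis by (intro exI[of _ "ps @ [P]"]) (auto simp: ps_def les)
  qed
  then obtain qs where qs: "prime_chain (poly_ring E) qs" "last qs = P" "card (E - F) \<le> length qs - 1" by auto
  then have "enat (card (E - F)) \<le> enat (length qs - 1)" by simp
  also have "\<dots> \<le> prime_height (poly_ring E) P"
    unfolding prime_height_def using qs by (intro SUP_upper) auto
  finally show ?thesis .
qed

text \<open>Distinct monomials on the independent set \<open>F\<close> have distinct images and stay
  linearly independent modulo the toric ideal. This is growth of order
  \<open>card F\<close>.\<close>

lemma prime_height_toric_le:
  assumes F: "max_indep E F"
  shows "prime_height (poly_ring E) (toric_ideal E :: ('v, 'k::field) epoly set) \<le> enat (card (E - F))"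
  unfolding prime_height_def
proof (rule SUP_least)
  fix ps :: "('v, 'k) epoly set list"
  assume "ps \<in> {ps. prime_chain (poly_ring E) ps \<and> last ps = toric_ideal E}"
  then have ps: "prime_chain (poly_ring E) ps" "last ps = toric_ideal E" by auto
  have FE: "F \<subseteq> E" "mindep F" using F by (auto simp: max_indep_def)
  have finF: "finite F" using FE fin_E finite_subset by blast
  have "ind_mod E (toric_ideal E :: ('v, 'k) epoly set) D ((D + 1) ^ card F)" for D
  proof -
    obtain b where b: "bij_betw b {..<(D + 1) ^ card F} (box F D)"
      using ex_bij_betw_nat_finite[OF card_box(1)[OF finF], of D] card_box(2)[OF finF, of D]
      by (auto simp: atLeast0LessThan)
    have bF: "b i \<in> box F D" if "i < (D + 1) ^ card F" for i using b that by (auto simp: bij_betw_def)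
    have binj: "b i = b j \<longleftrightarrow> i = j" if "i < (D + 1) ^ card F" "j < (D + 1) ^ card F" for i j
      using b that by (auto simp: bij_betw_def inj_on_def)
    show ?thesis unfolding ind_mod_def
    proof (intro exI[of _ "\<lambda>i. single (b i) 1"] conjI allI impI)
      show "keys (single (b i) 1) \<subseteq> box E D" if "i < (D + 1) ^ card F" for i
        using bF[OF that] FE by (auto simp: box_def)
      fix c i assume c: "(\<Sum>i<(D + 1) ^ card F. single 0 (c i) * single (b i) 1) \<in> (toric_ideal E :: ('v, 'k) epoly set)"
        and i: "i < (D + 1) ^ card F"
      have img: "mono_img (b j) = mono_img (b i) \<longleftrightarrow> j = i" if "j < (D + 1) ^ card F" for j
        using mindepD[OF FE(2), of "b j" "b i"] bF[OF i] bF[OF that] binj[OF that i] by (auto simp: box_def)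
      have "0 = coeff_sum (\<lambda>m. mono_img m = mono_img (b i)) (\<Sum>i<(D + 1) ^ card F. single 0 (c i) * single (b i) 1)"
        using c by (auto simp: toric_ideal_eq_kernel graded_kernel_def)
      also have "\<dots> = (\<Sum>j<(D + 1) ^ card F. if j = i then c i else 0)"
        unfolding coeff_sum_sum by (rule sum.cong) (auto simp: mult_single img)
      also have "\<dots> = c i" using i by simp
      finally show "c i = 0" by simp
    qed
  qed
  note base = this
  \<comment> \<open>Exponents at most \<open>D'\<close> give \<open>(D' + 1) ^ card F\<close>
    monomials, hence the shift \<open>D = Suc D'\<close>. For \<open>D = 0\<close> one residue is
    needed when \<open>F\<close> is empty, because \<open>0 ^ 0 = 1\<close>.\<close>
  have "ind_mod E (toric_ideal E :: ('v, 'k) epoly set) (1 * D) (D ^ card F)" for D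
  proof (cases D)
    case 0
    show ?thesis
    proof (cases "card F = 0")
      case True
      then show ?thesis using base[of 0] 0 by simp
    next
      case False
      then have "D ^ card F = 0" using 0 by simp
      moreover have "ind_mod E (toric_ideal E :: ('v, 'k) epoly set) (1 * D) 0" by (simp add: ind_mod_def)
      ultimately show ?thesis by (simp only:)
    qed
  next
    case (Suc D')
    then show ?thesis using ind_mod_mono[OF base[of D'], of "toric_ideal E" D] by auto
  qed
  then have "length ps - 1 + card F \<le> card E"
    using prime_chain_length_le[OF fin_E ps(1), of 1 "card F"] ps(2) by auto
  then show "enat (length ps - 1) \<le> enat (card (E - F))"
    using FE finF fin_E by (simp add: card_Diff_subset)
qed

theorem ideal_height_toric:
  assumes "max_indep E F"
  shows "ideal_height (poly_ring E) (toric_ideal E :: ('v, 'k::field) epoly set) = enat (card (E - F))"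
proof (rule antisym)
  have "ideal_height (poly_ring E) (toric_ideal E :: ('v, 'k) epoly set) \<le> prime_height (poly_ring E) (toric_ideal E :: ('v, 'k) epoly set)"
    unfolding ideal_height_def using primeideal_toric_ideal[where 'k='k] by (intro INF_lower) auto
  also have "\<dots> \<le> enat (card (E - F))" by (rule prime_height_toric_le[OF assms])
  finally show "ideal_height (poly_ring E) (toric_ideal E :: ('v, 'k) epoly set) \<le> enat (card (E - F))" .
  show "enat (card (E - F)) \<le> ideal_height (poly_ring E) (toric_ideal E :: ('v, 'k) epoly set)"
    unfolding ideal_height_def using prime_height_ge[OF assms] by (intro INF_greatest) auto
qed

end

section \<open>Minimal binomial systems: existence, common size, restriction to subgraphs\<close>

section \<open>Finite binomial generating sets\<close>

lemma nat_seq_mono_subseq: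
  fixes s :: "nat \<Rightarrow> nat"
  shows "\<exists>r :: nat \<Rightarrow> nat. strict_mono r \<and> mono (s \<circ> r)"
proof -
  obtain r :: "nat \<Rightarrow> nat" where r: "strict_mono r" "monoseq (\<lambda>n. s (r n))" using seq_monosub[of s] by auto
  show ?thesis
  proof (cases "mono (s \<circ> r)")
    case True
    then show ?thesis using r by blast
  next
    case False
    then have dec: "s (r n) \<le> s (r m)" if "m \<le> n" for m n
      using r(2) that by (auto simp: monoseq_def mono_def)
    obtain N where N: "\<And>n. s (r N) \<le> s (r n)"
      using ex_has_least_nat[of "\<lambda>_. True" 0 "\<lambda>n. s (r n)"] by auto
    have "s (r (N + n)) = s (r N)" for n using N[of "N + n"] dec[of N "N + n"] by simp
    moreover have "strict_mono (\<lambda>n. r (N + n))" using r(1) by (auto simp: strict_mono_def)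
    ultimately show ?thesis by (intro exI[of _ "\<lambda>n. r (N + n)"]) (auto simp: mono_def)
  qed
qed

text \<open>Dickson's lemma in sequence form: passing to subsequences makes one coordinate after the
  other monotone.\<close>

lemma dickson:
  fixes f :: "nat \<Rightarrow> 'a \<Rightarrow> nat"
  assumes "finite X"
  shows "\<exists>r :: nat \<Rightarrow> nat. strict_mono r \<and> (\<forall>i j. i \<le> j \<longrightarrow> (\<forall>x\<in>X. f (r i) x \<le> f (r j) x))"
  using assms
proof (induction X rule: finite_induct)
  case empty
  then show ?case by (intro exI[of _ id]) (auto simp: strict_mono_def)
next
  case (insert x X)
  then obtain r :: "nat \<Rightarrow> nat" where r: "strict_mono r" "\<forall>i j. i \<le> j \<longrightarrow> (\<forall>x\<in>X. f (r i) x \<le> f (r j) x)" by auto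
  obtain q :: "nat \<Rightarrow> nat" where q: "strict_mono q" "mono ((\<lambda>n. f (r n) x) \<circ> q)"
    using nat_seq_mono_subseq[of "\<lambda>n. f (r n) x"] by auto
  have "strict_mono (\<lambda>i. r (q i))" using r(1) q(1) by (auto simp: strict_mono_def)
  moreover have "f (r (q i)) z \<le> f (r (q j)) z" if "i \<le> j" "z \<in> insert x X" for i j z
  proof (cases "z = x")
    case True
    then show ?thesis using q(2) that(1) by (auto simp: mono_def)
  next
    case False
    have "q i \<le> q j" using q(1) that(1) by (simp add: strict_mono_less_eq)
    then show ?thesis using r(2) False that(2) by auto
  qed
  ultimately show ?case
    by (intro exI[of _ "\<lambda>i. r (q i)"] conjI allI impI ballI)
qed

definition pm_le :: "('a \<Rightarrow>\<^sub>0 nat) \<Rightarrow> ('a \<Rightarrow>\<^sub>0 nat) \<Rightarrow> bool" where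
  "pm_le a b \<longleftrightarrow> (\<forall>x. lookup a x \<le> lookup b x)"

lemma pm_leE:
  assumes "pm_le a b"
  obtains c where "b = a + c" "pm_le c b"
proof -
  have "b = a + (b - a)" using assms
    by (intro poly_mapping_eqI) (simp add: pm_le_def lookup_add lookup_minus)
  then show thesis using that[of "b - a"] by (auto simp: pm_le_def lookup_minus)
qed

lemma pm_le_add [simp]: "pm_le a (a + b)" "pm_le b (a + b)"
  by (simp_all add: pm_le_def lookup_add)

lemma pm_le_refl [simp]: "pm_le a a"
  by (simp add: pm_le_def)

lemma pm_le_trans: "pm_le a b \<Longrightarrow> pm_le b c \<Longrightarrow> pm_le a c"
  unfolding pm_le_def by (meson order_trans)

lemma pm_le_antisym: "pm_le a b \<Longrightarrow> pm_le b a \<Longrightarrow> a = b"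
  by (auto simp: pm_le_def intro!: poly_mapping_eqI antisym)

lemma pm_le_keys: "pm_le a b \<Longrightarrow> keys a \<subseteq> keys b"
  unfolding pm_le_def by (metis in_keys_iff le_zero_eq subsetI)

context edge_set
begin

definition relations :: "(('v set \<Rightarrow>\<^sub>0 nat) \<times> ('v set \<Rightarrow>\<^sub>0 nat)) set" where
  "relations = {(u, v). keys u \<subseteq> E \<and> keys v \<subseteq> E \<and> mono_img u = mono_img v \<and> u \<noteq> v}"

text \<open>The exponent pairs of primitive binomials, in other words the Graver basis. It may be
  redundant as a generating set, but Dickson's lemma on two copies of \<open>E\<close> makes it
  finite.\<close>

definition minimal_relations :: "(('v set \<Rightarrow>\<^sub>0 nat) \<times> ('v set \<Rightarrow>\<^sub>0 nat)) set" where
  "minimal_relations = {(u, v) \<in> relations. \<forall>(a, b)\<in>relations. pm_le a u \<longrightarrow> pm_le b v \<longrightarrow> (a, b) = (u, v)}"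

lemma finite_minimal_relations: "finite minimal_relations"
proof (rule ccontr)
  assume "infinite minimal_relations"
  then obtain g :: "nat \<Rightarrow> _" where g: "inj g" "range g \<subseteq> minimal_relations"
    using infinite_countable_subset by blast
  define f where "f i x = (case x of Inl e \<Rightarrow> lookup (fst (g i)) e | Inr e \<Rightarrow> lookup (snd (g i)) e)" for i x
  obtain r :: "nat \<Rightarrow> nat" where r: "strict_mono r" "\<forall>i j. i \<le> j \<longrightarrow> (\<forall>x\<in>E <+> E. f (r i) x \<le> f (r j) x)"
    using dickson[of "E <+> E" f] fin_E by auto
  obtain a b where ab: "g (r 0) = (a, b)" by fastforce
  obtain u v where uv: "g (r 1) = (u, v)" by fastforce
  have mem: "(a, b) \<in> minimal_relations" "(u, v) \<in> minimal_relations" using g(2) ab uv by (metis range_subsetD)+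
  have le: "f (r 0) x \<le> f (r 1) x" if "x \<in> E <+> E" for x using r(2) that by simp
  have keys: "keys a \<subseteq> E" "keys b \<subseteq> E" using mem by (auto simp: minimal_relations_def relations_def)
  have "lookup a e \<le> lookup u e \<and> lookup b e \<le> lookup v e" for e
  proof (cases "e \<in> E")
    case True
    then show ?thesis using le[of "Inl e"] le[of "Inr e"] unfolding f_def ab uv by auto
  next
    case False
    then have "e \<notin> keys a" "e \<notin> keys b" using keys by auto
    then show ?thesis by (simp add: in_keys_iff)
  qed
  then have "(a, b) = (u, v)" using mem by (auto simp: minimal_relations_def pm_le_def)
  then have "g (r 0) = g (r 1)" using ab uv by simp
  then have "r 0 = r 1" using g(1) by (simp add: inj_eq)
  then show False using r(1) by (metis strict_mono_eq zero_neq_one)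
qed

definition size_on :: "('v set \<Rightarrow>\<^sub>0 nat) \<Rightarrow> nat" where
  "size_on m = (\<Sum>e\<in>E. lookup m e)"

lemma size_on_add: "size_on (a + b) = size_on a + size_on b"
  by (simp add: size_on_def lookup_add sum.distrib)

lemma size_on_eq_0: "keys m \<subseteq> E \<Longrightarrow> size_on m = 0 \<Longrightarrow> m = 0"
  using fin_E by (intro poly_mapping_eqI) (auto simp: size_on_def in_keys_iff subset_iff)

lemma minimal_relation_below:
  assumes "(u, v) \<in> relations"
  shows "\<exists>(a, b)\<in>minimal_relations. pm_le a u \<and> pm_le b v"
  using assms
proof (induction "size_on u + size_on v" arbitrary: u v rule: less_induct)
  case less
  show ?case
  proof (cases "(u, v) \<in> minimal_relations")
    case True
    then show ?thesis by (intro bexI[of _ "(u, v)"]) auto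
  next
    case False
    then obtain a b where ab: "(a, b) \<in> relations" "pm_le a u" "pm_le b v" "(a, b) \<noteq> (u, v)"
      using less.prems unfolding minimal_relations_def by blast
    obtain c where c: "u = a + c" using pm_leE[OF ab(2)] by metis
    obtain d where d: "v = b + d" using pm_leE[OF ab(3)] by metis
    have cd: "keys c \<subseteq> E" "keys d \<subseteq> E" using less.prems by (auto simp: c d relations_def keys_add_nat)
    have "c \<noteq> 0 \<or> d \<noteq> 0" using ab(4) c d by auto
    then have "size_on c + size_on d > 0" using size_on_eq_0 cd by (metis add_gr_0 neq0_conv)
    then have "size_on a + size_on b < size_on u + size_on v" by (auto simp: c d size_on_add)
    from less.hyps[OF this ab(1)] show ?thesis using ab(2,3) pm_le_trans by blast
  qed
qed

text \<open>Splitting a minimal relation \<open>(a, b)\<close> off \<open>(u, v)\<close> leaves a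
  smaller relation \<open>(c, d)\<close>, and x^(a+c) - x^(b+d) = x^c (x^a - x^b) + x^b (x^c - x^d).
  Induction on the total degree shows that the primitive binomials generate.\<close>

theorem min_system_toric_exists:
  "\<exists>A. minimal_binomial_system E (toric_ideal E :: ('v, 'k::field) epoly set) A"
proof -
  define A :: "('v, 'k) epoly set" where "A = (\<lambda>(u, v). single u 1 - single v 1) ` minimal_relations"
  have finA: "finite A" unfolding A_def using finite_minimal_relations by simp
  have AI: "A \<subseteq> toric_ideal E"
    unfolding A_def toric_ideal_eq_kernel
    by (auto simp: minimal_relations_def relations_def intro!: binomial_in_graded_kernel)
  have Apoly: "A \<subseteq> polys_on E" using AI by (auto simp: toric_ideal_def)
  note idl = ideal_comb[OF Apoly]
  have "single u 1 - single v 1 \<in> comb E A"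
    if "keys u \<subseteq> E" "keys v \<subseteq> E" "mono_img u = mono_img v" for u v
    using that
  proof (induction "size_on u + size_on v" arbitrary: u v rule: less_induct)
    case less
    show ?case
    proof (cases "u = v")
      case True
      then show ?thesis using ideal_poly_ringD(2)[OF idl] by simp
    next
      case False
      then have "(u, v) \<in> relations" using less.prems by (auto simp: relations_def)
      then obtain a b where ab: "(a, b) \<in> minimal_relations" "pm_le a u" "pm_le b v"
        using minimal_relation_below by blast
      obtain c where c: "u = a + c" using pm_leE[OF ab(2)] by metis
      obtain d where d: "v = b + d" using pm_leE[OF ab(3)] by metis
      have abr: "keys a \<subseteq> E" "keys b \<subseteq> E" "mono_img a = mono_img b" "a \<noteq> b"
        using ab(1) by (auto simp: minimal_relations_def relations_def)
      have cd: "keys c \<subseteq> E" "keys d \<subseteq> E" using less.prems by (auto simp: c d keys_add_nat)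
      have img: "mono_img c = mono_img d" using less.prems(3) abr(3) by (simp add: c d mono_img_add)
      have "size_on a + size_on b > 0" using size_on_eq_0 abr by (metis add_gr_0 neq0_conv)
      then have "size_on c + size_on d < size_on u + size_on v" by (auto simp: c d size_on_add)
      from less.hyps[OF this cd img] have 1: "single b 1 * (single c 1 - single d 1) \<in> comb E A"
        by (intro ideal_poly_ringD(4)[OF idl] single_polys_on abr)
      have "single a 1 - single b 1 \<in> A" using ab(1) by (force simp: A_def)
      then have 2: "single c 1 * (single a 1 - single b 1) \<in> comb E A"
        using subset_comb[OF finA] by (intro ideal_poly_ringD(4)[OF idl] single_polys_on cd) auto
      have "single u 1 - single v 1 =
          single c 1 * (single a 1 - single b 1) + single b (1::'k) * (single c 1 - single d 1)"
        by (simp add: c d right_diff_distrib mult_single add.commute)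
      then show ?thesis using ideal_poly_ringD(3)[OF idl 2 1] by simp
    qed
  qed
  then have "comb E A = toric_ideal E" by (intro comb_toric_idealI finA AI)
  moreover have "\<forall>f\<in>A. is_binomial f" by (auto simp: A_def is_binomial_def)
  ultimately show ?thesis using min_system_exists[OF finA Apoly] by blast
qed

end

section \<open>Minimal binomial systems\<close>

lemma comb_mono:
  assumes "E' \<subseteq> E" "B \<subseteq> B'" "finite B'"
  shows "comb E' B \<subseteq> comb E B'"
proof
  fix p assume "p \<in> comb E' B"
  then obtain c where c: "\<forall>f\<in>B. c f \<in> polys_on E'" "p = (\<Sum>f\<in>B. c f * f)" unfolding comb_def by blast
  define d where "d f = (if f \<in> B then c f else 0)" for f
  have "p = (\<Sum>f\<in>B'. d f * f)"
    unfolding c(2) using assms(2,3) by (intro sum.mono_neutral_cong_left) (auto simp: d_def)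
  moreover have "\<forall>f\<in>B'. d f \<in> polys_on E" using c(1) polys_on_mono[OF assms(1)] by (auto simp: d_def)
  ultimately show "p \<in> comb E B'" unfolding comb_def by blast
qed

definition vec :: "('v, 'k::comm_ring_1) epoly \<Rightarrow> 'v set \<Rightarrow> rat" where
  "vec f e = of_nat (lookup (bin_lead f) e) - of_nat (lookup (bin_trail f) e)"

definition pair :: "('v set \<Rightarrow> rat) \<Rightarrow> ('v, 'k::comm_ring_1) epoly \<Rightarrow> rat" where
  "pair y f = wt y (bin_lead f) - wt y (bin_trail f)"

abbreviation bin_deg :: "('v, 'k::comm_ring_1) epoly \<Rightarrow> 'v \<Rightarrow>\<^sub>0 nat" where
  "bin_deg f \<equiv> mono_img (bin_lead f)"

lemma wt_scale: "wt (\<lambda>e. c * y e) m = c * wt y m"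
  by (simp add: wt_def sum_distrib_left mult.assoc)

locale min_system = edge_set E for E :: "'v set set" +
  fixes A :: "('v, 'k::field) epoly set"
  assumes min_sys: "minimal_binomial_system E (toric_ideal E) A"
begin

lemma fin_A: "finite A" and A_polys: "A \<subseteq> polys_on E" and A_bin: "f \<in> A \<Longrightarrow> is_binomial f"
  and comb_A: "comb E A = toric_ideal E"
  using min_sys by (auto simp: min_system_comb)

lemma A_toric: "A \<subseteq> toric_ideal E"
  using subset_comb[OF fin_A, of E] comb_A by simp

lemma irredundant: "f \<in> A \<Longrightarrow> f \<notin> comb E (A - {f})"
  by (rule min_system_irredundant[OF min_sys])

lemma A_nonzero: "f \<in> A \<Longrightarrow> f \<noteq> 0"
proof
  assume f: "f \<in> A" "f = 0"
  have "ideal (comb E (A - {f})) (poly_ring E)" using A_polys by (intro ideal_comb) auto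
  then show False using irredundant[OF f(1)] ideal_poly_ringD(2) f(2) by blast
qed

lemma A_props:
  assumes "f \<in> A"
  shows "f = single (bin_lead f) 1 - single (bin_trail f) 1"
    "keys (bin_lead f) \<subseteq> E" "keys (bin_trail f) \<subseteq> E" "bin_lead f \<noteq> bin_trail f"
    "mono_img (bin_trail f) = bin_deg f"
proof -
  have f: "is_binomial f" "f \<in> toric_ideal E" "f \<noteq> 0"
    using assms A_bin A_toric A_nonzero by auto
  show "f = single (bin_lead f) 1 - single (bin_trail f) 1" by (rule binomial_eq[OF f(1)])
  show "keys (bin_lead f) \<subseteq> E" "keys (bin_trail f) \<subseteq> E" "bin_lead f \<noteq> bin_trail f"
    "mono_img (bin_trail f) = bin_deg f" using binomial_props[OF f] by auto
qed

lemma pair_vec: "f \<in> A \<Longrightarrow> pair y f = (\<Sum>e\<in>E. y e * vec f e)"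
  using A_props(2,3)[of f] fin_E
  by (simp add: pair_def vec_def wt_superset[of E] sum_subtractf right_diff_distrib)

lemma vec_boundary: "f \<in> A \<Longrightarrow> (\<Sum>e\<in>{e\<in>E. v \<in> e}. vec f e) = 0"
proof -
  assume f: "f \<in> A"
  have "lookup (mono_img (bin_lead f)) v = lookup (mono_img (bin_trail f)) v" using A_props(5)[OF f] by simp
  then have "(\<Sum>e\<in>{e\<in>E. v \<in> e}. lookup (bin_lead f) e) = (\<Sum>e\<in>{e\<in>E. v \<in> e}. lookup (bin_trail f) e)"
    by (simp add: lookup_img[OF A_props(2)[OF f]] lookup_img[OF A_props(3)[OF f]])
  then have "(\<Sum>e\<in>{e\<in>E. v \<in> e}. rat_of_nat (lookup (bin_lead f) e)) = (\<Sum>e\<in>{e\<in>E. v \<in> e}. of_nat (lookup (bin_trail f) e))"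
    by (simp flip: of_nat_sum)
  then show ?thesis by (simp add: vec_def sum_subtractf)
qed

text \<open>If \<open>y\<close> separated \<open>a\<close> from \<open>b\<close>, the sum of the coefficients over all monomials of the same
  degree and the same weight as \<open>a\<close> would vanish on the ideal, but not on the binomial of
  \<open>a\<close> and \<open>b\<close>.\<close>
lemma wt_eq_if_pair_eq_0:
  assumes ab: "keys a \<subseteq> E" "keys b \<subseteq> E" "mono_img a = mono_img b"
    and y: "\<And>f. f \<in> A \<Longrightarrow> pm_le (bin_deg f) (mono_img a) \<Longrightarrow> pair y f = 0"
  shows "wt y a = wt y b"
proof (rule ccontr)
  assume ne: "wt y a \<noteq> wt y b"
  define Q where "Q m \<longleftrightarrow> mono_img m = mono_img a \<and> wt y m = wt y a" for m
  have "single a 1 - single b (1::'k) \<in> comb E A"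
    unfolding comb_A toric_ideal_eq_kernel using ab by (rule binomial_in_graded_kernel)
  then obtain c where c: "single a 1 - single b (1::'k) = (\<Sum>f\<in>A. c f * f)"
    unfolding comb_def by (elim CollectE exE conjE)
  have "coeff_sum (\<lambda>n. Q (m + n)) f = 0" if f: "f \<in> A" for m f
  proof -
    note p = A_props[OF f]
    have "Q (m + bin_lead f) \<longleftrightarrow> Q (m + bin_trail f)"
    proof (cases "mono_img (m + bin_lead f) = mono_img a")
      case True
      then have "pm_le (bin_deg f) (mono_img a)" by (metis mono_img_add pm_le_add(2))
      then have "pair y f = 0" using y[OF f] by simp
      then show ?thesis by (simp add: Q_def mono_img_add wt_add p(5) pair_def)
    qed (simp add: Q_def mono_img_add p(5))
    then show ?thesis by (subst p(1)) (simp add: coeff_sum_diff)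
  qed
  then have "coeff_sum Q (\<Sum>f\<in>A. c f * f) = 0"
    by (simp add: coeff_sum_sum coeff_sum_mult)
  moreover have "coeff_sum Q (single a 1 - single b (1::'k)) = 1"
    using ne by (simp add: coeff_sum_diff Q_def)
  ultimately show False using c by simp
qed

text \<open>On the circuit of \<open>e\<close> the weight \<open>y\<close> sees only
  \<open>e\<close>, with different exponents on the two sides, whereas vanishing on all generators
  forces equal weights.\<close>

lemma pairing_nondegenerate:
  assumes F: "max_indep E F" and y: "\<And>f. f \<in> A \<Longrightarrow> pair y f = 0" and y0: "\<And>e. e \<in> F \<Longrightarrow> y e = 0"
    and e: "e \<in> E - F"
  shows "y e = 0"
proof -
  obtain u v where uv: "keys u \<subseteq> insert e F" "keys v \<subseteq> insert e F" "mono_img u = mono_img v"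
    "lookup u e \<noteq> lookup v e" using max_indep_circuit[OF F e] by blast
  have FE: "insert e F \<subseteq> E" "finite F" using F e fin_E by (auto simp: max_indep_def intro: finite_subset)
  have w: "wt y m = y e * of_nat (lookup m e)" if "keys m \<subseteq> insert e F" for m
    using wt_superset[OF _ that, of y] FE(2) e y0 by simp
  have "wt y u = wt y v" using uv FE y by (intro wt_eq_if_pair_eq_0) auto
  then have "y e * of_nat (lookup u e) = y e * of_nat (lookup v e)" using w uv by simp
  then show ?thesis using uv(4) by simp
qed

text \<open>The weights that are free on \<open>E - F\<close> and zero elsewhere pair faithfully
  with \<open>A\<close>. Fewer than \<open>card (E - F)\<close> conditions leave a nonzero one,
  which some generator must detect.\<close>

lemma pair_nontrivial:
  assumes F: "max_indep E F" and B: "B \<subseteq> A" "card B < card (E - F)"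
  shows "\<exists>y. (\<forall>f\<in>B. pair y f = 0) \<and> (\<exists>f\<in>A. pair y f \<noteq> 0)"
proof -
  have "finite B" using B(1) fin_A finite_subset by blast
  then obtain c where c: "\<exists>e\<in>E - F. c e \<noteq> 0" "\<forall>f\<in>B. (\<Sum>e\<in>E - F. c e * vec f e) = 0"
    using homogeneous_system_nontrivial[OF _ _ B(2), of "\<lambda>e f. vec f e"] fin_E by auto
  define y where "y e = (if e \<in> E - F then c e else 0)" for e
  have "pair y f = (\<Sum>e\<in>E - F. c e * vec f e)" if "f \<in> A" for f
    unfolding pair_vec[OF that] using fin_E
    by (intro sum.mono_neutral_cong_right) (auto simp: y_def)
  then have "\<forall>f\<in>B. pair y f = 0" using B(1) c(2) by auto
  moreover have "\<exists>f\<in>A. pair y f \<noteq> 0"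
  proof (rule ccontr)
    assume "\<not> ?thesis"
    then have z: "pair y f = 0" if "f \<in> A" for f using that by blast
    have "y e = 0" if "e \<in> F" for e using that by (simp add: y_def)
    then have "y e = 0" if "e \<in> E - F" for e using pairing_nondegenerate[OF F z _ that] by blast
    then show False using c(1) by (auto simp: y_def)
  qed
  ultimately show ?thesis by blast
qed

lemma card_A_ge: "max_indep E F \<Longrightarrow> card (E - F) \<le> card A"
  using pair_nontrivial[of F A] by (cases "card A < card (E - F)") auto

text \<open>If \<open>A\<close> is no larger than the rank, the generators other than
  \<open>f\<close> impose too few conditions; a weight that they leave over is nonzero on
  \<open>f\<close> and gets rescaled. This is linear independence in the form used later.\<close>

lemma dual_functional:
  assumes "max_indep E F" "card A \<le> card (E - F)" "f \<in> A"
  shows "\<exists>y. pair y f = 1 \<and> (\<forall>g\<in>A - {f}. pair y g = 0)"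
proof -
  have "card (A - {f}) < card (E - F)" using assms card_Diff1_less[OF fin_A assms(3)] by simp
  then obtain y where y: "\<forall>g\<in>A - {f}. pair y g = 0" "\<exists>g\<in>A. pair y g \<noteq> 0"
    using pair_nontrivial[OF assms(1), of "A - {f}"] by auto
  then have nz: "pair y f \<noteq> 0" by blast
  have "pair (\<lambda>e. inverse (pair y f) * y e) g = inverse (pair y f) * pair y g" for g :: "('v, 'k) epoly"
    by (simp only: pair_def wt_scale right_diff_distrib)
  then show ?thesis using y(1) nz by (intro exI[of _ "\<lambda>e. inverse (pair y f) * y e"]) auto
qed

text \<open>Graded Nakayama: in the component of degree \<open>bin_deg a0\<close> the coefficient of
  \<open>a0\<close> is the constant \<open>lookup (s a0) 0\<close>. If it were nonzero,
  \<open>a0\<close> would be a combination of the other generators.\<close>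

lemma syzygy_const_term:
  assumes s: "\<And>a. a \<in> A \<Longrightarrow> s a \<in> polys_on E" and rel: "(\<Sum>a\<in>A. s a * a) = 0" and a0: "a0 \<in> A"
  shows "lookup (s a0) 0 = 0"
proof (rule ccontr)
  assume nz: "lookup (s a0) 0 \<noteq> 0"
  define t where "t a = poly_filter (\<lambda>m. mono_img m + bin_deg a = bin_deg a0) (s a)" for a
  have "poly_filter (\<lambda>m. mono_img m = bin_deg a0) (s a * a) = t a * a" if a: "a \<in> A" for a
  proof -
    note p = A_props[OF a]
    have "s a * a = s a * single (bin_lead a) 1 - s a * single (bin_trail a) 1"
      by (subst (2) p(1)) (simp add: right_diff_distrib)
    then have "poly_filter (\<lambda>m. mono_img m = bin_deg a0) (s a * a) =
        t a * single (bin_lead a) 1 - t a * single (bin_trail a) 1"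
      by (simp add: poly_filter_diff poly_filter_mult_single mono_img_add p(5) t_def)
    also have "\<dots> = t a * a" by (subst (3) p(1)) (simp add: right_diff_distrib)
    finally show ?thesis .
  qed
  then have "(\<Sum>a\<in>A. t a * a) = poly_filter (\<lambda>m. mono_img m = bin_deg a0) (\<Sum>a\<in>A. s a * a)"
    by (simp add: poly_filter_sum)
  also have "\<dots> = 0" by (simp add: rel)
  finally have tz: "(\<Sum>a\<in>A. t a * a) = 0" .
  have "t a0 = single 0 (lookup (s a0) 0)"
  proof (rule poly_mapping_eqI)
    fix m
    have "mono_img m = 0 \<longleftrightarrow> m = 0" if "m \<in> keys (s a0)"
      using s[OF a0] that by (intro img_eq_0) (auto simp: polys_on_def)
    then show "lookup (t a0) m = lookup (single 0 (lookup (s a0) 0)) m"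
      by (auto simp: t_def lookup_poly_filter lookup_single when_def in_keys_iff)
  qed
  then have "single 0 (lookup (s a0) 0) * a0 = - (\<Sum>a\<in>A - {a0}. t a * a)"
    using tz sum.remove[OF fin_A a0, of "\<lambda>a. t a * a"] by (simp add: eq_neg_iff_add_eq_0)
  then have "single 0 (inverse (lookup (s a0) 0)) * (single 0 (lookup (s a0) 0) * a0) =
      single 0 (- inverse (lookup (s a0) 0)) * (\<Sum>a\<in>A - {a0}. t a * a)"
    by (simp add: single_uminus)
  then have eq: "a0 = single 0 (- inverse (lookup (s a0) 0)) * (\<Sum>a\<in>A - {a0}. t a * a)"
    using nz by (simp add: mult.assoc[symmetric] mult_single)
  have "(\<Sum>a\<in>A - {a0}. t a * a) \<in> comb E (A - {a0})"
    unfolding comb_def using s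
    by (intro CollectI exI[of _ t]) (auto simp: t_def intro!: poly_filter_polys_on)
  moreover have "ideal (comb E (A - {a0})) (poly_ring E)" using A_polys by (intro ideal_comb) auto
  ultimately have "single 0 (- inverse (lookup (s a0) 0)) * (\<Sum>a\<in>A - {a0}. t a * a) \<in> comb E (A - {a0})"
    by (intro ideal_poly_ringD(4) single_polys_on) auto
  then have "a0 \<in> comb E (A - {a0})" unfolding eq[symmetric] .
  then show False using irredundant[OF a0] by simp
qed

text \<open>\<open>B\<close> may contain arbitrary, even inhomogeneous, polynomials. If it is
  smaller than \<open>A\<close>, a linear relation \<open>c\<close> between the constant terms of
  the rows of \<open>P\<close> exists; rewriting \<open>A\<close> through \<open>B\<close> and back
  turns it into a syzygy whose constant terms are the \<open>c a\<close>.\<close>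

lemma card_A_le:
  fixes B :: "('v, 'k) epoly set"
  assumes "finite B" "B \<subseteq> polys_on E" "comb E B = toric_ideal E"
  shows "card A \<le> card B"
proof (rule ccontr)
  assume "\<not> ?thesis"
  then have less: "card B < card A" by simp
  have "\<forall>a\<in>A. \<exists>c. (\<forall>b\<in>B. c b \<in> polys_on E) \<and> a = (\<Sum>b\<in>B. c b * b)"
    using A_toric assms(3) unfolding comb_def by blast
  from bchoice[OF this] obtain P where
    P0: "\<forall>a\<in>A. (\<forall>b\<in>B. P a b \<in> polys_on E) \<and> a = (\<Sum>b\<in>B. P a b * b)" ..
  have P: "P a b \<in> polys_on E" if "a \<in> A" "b \<in> B" for a b using P0 that by blast
  have P2: "a = (\<Sum>b\<in>B. P a b * b)" if "a \<in> A" for a using P0 that by blast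
  have "\<forall>b\<in>B. \<exists>c. (\<forall>a\<in>A. c a \<in> polys_on E) \<and> b = (\<Sum>a\<in>A. c a * a)"
    using subset_comb[OF assms(1), of E] assms(3) comb_A unfolding comb_def by blast
  from bchoice[OF this] obtain R where
    R0: "\<forall>b\<in>B. (\<forall>a\<in>A. R b a \<in> polys_on E) \<and> b = (\<Sum>a\<in>A. R b a * a)" ..
  have R: "R b a \<in> polys_on E" if "a \<in> A" "b \<in> B" for a b using R0 that by blast
  have R2: "b = (\<Sum>a\<in>A. R b a * a)" if "b \<in> B" for b using R0 that by blast
  obtain c where c: "\<exists>a\<in>A. c a \<noteq> 0" "\<forall>b\<in>B. (\<Sum>a\<in>A. c a * lookup (P a b) 0) = 0"
    using homogeneous_system_nontrivial[OF assms(1) fin_A less, of "\<lambda>a b. lookup (P a b) 0"] by auto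
  define q where "q b = (\<Sum>a\<in>A. single 0 (c a) * P a b)" for b
  define s where "s a = single 0 (c a) - (\<Sum>b\<in>B. q b * R b a)" for a
  have q0: "lookup (q b) 0 = 0" if "b \<in> B" for b
    using c(2) that by (simp add: q_def lookup_sum lookup_mult_0)
  have qE: "q b \<in> polys_on E" if "b \<in> B" for b
    unfolding q_def using P that by (intro sum_polys_on mult_polys_on single_polys_on) auto
  have "(\<Sum>a\<in>A. single 0 (c a) * a) = (\<Sum>a\<in>A. single 0 (c a) * (\<Sum>b\<in>B. P a b * b))"
    using P2 by (intro sum.cong) auto
  also have "\<dots> = (\<Sum>b\<in>B. q b * b)"
    by (simp add: q_def sum_distrib_left sum_distrib_right mult.assoc) (rule sum.swap)
  also have "\<dots> = (\<Sum>b\<in>B. q b * (\<Sum>a\<in>A. R b a * a))"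
    using R2 by (intro sum.cong) auto
  also have "\<dots> = (\<Sum>a\<in>A. (\<Sum>b\<in>B. q b * R b a) * a)"
    by (simp add: sum_distrib_left sum_distrib_right mult.assoc) (rule sum.swap)
  finally have "(\<Sum>a\<in>A. s a * a) = 0"
    by (simp add: s_def left_diff_distrib sum_subtractf)
  moreover have "s a \<in> polys_on E" if "a \<in> A" for a
    unfolding s_def using qE R that
    by (intro diff_polys_on single_polys_on sum_polys_on mult_polys_on) auto
  ultimately have "lookup (s a) 0 = 0" if "a \<in> A" for a using syzygy_const_term that by blast
  moreover have "lookup (s a) 0 = c a" for a
    using q0 by (simp add: s_def lookup_minus lookup_sum lookup_mult_0)
  ultimately show False using c(1) by auto
qed

text \<open>The height is the rank, every finite generating set has at least \<open>card A\<close>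
  elements, and \<open>card A\<close> is at least the rank. Any single minimal system therefore
  decides the question.\<close>

theorem complete_intersection_iff:
  assumes "max_indep E F"
  shows "complete_intersection (poly_ring E) (toric_ideal E :: ('v, 'k) epoly set) \<longleftrightarrow> card A \<le> card (E - F)"
proof
  assume "complete_intersection (poly_ring E) (toric_ideal E :: ('v, 'k) epoly set)"
  then obtain B :: "('v, 'k) epoly set" where B: "finite B" "B \<subseteq> polys_on E"
    "genideal (poly_ring E) B = toric_ideal E" "card B = card (E - F)"
    by (auto simp: complete_intersection_def ideal_height_toric[OF assms])
  then show "card A \<le> card (E - F)" using card_A_le[of B] by (simp add: genideal_eq_comb)
next
  assume "card A \<le> card (E - F)"
  then have "card A = card (E - F)" using card_A_ge[OF assms] by simp
  then show "complete_intersection (poly_ring E) (toric_ideal E :: ('v, 'k) epoly set)"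
    unfolding complete_intersection_def ideal_height_toric[OF assms]
    using fin_A A_polys comb_A by (auto intro!: exI[of _ A] simp: genideal_eq_comb)
qed

end

context edge_set
begin

definition induced :: "'v set \<Rightarrow> 'v set set" where
  "induced S = {e \<in> E. e \<subseteq> S}"

lemma edge_set_induced: "edge_set (induced S)"
  using fin_E card_edge by unfold_locales (auto simp: induced_def)

lemma keys_induced_iff: "keys m \<subseteq> E \<Longrightarrow> keys m \<subseteq> induced S \<longleftrightarrow> keys (mono_img m) \<subseteq> S"
  by (auto simp: keys_img induced_def)

end

context min_system
begin

text \<open>A monomial supported on an induced subgraph only has companions of the same degree
  supported on that subgraph, so restricting the generators loses nothing.\<close>
lemma min_system_induced: "min_system (induced S) (A \<inter> polys_on (induced S))"
proof -
  let ?E = "induced S"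
  let ?A = "A \<inter> polys_on ?E"
  define \<pi> where "\<pi> p = poly_filter (\<lambda>m. keys m \<subseteq> ?E) p" for p :: "('v, 'k) epoly"
  have EE: "?E \<subseteq> E" by (auto simp: induced_def)
  have finA: "finite ?A" using fin_A by simp
  have \<pi>on: "\<pi> p \<in> polys_on ?E" for p by (auto simp: \<pi>_def polys_on_def keys_poly_filter)
  have \<pi>id: "\<pi> p = p" if "p \<in> polys_on ?E" for p
    using that by (intro poly_mapping_eqI) (auto simp: \<pi>_def lookup_poly_filter polys_on_def in_keys_iff)
  have lt: "keys (bin_lead f) \<subseteq> ?E \<longleftrightarrow> keys (bin_trail f) \<subseteq> ?E" if "f \<in> A" for f
    using A_props[OF that] by (simp add: keys_induced_iff)
  have memA: "f \<in> ?A \<longleftrightarrow> keys (bin_lead f) \<subseteq> ?E" if f: "f \<in> A" for f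
  proof
    assume "f \<in> ?A"
    moreover have "bin_lead f \<in> keys f"
      using A_props(4)[OF f] by (subst A_props(1)[OF f]) (simp add: in_keys_iff lookup_minus lookup_single when_def)
    ultimately show "keys (bin_lead f) \<subseteq> ?E" by (auto simp: polys_on_def)
  next
    assume "keys (bin_lead f) \<subseteq> ?E"
    then have "single (bin_lead f) 1 - single (bin_trail f) (1::'k) \<in> polys_on ?E"
      using lt[OF f] by (intro diff_polys_on single_polys_on) auto
    then show "f \<in> ?A" using f A_props(1)[OF f] by simp
  qed
  \<comment> \<open>\<open>\<pi>\<close> sets the variables outside the subgraph to zero. Both
    monomials of \<open>f\<close> survive or neither does, because their common degree decides
    this.\<close>
  have \<pi>mult: "\<pi> (p * f) = (if f \<in> ?A then \<pi> p * f else 0)" if f: "f \<in> A" for p f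
  proof -
    note pr = A_props[OF f]
    have pf: "p * f = p * single (bin_lead f) 1 - p * single (bin_trail f) 1"
      by (subst (1) pr(1)) (simp add: right_diff_distrib)
    show ?thesis
    proof (cases "f \<in> ?A")
      case True
      then have k: "keys (bin_lead f) \<subseteq> ?E" "keys (bin_trail f) \<subseteq> ?E" using memA[OF f] lt[OF f] by auto
      have "\<pi> (p * f) = \<pi> p * single (bin_lead f) 1 - \<pi> p * single (bin_trail f) 1"
        using k by (simp add: pf \<pi>_def poly_filter_diff poly_filter_mult_single keys_add_nat)
      also have "\<dots> = \<pi> p * f" by (subst (3) pr(1)) (simp add: right_diff_distrib)
      finally show ?thesis using True by simp
    next
      case False
      then have k: "\<not> keys (bin_lead f) \<subseteq> ?E" "\<not> keys (bin_trail f) \<subseteq> ?E" using memA[OF f] lt[OF f] by auto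
      have "poly_filter (\<lambda>m. False) q = 0" for q :: "('v, 'k) epoly"
        by (rule poly_mapping_eqI) (simp add: lookup_poly_filter)
      then have "\<pi> (p * f) = 0"
        using k by (simp add: pf \<pi>_def poly_filter_diff poly_filter_mult_single keys_add_nat)
      then show ?thesis by (simp only: False if_False)
    qed
  qed
  have tor: "toric_ideal ?E = toric_ideal E \<inter> (polys_on ?E :: ('v, 'k) epoly set)"
    using polys_on_mono[OF EE] by (auto simp: toric_ideal_def)
  have gen: "comb ?E ?A = toric_ideal ?E"
  proof
    show "comb ?E ?A \<subseteq> toric_ideal ?E"
      using A_toric by (intro comb_subset_ideal ideal_toric_ideal) (auto simp: tor)
    show "toric_ideal ?E \<subseteq> comb ?E ?A"
    proof
      fix p :: "('v, 'k) epoly" assume p: "p \<in> toric_ideal ?E"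
      then have "p \<in> comb E A" using comb_A tor by auto
      then obtain c where c: "p = (\<Sum>f\<in>A. c f * f)" unfolding comb_def by blast
      have "p = \<pi> p" using p by (simp add: \<pi>id tor)
      also have "\<dots> = (\<Sum>f\<in>A. \<pi> (c f * f))" unfolding c by (simp add: \<pi>_def poly_filter_sum)
      also have "\<dots> = (\<Sum>f\<in>?A. \<pi> (c f) * f)"
        using fin_A by (intro sum.mono_neutral_cong_right) (auto simp: \<pi>mult)
      finally show "p \<in> comb ?E ?A"
        unfolding comb_def by (intro CollectI exI[of _ "\<lambda>f. \<pi> (c f)"] conjI ballI \<pi>on)
    qed
  qed
  have "comb ?E B \<noteq> toric_ideal ?E" if B: "B \<subset> ?A" for B
  proof
    assume eq: "comb ?E B = toric_ideal ?E"
    obtain f where f: "f \<in> ?A" "f \<notin> B" using B by auto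
    then have "f \<in> comb ?E B" using eq A_toric by (auto simp: tor)
    then have "f \<in> comb E (A - {f})" using comb_mono[OF EE, of B "A - {f}"] B f fin_A by auto
    then show False using irredundant f by blast
  qed
  then have "minimal_binomial_system ?E (toric_ideal ?E) ?A"
    unfolding min_system_comb using finA gen A_bin by blast
  then show ?thesis by (intro min_system.intro min_system_axioms.intro edge_set_induced)
qed

end

section \<open>Potentials, odd closed walks and dumbbells\<close>

section \<open>Potentials and alternating sums along walks\<close>

definition is_pot :: "('v set \<Rightarrow> rat) \<Rightarrow> 'v set set \<Rightarrow> ('v \<Rightarrow> rat) \<Rightarrow> bool" where
  "is_pot y X \<phi> \<longleftrightarrow> (\<forall>a b. {a, b} \<in> X \<longrightarrow> y {a, b} = \<phi> a + \<phi> b)"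

text \<open>On \<open>X\<close> the weight lies in the row space of the incidence matrix. Dually,
  this fails exactly when some even closed walk has a nonzero alternating sum.\<close>

definition cob :: "('v set \<Rightarrow> rat) \<Rightarrow> 'v set set \<Rightarrow> bool" where
  "cob y X \<longleftrightarrow> (\<exists>\<phi>. is_pot y X \<phi>)"

text \<open>Equivalently, the component of \<open>c\<close> in the graph \<open>X\<close> is not bipartite.\<close>
definition rigid :: "'v set set \<Rightarrow> 'v \<Rightarrow> bool" where
  "rigid X c \<longleftrightarrow> (\<forall>\<psi>::'v \<Rightarrow> rat. (\<forall>a b. {a, b} \<in> X \<longrightarrow> \<psi> a + \<psi> b = 0) \<longrightarrow> \<psi> c = 0)"

lemma is_potD: "is_pot y X \<phi> \<Longrightarrow> {a, b} \<in> X \<Longrightarrow> y {a, b} = \<phi> a + \<phi> b"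
  by (simp add: is_pot_def)

lemma is_pot_mono: "is_pot y X \<phi> \<Longrightarrow> X' \<subseteq> X \<Longrightarrow> is_pot y X' \<phi>"
  by (auto simp: is_pot_def)

lemma rigid_mono: "rigid X c \<Longrightarrow> X \<subseteq> X' \<Longrightarrow> rigid X' c"
  by (auto simp: rigid_def)

lemma pot_unique:
  assumes "rigid X c" "is_pot y X \<phi>" "is_pot y X \<phi>'"
  shows "\<phi> c = \<phi>' c"
proof -
  have "(\<phi> a - \<phi>' a) + (\<phi> b - \<phi>' b) = 0" if "{a, b} \<in> X" for a b
    using is_potD[OF assms(2) that] is_potD[OF assms(3) that] by simp
  then have "\<phi> c - \<phi>' c = 0" using assms(1)[unfolded rigid_def, rule_format, of "\<lambda>a. \<phi> a - \<phi>' a"] by blast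
  then show ?thesis by simp
qed

definition walk_sum :: "('v set \<Rightarrow> rat) \<Rightarrow> (nat \<Rightarrow> 'v) \<Rightarrow> nat \<Rightarrow> rat" where
  "walk_sum y v n = (\<Sum>k<n. (-1) ^ k * y {v k, v (Suc k)})"

definition walk_on :: "'v set set \<Rightarrow> (nat \<Rightarrow> 'v) \<Rightarrow> nat \<Rightarrow> bool" where
  "walk_on X v n \<longleftrightarrow> (\<forall>k<n. {v k, v (Suc k)} \<in> X)"

text \<open>Hides the vertex sequence behind length, end points and alternating sum, so that walks
  can be concatenated and reversed without index arithmetic.\<close>

definition walk :: "('v set \<Rightarrow> rat) \<Rightarrow> 'v set set \<Rightarrow> nat \<Rightarrow> 'v \<Rightarrow> 'v \<Rightarrow> rat \<Rightarrow> bool" where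
  "walk y X n a b t \<longleftrightarrow> (\<exists>v. v 0 = a \<and> v n = b \<and> walk_on X v n \<and> t = walk_sum y v n)"

lemma walk_sum_add:
  "walk_sum y v (n + m) = walk_sum y v n + (-1) ^ n * walk_sum y (\<lambda>k. v (n + k)) m"
  by (simp add: walk_sum_def sum_lessThan_add power_add sum_distrib_left mult.assoc)

lemma walk_0: "walk y X 0 a a 0"
  by (auto simp: walk_def walk_on_def walk_sum_def)

lemma walk_edge: "{a, b} \<in> X \<Longrightarrow> walk y X 1 a b (y {a, b})"
  unfolding walk_def by (intro exI[of _ "\<lambda>k. if k = 0 then a else b"]) (auto simp: walk_on_def walk_sum_def)

lemma walk_trans:
  assumes "walk y X n a b s" "walk y X m b c t"
  shows "walk y X (n + m) a c (s + (-1) ^ n * t)"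
proof -
  obtain v where v: "v 0 = a" "v n = b" "walk_on X v n" "s = walk_sum y v n"
    using assms(1) by (auto simp: walk_def)
  obtain w where w: "w 0 = b" "w m = c" "walk_on X w m" "t = walk_sum y w m"
    using assms(2) by (auto simp: walk_def)
  define u where "u k = (if k \<le> n then v k else w (k - n))" for k
  have un: "u (n + k) = w k" for k using v(2) w(1) by (auto simp: u_def)
  have "walk_sum y u n = s" unfolding v(4) walk_sum_def by (intro sum.cong) (auto simp: u_def)
  then have "walk_sum y u (n + m) = s + (-1) ^ n * t" by (simp add: walk_sum_add un w(4))
  moreover have "walk_on X u (n + m)"
    unfolding walk_on_def
  proof (intro allI impI)
    fix k assume k: "k < n + m"
    show "{u k, u (Suc k)} \<in> X"
    proof (cases "k < n")
      case True
      then show ?thesis using v(3) by (auto simp: u_def walk_on_def)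
    next
      case False
      then obtain j where "k = n + j" using le_Suc_ex by (metis not_less)
      then show ?thesis using w(3) k un[of j] un[of "Suc j"] by (auto simp: walk_on_def)
    qed
  qed
  moreover have "u 0 = a" "u (n + m) = c" using v w un[of m] by (auto simp: u_def)
  ultimately show ?thesis unfolding walk_def by metis
qed

lemma walk_on_shift: "walk_on X v N \<Longrightarrow> i + n \<le> N \<Longrightarrow> walk_on X (\<lambda>k. v (i + k)) n"
  by (auto simp: walk_on_def)

lemma walk_segment:
  assumes "walk_on X v N" "i \<le> j" "j \<le> N"
  shows "walk y X (j - i) (v i) (v j) (walk_sum y (\<lambda>k. v (i + k)) (j - i))"
  unfolding walk_def using walk_on_shift[OF assms(1), of i "j - i"] assms(2,3)
  by (intro exI[of _ "\<lambda>k. v (i + k)"]) auto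

lemma walk_split:
  assumes "walk_on X v N" "k \<le> N"
  obtains s t where "walk y X k (v 0) (v k) s" "walk y X (N - k) (v k) (v N) t"
    "walk_sum y v N = s + (-1) ^ k * t"
  using that[of "walk_sum y v k" "walk_sum y (\<lambda>i. v (k + i)) (N - k)"]
    walk_segment[OF assms(1), of 0 k y] walk_segment[OF assms(1), of k N y]
    walk_sum_add[of y v k "N - k"] assms(2) by simp

text \<open>Reversing an even walk negates its alternating sum, reversing an odd walk preserves it:
  the first edge always counts positively.\<close>

lemma walk_rev: "walk y X n a b t \<Longrightarrow> walk y X n b a (- ((-1) ^ n) * t)"
proof (induction n arbitrary: a t)
  case 0
  then show ?case by (auto simp: walk_def walk_on_def walk_sum_def)
next
  case (Suc n)
  then obtain v where v: "v 0 = a" "v (Suc n) = b" "walk_on X v (Suc n)" "t = walk_sum y v (Suc n)"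
    by (auto simp: walk_def)
  obtain r s where rs: "walk y X 1 (v 0) (v 1) r" "walk y X (Suc n - 1) (v 1) (v (Suc n)) s" "t = r + (-1) ^ 1 * s"
    using walk_split[OF v(3), of 1] v(4) by auto
  have e: "{v 0, v 1} \<in> X" using v(3) by (auto simp: walk_on_def)
  have r: "r = y {v 0, v 1}" using rs(1) unfolding walk_def by (auto simp: walk_sum_def)
  have "walk y X n b (v 1) (- ((-1) ^ n) * s)" using Suc.IH rs(2) v(2) by simp
  from walk_trans[OF this walk_edge[of "v 1" "v 0"]] e
  have "walk y X (n + 1) b a (- ((-1) ^ n) * s + (-1) ^ n * r)"
    using v(1) r by (simp add: insert_commute)
  moreover have "- ((-1) ^ n) * s + (-1) ^ n * r = - ((-1) ^ Suc n) * t" unfolding rs(3) by (simp add: algebra_simps)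
  ultimately show ?case by simp
qed

text \<open>The value at a root of each component determines \<open>\<phi>\<close> along walks
  through \<open>\<phi> b = y {a, b} - \<phi> a\<close>. An odd closed walk at the root forces half
  of its alternating sum there; if none exists, the value is free and set to 0.\<close>

lemma cob_if_closed_walks_vanish:
  assumes ev: "\<And>n a t. even n \<Longrightarrow> walk y X n a a t \<Longrightarrow> t = 0"
  shows "cob y X"
proof -
  define con where "con a b \<longleftrightarrow> (\<exists>n t. walk y X n a b t)" for a b
  have con_refl: "con a a" for a unfolding con_def using walk_0 by metis
  have con_sym: "con a b \<Longrightarrow> con b a" for a b unfolding con_def using walk_rev by metis
  have con_trans: "con a b \<Longrightarrow> con b c \<Longrightarrow> con a c" for a b c unfolding con_def using walk_trans by metis
  define rt where "rt a = (SOME r. con a r)" for a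
  have rt: "con (rt a) a" for a unfolding rt_def using someI[of "con a" a] con_refl con_sym by metis
  have rt_eq: "rt a = rt b" if "con a b" for a b
  proof -
    have "con a = con b" using that con_sym con_trans by (intro ext) metis
    then show ?thesis by (simp add: rt_def)
  qed
  define c0 where "c0 r = (if \<exists>n t. odd n \<and> walk y X n r r t then (SOME t. \<exists>n. odd n \<and> walk y X n r r t) / 2 else 0)" for r
  \<comment> \<open>Two odd closed walks at \<open>r\<close> concatenate to an even one, whose
    vanishing says that their sums agree.\<close>
  have c0: "c0 r = t / 2" if "odd n" "walk y X n r r t" for r n t
  proof -
    have "\<exists>t n. odd n \<and> walk y X n r r t" using that by blast
    from someI_ex[OF this] obtain m where m: "odd m" "walk y X m r r (SOME t. \<exists>n. odd n \<and> walk y X n r r t)" by blast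
    have "(SOME t. \<exists>n. odd n \<and> walk y X n r r t) + (-1) ^ m * t = 0"
      using m(1) that(1) by (intro ev[OF _ walk_trans[OF m(2) that(2)]]) simp
    then show ?thesis using that m(1) by (auto simp: c0_def)
  qed
  have wd: "(-1) ^ n * (c0 r - t) = (-1) ^ n' * (c0 r - t')"
    if w: "walk y X n r a t" "walk y X n' r a t'" for n n' r a t t'
  proof -
    have cl: "walk y X (n + n') r r (t + (-1) ^ n * (- ((-1) ^ n') * t'))"
      using walk_trans[OF w(1) walk_rev[OF w(2)]] .
    show ?thesis
    proof (cases "even (n + n')")
      case True
      then have "t + (-1) ^ n * (- ((-1) ^ n') * t') = 0" using ev[OF _ cl] by simp
      then show ?thesis using True by (cases "even n") auto
    next
      case False
      then have "c0 r = (t + (-1) ^ n * (- ((-1) ^ n') * t')) / 2" using c0[OF _ cl] by simp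
      then show ?thesis using False by (cases "even n") (auto simp: field_simps)
    qed
  qed
  define \<phi> where "\<phi> a = (SOME z. \<exists>n t. walk y X n (rt a) a t \<and> z = (-1) ^ n * (c0 (rt a) - t))" for a
  have \<phi>: "\<phi> a = (-1) ^ n * (c0 (rt a) - t)" if w: "walk y X n (rt a) a t" for a n t
  proof -
    have "\<exists>z n t. walk y X n (rt a) a t \<and> z = (-1) ^ n * (c0 (rt a) - t)" using w by blast
    from someI_ex[OF this] obtain n' t' where
      "walk y X n' (rt a) a t'" "\<phi> a = (-1) ^ n' * (c0 (rt a) - t')" unfolding \<phi>_def by blast
    then show ?thesis using wd[OF w] by simp
  qed
  have "y {a, b} = \<phi> a + \<phi> b" if e: "{a, b} \<in> X" for a b
  proof -
    obtain n t where w: "walk y X n (rt a) a t" using rt unfolding con_def by blast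
    have "rt b = rt a" using rt_eq[of a b] walk_edge[OF e, of y] unfolding con_def by metis
    then have "walk y X (n + 1) (rt b) b (t + (-1) ^ n * y {a, b})"
      using walk_trans[OF w walk_edge[OF e]] by simp
    from \<phi>[OF this] \<phi>[OF w] \<open>rt b = rt a\<close> show ?thesis
      by (cases "even n") (auto simp: algebra_simps)
  qed
  then show ?thesis by (auto simp: cob_def is_pot_def)
qed

lemma minus_one_power_diff: "odd l \<Longrightarrow> k \<le> l \<Longrightarrow> (-1 :: rat) ^ (l - k) = - ((-1) ^ k)"
  by (simp add: minus_one_power_iff)

text \<open>Two odd closed walks at a common vertex that are glued together once more can be recombined
  into two even closed walks, each shorter than the concatenation.\<close>
lemma odd_closed_walks_recombine:
  assumes short: "\<And>n x t. even n \<Longrightarrow> n < l + l' \<Longrightarrow> walk y X n x x t \<Longrightarrow> t = 0"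
    and l: "odd l" "odd l'" and k: "0 < k" "k < l" and m: "0 < m" "m < l'"
    and a: "walk y X k c x sa" and b: "walk y X (l - k) x c sb"
    and g: "walk y X m c z sg" and d: "walk y X (l' - m) z c sd"
    and glue: "x = z \<or> {x, z} \<in> X"
  shows "sa + (-1) ^ k * sb = sg + (-1) ^ m * sd"
proof -
  have lk: "(-1 :: rat) ^ (l - k) = - ((-1) ^ k)" using l k by (intro minus_one_power_diff) auto
  have lm: "(-1 :: rat) ^ (l' - m) = - ((-1) ^ m)" using l m by (intro minus_one_power_diff) auto
  note gr = walk_rev[OF g] and dr = walk_rev[OF d]
  from glue show ?thesis
  proof
    assume xz: "x = z"
    show ?thesis
    \<comment> \<open>The parity of \<open>k + m\<close> decides which pieces close up to even
      walks. Both results are shorter than \<open>l + l'\<close> because \<open>k\<close> and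
      \<open>m\<close> lie strictly inside their ranges. With a connecting edge the two parities
      exchange roles.\<close>
    proof (cases "even (k + m)")
      case True
      have 1: "sa + (-1) ^ k * (- ((-1) ^ m) * sg) = 0"
        using walk_trans[OF a gr[folded xz]] k m True by (intro short[of "k + m"]) auto
      have 2: "sb + (-1) ^ (l - k) * (- ((-1) ^ (l' - m)) * sd) = 0"
        using walk_trans[OF b dr[folded xz]] k m l True by (intro short[of "(l - k) + (l' - m)"]) auto
      show ?thesis using 1 2 True unfolding lk lm by (cases "even k") auto
    next
      case False
      have 1: "sb + (-1) ^ (l - k) * sg = 0"
        using walk_trans[OF b g[folded xz]] k m l False by (intro short[of "(l - k) + m"]) auto
      have 2: "sd + (-1) ^ (l' - m) * sa = 0"
        using walk_trans[OF d[folded xz] a] k m l False by (intro short[of "(l' - m) + k"]) auto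
      show ?thesis using 1 2 False unfolding lk lm by (cases "even k") auto
    qed
  next
    assume "{x, z} \<in> X"
    then have e: "walk y X 1 x z (y {x, z})" "walk y X 1 z x (y {x, z})"
      using walk_edge[of x z X y] walk_edge[of z x X y] by (auto simp: insert_commute)
    show ?thesis
    proof (cases "even (k + m)")
      case False
      have 1: "sa + (-1) ^ k * (y {x, z} + (-1) ^ 1 * (- ((-1) ^ m) * sg)) = 0"
        using walk_trans[OF a walk_trans[OF e(1) gr]] k m l False by (intro short[of "k + (1 + m)"]) auto
      have 2: "sb + (-1) ^ (l - k) * ((- ((-1) ^ (l' - m)) * sd) + (-1) ^ (l' - m) * y {x, z}) = 0"
        using walk_trans[OF b walk_trans[OF dr e(2)]] k m l False
        by (intro short[of "(l - k) + ((l' - m) + 1)"]) auto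
      show ?thesis using 1 2 False unfolding lk lm by (cases "even k") auto
    next
      case True
      have 1: "sb + (-1) ^ (l - k) * (sg + (-1) ^ m * y {x, z}) = 0"
        using walk_trans[OF b walk_trans[OF g e(2)]] k m l True
        by (intro short[of "(l - k) + (m + 1)"]) auto
      have 2: "sd + (-1) ^ (l' - m) * (sa + (-1) ^ k * y {x, z}) = 0"
        using walk_trans[OF d walk_trans[OF a e(1)]] k m l True
        by (intro short[of "(l' - m) + (k + 1)"]) auto
      show ?thesis using 1 2 True unfolding lk lm by (cases "even k") auto
    qed
  qed
qed

text \<open>A shortest even closed walk on which \<open>y\<close> does not vanish repeats a vertex,
  since \<open>y\<close> vanishes on cycles. It splits there into two closed walks, odd by
  minimality; any further contact between them would permit the recombination into shorter even
  walks and make their sums equal.\<close>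

lemma cut_vertex_of_non_coboundary:
  assumes loop: "\<And>a. {a} \<notin> X" and nc: "\<not> cob y X"
    and cyc: "\<And>v N. even N \<Longrightarrow> v N = v 0 \<Longrightarrow> inj_on v {..<N} \<Longrightarrow> walk_on X v N \<Longrightarrow> walk_sum y v N = 0"
  obtains p q :: "nat \<Rightarrow> 'v" and l l' where "odd l" "odd l'" "l > 1" "l' > 1"
    "p l = p 0" "q l' = q 0" "p 0 = q 0" "walk_on X p l" "walk_on X q l'" "walk_sum y p l \<noteq> walk_sum y q l'"
    "\<And>k m. 0 < k \<Longrightarrow> k < l \<Longrightarrow> 0 < m \<Longrightarrow> m < l' \<Longrightarrow> p k \<noteq> q m \<and> {p k, q m} \<notin> X"
proof -
  define bad where "bad n \<longleftrightarrow> even n \<and> (\<exists>a t. walk y X n a a t \<and> t \<noteq> 0)" for n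
  have "\<exists>n. bad n" using cob_if_closed_walks_vanish[of y X] nc unfolding bad_def by blast
  define N where "N = (LEAST n. bad n)"
  have badN: "bad N" unfolding N_def using \<open>\<exists>n. bad n\<close> by (rule LeastI_ex)
  have short: "t = 0" if "even n" "n < N" "walk y X n x x t" for n x t
    using not_less_Least[of n bad] that unfolding N_def bad_def by blast
  obtain v where v: "v N = v 0" "walk_on X v N" "walk_sum y v N \<noteq> 0" and evN: "even N"
    using badN unfolding bad_def walk_def by metis
  have "\<not> inj_on v {..<N}" using cyc[OF evN v(1) _ v(2)] v(3) by blast
  then obtain i j where ij: "i < j" "j < N" "v i = v j" unfolding inj_on_def by (metis lessThan_iff linorder_neqE_nat)
  define s1 where "s1 = walk_sum y v i"
  define s2 where "s2 = walk_sum y (\<lambda>k. v (i + k)) (j - i)"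
  define s3 where "s3 = walk_sum y (\<lambda>k. v (j + k)) (N - j)"
  have w1: "walk y X i (v 0) (v i) s1" using walk_segment[OF v(2), of 0 i y] ij by (simp add: s1_def)
  have w2: "walk y X (j - i) (v i) (v i) s2" using walk_segment[OF v(2), of i j y] ij by (simp add: s2_def)
  have w3: "walk y X (N - j) (v i) (v 0) s3" using walk_segment[OF v(2), of j N y] ij v(1) by (simp add: s3_def)
  have tot: "walk_sum y v N = s1 + (-1) ^ i * s2 + (-1) ^ j * s3"
  proof -
    have "walk_sum y v j = s1 + (-1) ^ i * s2" using walk_sum_add[of y v i "j - i"] ij by (simp add: s1_def s2_def)
    then show ?thesis using walk_sum_add[of y v j "N - j"] ij by (simp add: s3_def)
  qed
  define l where "l = j - i"
  define l' where "l' = (N - j) + i"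
  have ll: "l + l' = N" using ij by (simp add: l_def l'_def)
  have oddl: "odd l"
  proof
    assume el: "even l"
    have "s2 = 0" using short[OF _ _ w2] el ij by (simp add: l_def)
    moreover have "s1 + (-1) ^ i * s3 = 0"
      using short[OF _ _ walk_trans[OF w1 w3]] el ij evN by (simp add: l_def)
    moreover have "(-1 :: rat) ^ j = (-1) ^ i"
    proof -
      have "even j \<longleftrightarrow> even i" using el ij by (simp add: l_def)
      then show ?thesis by (simp add: minus_one_power_iff)
    qed
    ultimately show False using tot v(3) by simp
  qed
  then have oddl': "odd l'" using ll evN by (metis even_add)
  obtain p where p: "p 0 = v i" "p l = v i" "walk_on X p l" "s2 = walk_sum y p l"
    using w2 unfolding walk_def l_def by blast
  obtain q where q: "q 0 = v i" "q l' = v i" "walk_on X q l'" "s3 + (-1) ^ (N - j) * s1 = walk_sum y q l'"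
    using walk_trans[OF w3 w1] unfolding walk_def l'_def by metis
  \<comment> \<open>In the total the inner walk enters with sign \<open>(-1) ^ i\<close> and the
    outer one, started at the repeated vertex, with \<open>(-1) ^ j\<close>. These signs are
    opposite, so equal sums would cancel.\<close>
  have ne: "walk_sum y p l \<noteq> walk_sum y q l'"
  proof
    assume "walk_sum y p l = walk_sum y q l'"
    then have eq: "s2 = s3 + (-1) ^ (N - j) * s1" using p q by simp
    have "even i \<longleftrightarrow> odd j" using oddl ij by (simp add: l_def)
    moreover have "even (N - j) \<longleftrightarrow> even j" using evN ij by simp
    ultimately have "walk_sum y v N = 0" unfolding tot eq by (cases "even j") auto
    then show False using v(3) by simp
  qed
  have gt1: "1 < n" if "odd n" "w n = w 0" "walk_on X w n" for w n
  proof (rule ccontr)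
    assume "\<not> 1 < n"
    then have "n = 1" using that(1) by (cases n) auto
    then have "{w 0, w 1} \<in> X" "w 1 = w 0" using that(2,3) by (auto simp: walk_on_def)
    then show False using loop by simp
  qed
  have sep: "p k \<noteq> q m \<and> {p k, q m} \<notin> X" if km: "0 < k" "k < l" "0 < m" "m < l'" for k m
  proof (rule ccontr)
    assume "\<not> ?thesis"
    then have glue: "p k = q m \<or> {p k, q m} \<in> X" by blast
    obtain sa sb where ab: "walk y X k (p 0) (p k) sa" "walk y X (l - k) (p k) (p l) sb"
      "walk_sum y p l = sa + (-1) ^ k * sb" using walk_split[OF p(3), of k] km by auto
    obtain sg sd where gd: "walk y X m (q 0) (q m) sg" "walk y X (l' - m) (q m) (q l') sd"
      "walk_sum y q l' = sg + (-1) ^ m * sd" using walk_split[OF q(3), of m] km by auto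
    have "sa + (-1) ^ k * sb = sg + (-1) ^ m * sd"
      by (rule odd_closed_walks_recombine[of l l' y X k m "v i" "p k" sa sb "q m" sg sd])
         (use short ll oddl oddl' km ab gd p q glue in auto)
    then show False using ne ab gd by simp
  qed
  show thesis
    by (rule that[OF oddl oddl' _ _ _ _ _ p(3) q(3) ne sep])
       (use gt1[OF oddl _ p(3)] gt1[OF oddl' _ q(3)] p q in auto)
qed

section \<open>Minimal rigid sets\<close>

context edge_set
begin

lemma edge_distinct: "{a, b} \<in> E \<Longrightarrow> a \<noteq> b"
  using card_edge[of "{a, b}"] by auto

lemma edge_ends: "e \<in> E \<Longrightarrow> \<exists>a b. e = {a, b} \<and> a \<noteq> b"
  using card_edge[of e] by (auto simp: card_2_iff)

lemma induced_iff: "{a, b} \<in> induced S \<longleftrightarrow> {a, b} \<in> E \<and> a \<in> S \<and> b \<in> S"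
  by (auto simp: induced_def)

lemma induced_mono: "S \<subseteq> T \<Longrightarrow> induced S \<subseteq> induced T"
  by (auto simp: induced_def)

lemma induced_subset: "induced S \<subseteq> E"
  by (auto simp: induced_def)

text \<open>A minimal rigid set consists of two geodesics starting in \<open>c\<close> whose end points are adjacent:
  a tree plus one edge closing an odd cycle.\<close>
lemma minimal_rigid_no_cycles:
  fixes d :: "'v set \<Rightarrow> rat"
  assumes c: "c \<in> S" and rig: "rigid (induced S) c"
    and min: "\<And>T. T \<subset> S \<Longrightarrow> c \<in> T \<Longrightarrow> \<not> rigid (induced T) c"
    and d: "\<And>v. v \<in> S \<Longrightarrow> (\<Sum>e\<in>{e\<in>induced S. v \<in> e}. d e) = 0"
    and e0: "e0 \<in> induced S"
  shows "d e0 = 0"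
proof -
  let ?X = "induced S"
  have finX: "finite ?X" using fin_E finite_subset[OF induced_subset] by blast
  have min': "T = S" if "T \<subseteq> S" "c \<in> T" "rigid (induced T) c" for T
    using min[of T] that by blast
  \<comment> \<open>The vertices connected to \<open>c\<close> inside \<open>S\<close> are already
    rigid, because a solution on them extends by 0; minimality makes them all of
    \<open>S\<close>.\<close>
  have reach: "(c, x) \<in> (adj_rel ?X)\<^sup>*" if "x \<in> S" for x
  proof -
    define T where "T = {x \<in> S. (c, x) \<in> (adj_rel ?X)\<^sup>*}"
    have "rigid (induced T) c"
      unfolding rigid_def
    proof (intro allI impI)
      fix \<psi> :: "'v \<Rightarrow> rat" assume \<psi>: "\<forall>a b. {a, b} \<in> induced T \<longrightarrow> \<psi> a + \<psi> b = 0"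
      define \<psi>' where "\<psi>' x = (if x \<in> T then \<psi> x else 0)" for x
      have "\<psi>' a + \<psi>' b = 0" if ab: "{a, b} \<in> ?X" for a b
      proof -
        have S: "a \<in> S" "b \<in> S" "{a, b} \<in> E" using ab by (auto simp: induced_iff)
        have "(a, b) \<in> adj_rel ?X" "(b, a) \<in> adj_rel ?X" using ab by (auto simp: adj_rel_def insert_commute)
        then have "a \<in> T \<longleftrightarrow> b \<in> T" using S by (auto simp: T_def intro: rtrancl_into_rtrancl)
        then show ?thesis using \<psi> S by (auto simp: \<psi>'_def induced_iff)
      qed
      then have "\<psi>' c = 0" using rig unfolding rigid_def by blast
      then show "\<psi> c = 0" using c by (simp add: \<psi>'_def T_def)
    qed
    then have "T = S" using c by (intro min') (auto simp: T_def)
    then show ?thesis using that by (auto simp: T_def)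
  qed
  define \<delta> where "\<delta> x = (LEAST n. (c, x) \<in> adj_rel ?X ^^ n)" for x
  have \<delta>rel: "(c, x) \<in> adj_rel ?X ^^ \<delta> x" if "x \<in> S" for x
    unfolding \<delta>_def by (rule LeastI_ex[OF reach[OF that, unfolded rtrancl_power]])
  have \<delta>le: "\<delta> x \<le> n" if "(c, x) \<in> adj_rel ?X ^^ n" for x n
    unfolding \<delta>_def using that by (rule Least_le)
  have \<delta>c: "\<delta> c = 0" using \<delta>le[of c 0] by simp
  have \<delta>step: "\<delta> b \<le> Suc (\<delta> a)" if "{a, b} \<in> ?X" for a b
  proof -
    have "(c, a) \<in> adj_rel ?X ^^ \<delta> a" using that by (intro \<delta>rel) (auto simp: induced_iff)
    then show ?thesis using that by (intro \<delta>le) (auto simp: adj_rel_def)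
  qed
  have \<delta>adj: "\<delta> b = Suc (\<delta> a) \<or> \<delta> a = \<delta> b \<or> \<delta> a = Suc (\<delta> b)" if "{a, b} \<in> ?X" for a b
    using \<delta>step[of a b] \<delta>step[of b a] that by (auto simp: insert_commute)
  define geo where "geo p k \<longleftrightarrow> p 0 = c \<and> (\<forall>i<k. {p i, p (Suc i)} \<in> ?X) \<and> \<delta> (p k) = k" for p :: "nat \<Rightarrow> 'v" and k
  have geo_ex: "\<exists>p. geo p (\<delta> x) \<and> p (\<delta> x) = x" if "x \<in> S" for x
    using \<delta>rel[OF that] by (auto simp: relpow_fun_conv geo_def adj_rel_def)
  have geo_level: "\<delta> (p i) = i" if g: "geo p k" "i \<le> k" for p k i
  proof (rule antisym)
    have "\<delta> (p i) \<le> i" if "i \<le> k" for i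
      using that
    proof (induction i)
      case (Suc i)
      then show ?case using \<delta>step[of "p i" "p (Suc i)"] g(1) by (auto simp: geo_def)
    qed (use g(1) \<delta>c in \<open>auto simp: geo_def\<close>)
    then show "\<delta> (p i) \<le> i" using g(2) .
    have "\<delta> (p (i + j)) \<le> \<delta> (p i) + j" if "i + j \<le> k" for j
      using that
    proof (induction j)
      case (Suc j)
      then show ?case using \<delta>step[of "p (i + j)" "p (Suc (i + j))"] g(1) by (auto simp: geo_def)
    qed auto
    from this[of "k - i"] show "i \<le> \<delta> (p i)" using g by (auto simp: geo_def)
  qed
  have geo_S: "p i \<in> S" if g: "geo p k" "i \<le> k" for p k i
  proof (cases i)
    case 0
    then show ?thesis using g c by (simp add: geo_def)
  next
    case (Suc j)
    then have "{p j, p i} \<in> ?X" using g by (auto simp: geo_def)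
    then show ?thesis by (auto simp: induced_iff)
  qed
  \<comment> \<open>Out along \<open>p\<close>, across the edge and back along \<open>q\<close> is
    an odd closed walk at \<open>c\<close>, so these vertices alone are rigid.\<close>
  have cover: "S = p ` {..k} \<union> q ` {..k}" if g: "geo p k" "geo q k" "{p k, q k} \<in> ?X" for p q k
  proof -
    let ?T = "p ` {..k} \<union> q ` {..k}"
    have inT: "{a, b} \<in> induced ?T" if "{a, b} \<in> ?X" "a \<in> ?T" "b \<in> ?T" for a b
      using that by (auto simp: induced_iff)
    have "rigid (induced ?T) c"
      unfolding rigid_def
    proof (intro allI impI)
      fix \<psi> :: "'v \<Rightarrow> rat" assume \<psi>: "\<forall>a b. {a, b} \<in> induced ?T \<longrightarrow> \<psi> a + \<psi> b = 0"
      have alt: "\<psi> (r i) = (-1) ^ i * \<psi> c" if r: "geo r k" "r ` {..k} \<subseteq> ?T" "i \<le> k" for r i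
        using r(3)
      proof (induction i)
        case 0
        then show ?case using r(1) by (simp add: geo_def)
      next
        case (Suc i)
        have rT: "r j \<in> ?T" if "j \<le> k" for j using that r(2) by blast
        have "{r i, r (Suc i)} \<in> induced ?T" using Suc.prems r(1) rT
          by (intro inT) (auto simp: geo_def simp del: Un_iff)
        then have "\<psi> (r i) + \<psi> (r (Suc i)) = 0" using \<psi> by blast
        then show ?case using Suc by simp
      qed
      have "{p k, q k} \<in> induced ?T" using g by (intro inT) auto
      then have "\<psi> (p k) + \<psi> (q k) = 0" using \<psi> by blast
      then have "(-1) ^ k * \<psi> c = 0" using alt[OF g(1), of k] alt[OF g(2), of k] by auto
      then show "\<psi> c = 0" by simp
    qed
    moreover have "c \<in> ?T" using g(1) by (force simp: geo_def)
    ultimately show ?thesis using geo_S g by (intro min'[symmetric]) auto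
  qed
  \<comment> \<open>Otherwise every edge changes the distance by one, and
    \<open>(-1) ^ \<delta>\<close> is a solution that does not vanish at \<open>c\<close>.\<close>
  have "\<exists>u v. {u, v} \<in> ?X \<and> \<delta> u = \<delta> v"
  proof (rule ccontr)
    assume *: "\<not> ?thesis"
    have "(-1 :: rat) ^ \<delta> a + (-1) ^ \<delta> b = 0" if ab: "{a, b} \<in> ?X" for a b
    proof -
      have "\<delta> a \<noteq> \<delta> b" using * ab by blast
      then show ?thesis using \<delta>adj[OF ab] by auto
    qed
    then have "(-1 :: rat) ^ \<delta> c = 0" using rig[unfolded rigid_def, rule_format, of "\<lambda>x. (-1) ^ \<delta> x"] by blast
    then show False by simp
  qed
  then obtain u v where uv: "{u, v} \<in> ?X" "\<delta> u = \<delta> v" by blast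
  define k where "k = \<delta> u"
  obtain p where p: "geo p k" "p k = u" using geo_ex[of u] uv by (auto simp: k_def induced_iff)
  obtain q where q: "geo q k" "q k = v" using geo_ex[of v] uv by (auto simp: k_def induced_iff)
  have Spq: "S = p ` {..k} \<union> q ` {..k}" using cover p q uv by auto
  have level: "x = p (\<delta> x) \<or> x = q (\<delta> x)" "\<delta> x \<le> k" if "x \<in> S" for x
    using that geo_level[OF p(1)] geo_level[OF q(1)] unfolding Spq by auto
  \<comment> \<open>The geodesics to the ends of any such edge cover \<open>S\<close>, so its level
    is the top level \<open>k\<close>, and there \<open>u\<close> and \<open>v\<close> are the only
    vertices.\<close>
  have same: "{a, b} = {u, v}" if ab: "{a, b} \<in> ?X" "\<delta> a = \<delta> b" for a b
  proof -
    have S: "a \<in> S" "b \<in> S" "a \<noteq> b" using ab edge_distinct by (auto simp: induced_iff)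
    obtain p' where p': "geo p' (\<delta> a)" "p' (\<delta> a) = a" using geo_ex S by blast
    obtain q' where q': "geo q' (\<delta> a)" "q' (\<delta> a) = b" using geo_ex[OF S(2)] ab(2) by auto
    have "S = p' ` {..\<delta> a} \<union> q' ` {..\<delta> a}" using cover[OF p'(1) q'(1)] p' q' ab by auto
    then have "\<delta> x \<le> \<delta> a" if "x \<in> S" for x
      using that geo_level[OF p'(1)] geo_level[OF q'(1)] by auto
    moreover have "u \<in> S" using uv by (auto simp: induced_iff)
    ultimately have "\<delta> a = k" using level(2)[OF S(1)] by (auto simp: k_def intro: antisym)
    then have "a = u \<or> a = v" "b = u \<or> b = v" using level(1)[OF S(1)] level(1)[OF S(2)] p(2) q(2) ab(2) by auto
    then show ?thesis using S(3) by auto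
  qed
  \<comment> \<open>Such an edge lets the initial part of \<open>r\<close> be replaced by that of
    \<open>r'\<close>. The new pair of geodesics still covers \<open>S\<close>, so
    \<open>r j\<close> must be the only vertex left at level \<open>j\<close>, namely
    \<open>r' j\<close>.\<close>
  have cross: "r j = r' j" if r: "geo r k" "r k = x" "geo r' k" "r' k = x'" "{x, x'} = {u, v}"
    "j < k" "{r' j, r (Suc j)} \<in> ?X" for r r' x x' j
  proof -
    define t where "t i = (if i \<le> j then r' i else r i)" for i
    have "geo t k"
      unfolding geo_def
    proof (intro conjI allI impI)
      fix i assume "i < k"
      then show "{t i, t (Suc i)} \<in> ?X" using r unfolding t_def geo_def
        by (cases "i < j"; cases "i = j") auto
    qed (use r in \<open>auto simp: t_def geo_def\<close>)
    moreover have "{t k, r' k} \<in> ?X" using r uv by (auto simp: t_def)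
    ultimately have "S = t ` {..k} \<union> r' ` {..k}" using cover r by blast
    moreover have "r j \<in> S" using geo_S[OF r(1)] r(6) by simp
    ultimately obtain i where i: "i \<le> k" "r j = t i \<or> r j = r' i" by auto
    have "\<delta> (r j) = j" using geo_level[OF r(1)] r(6) by simp
    moreover have "\<delta> (t i) = i" "\<delta> (r' i) = i" using geo_level[OF \<open>geo t k\<close>] geo_level[OF r(3)] i by auto
    ultimately have "i = j" using i(2) by auto
    then show ?thesis using i(2) by (auto simp: t_def)
  qed
  \<comment> \<open>Unique parents make the edges other than \<open>{u, v}\<close> a tree rooted at
    \<open>c\<close>.\<close>
  have parent: "a = b" if ab: "{a, x} \<in> ?X" "{b, x} \<in> ?X" "\<delta> x = Suc (\<delta> a)" "\<delta> b = \<delta> a" for a b x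
  proof -
    have S: "x \<in> S" "a \<in> S" "b \<in> S" using ab by (auto simp: induced_iff)
    obtain j where j: "\<delta> a = j" "\<delta> b = j" "\<delta> x = Suc j" using ab by simp
    have a: "a = p j \<or> a = q j" using level(1)[OF S(2)] unfolding j .
    have b: "b = p j \<or> b = q j" using level(1)[OF S(3)] unfolding j .
    have x: "x = p (Suc j) \<or> x = q (Suc j)" using level(1)[OF S(1)] unfolding j .
    have jk: "j < k" using level(2)[OF S(1)] j(3) by simp
    show ?thesis
    proof (cases "p j = q j")
      case True
      then show ?thesis using a b by simp
    next
      case False
      have uvs: "{u, v} = {u, v}" "{v, u} = {u, v}" by auto
      have np: "{q j, p (Suc j)} \<notin> ?X" using cross[OF p q uvs(1) jk] False by auto
      have nq: "{p j, q (Suc j)} \<notin> ?X" using cross[OF q p uvs(2) jk] False by auto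
      from x show ?thesis
      proof
        assume "x = p (Suc j)"
        then have "a \<noteq> q j" "b \<noteq> q j" using np ab(1,2) by auto
        then show ?thesis using a b by simp
      next
        assume "x = q (Suc j)"
        then have "a \<noteq> p j" "b \<noteq> p j" using nq ab(1,2) by auto
        then show ?thesis using a b by simp
      qed
    qed
  qed
  \<comment> \<open>Summing the vertex conditions with signs \<open>(-1) ^ \<delta> x\<close>
    cancels every edge between consecutive levels and counts the level edge twice.\<close>
  have duv: "d {u, v} = 0"
  proof -
    have finS: "finite S" unfolding Spq by simp
    have "0 = (\<Sum>x\<in>S. (-1) ^ \<delta> x * (\<Sum>e\<in>{e\<in>?X. x \<in> e}. d e))" using d by simp
    also have "\<dots> = (\<Sum>x\<in>S. \<Sum>e\<in>{e\<in>?X. x \<in> e}. (-1) ^ \<delta> x * d e)" by (simp add: sum_distrib_left)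
    also have "\<dots> = (\<Sum>e\<in>?X. \<Sum>x\<in>{x\<in>S. x \<in> e}. (-1) ^ \<delta> x * d e)"
      by (rule sum.swap_restrict[OF finS finX])
    also have "\<dots> = (\<Sum>e\<in>?X. if e = {u, v} then 2 * (-1) ^ k * d {u, v} else 0)"
    proof (rule sum.cong[OF refl])
      fix e assume e: "e \<in> ?X"
      then obtain a b where ab: "e = {a, b}" "a \<noteq> b" using edge_ends induced_subset by blast
      have "{x\<in>S. x \<in> e} = {a, b}" using e by (auto simp: ab induced_iff)
      then have sm: "(\<Sum>x\<in>{x\<in>S. x \<in> e}. (-1) ^ \<delta> x * d e) = (-1) ^ \<delta> a * d e + (-1) ^ \<delta> b * d e" using ab(2) by simp
      show "(\<Sum>x\<in>{x\<in>S. x \<in> e}. (-1) ^ \<delta> x * d e) = (if e = {u, v} then 2 * (-1) ^ k * d {u, v} else 0)"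
      proof (cases "\<delta> a = \<delta> b")
        case True
        then have eq: "e = {u, v}" using same e ab by auto
        then have "\<delta> a = k" using True ab uv(2) by (auto simp: k_def doubleton_eq_iff)
        then show ?thesis using sm True eq by simp
      next
        case False
        then have "e \<noteq> {u, v}" using ab uv(2) by (auto simp: doubleton_eq_iff)
        moreover have "\<delta> b = Suc (\<delta> a) \<or> \<delta> a = Suc (\<delta> b)" using \<delta>adj[of a b] e ab False by auto
        ultimately show ?thesis unfolding sm by auto
      qed
    qed
    also have "\<dots> = 2 * (-1) ^ k * d {u, v}" using uv(1) finX by simp
    finally show ?thesis by simp
  qed
  \<comment> \<open>Working from the top level towards \<open>c\<close>, the condition at
    \<open>a\<close> leaves only the edge to its parent.\<close>
  have down: "d {a, b} = 0" if "{a, b} \<in> ?X" "\<delta> a = Suc (\<delta> b)" for a b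
    using that
  proof (induction "k - \<delta> a" arbitrary: a b rule: less_induct)
    case less
    have aS: "a \<in> S" using less.prems by (auto simp: induced_iff)
    let ?Y = "{e\<in>?X. a \<in> e}"
    have other: "d e = 0" if e: "e \<in> ?Y - {{a, b}}" for e
    proof -
      obtain x where x: "e = {a, x}"
      proof -
        obtain a' b' where "e = {a', b'}" using e edge_ends[of e] induced_subset by blast
        moreover have "a \<in> e" using e by simp
        ultimately have "e = {a, a'} \<or> e = {a, b'}" by auto
        then show thesis using that by blast
      qed
      have xS: "x \<in> S" "{a, x} \<in> ?X" using e x by (auto simp: induced_iff)
      consider "\<delta> x = Suc (\<delta> a)" | "\<delta> a = \<delta> x" | "\<delta> a = Suc (\<delta> x)" using \<delta>adj[OF xS(2)] by auto
      then show ?thesis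
      proof cases
        case 1
        have "k - \<delta> x < k - \<delta> a" using 1 level(2)[OF xS(1)] by simp
        from less.hyps[OF this, of a] xS(2) 1 show ?thesis by (simp add: x insert_commute)
      next
        case 2
        then show ?thesis using same[OF xS(2)] duv x by simp
      next
        case 3
        have "{x, a} \<in> ?X" "{b, a} \<in> ?X" using xS(2) less.prems(1) by (simp_all add: insert_commute)
        from parent[OF this 3] have "x = b" using 3 less.prems(2) by simp
        then show ?thesis using e x by simp
      qed
    qed
    have "0 = (\<Sum>e\<in>?Y. d e)" using d[OF aS] by simp
    also have "\<dots> = d {a, b} + (\<Sum>e\<in>?Y - {{a, b}}. d e)"
      using less.prems finX by (intro sum.remove) auto
    also have "(\<Sum>e\<in>?Y - {{a, b}}. d e) = 0" using other by (intro sum.neutral) auto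
    finally show ?case by simp
  qed
  obtain a b where ab: "e0 = {a, b}" using edge_ends e0 induced_subset by blast
  then show ?thesis
    using \<delta>adj[of a b] down[of a b] down[of b a] same[of a b] duv e0 by (auto simp: insert_commute)
qed

end

section \<open>Monomials of closed walks\<close>

lemma even_below_Suc:
  "{k. k < 2 * Suc M \<and> even k} = insert (2 * M) {k. k < 2 * M \<and> even k}"
  "{k. k < 2 * Suc M \<and> odd k} = insert (Suc (2 * M)) {k. k < 2 * M \<and> odd k}"
  by (auto simp: less_Suc_eq)

lemma mono_img_edge: "a \<noteq> b \<Longrightarrow> mono_img (single {a, b} 1) = single a 1 + single b 1"
  by (simp add: mono_img_single)

definition even_part :: "(nat \<Rightarrow> 'v) \<Rightarrow> nat \<Rightarrow> 'v set \<Rightarrow>\<^sub>0 nat" where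
  "even_part v N = (\<Sum>k\<in>{k. k < N \<and> even k}. single {v k, v (Suc k)} 1)"
definition odd_part :: "(nat \<Rightarrow> 'v) \<Rightarrow> nat \<Rightarrow> 'v set \<Rightarrow>\<^sub>0 nat" where
  "odd_part v N = (\<Sum>k\<in>{k. k < N \<and> odd k}. single {v k, v (Suc k)} 1)"

context edge_set
begin

lemma closed_walk_monomials:
  assumes "even N" "v N = v 0" "walk_on X v N" "X \<subseteq> E"
  shows "keys (even_part v N) \<subseteq> X" "keys (odd_part v N) \<subseteq> X"
    "mono_img (even_part v N) = (\<Sum>k<N. single (v k) 1)"
    "mono_img (odd_part v N) = (\<Sum>k<N. single (v k) 1)"
    "wt y (even_part v N) - wt y (odd_part v N) = walk_sum y v N"
proof -
  show "keys (even_part v N) \<subseteq> X" "keys (odd_part v N) \<subseteq> X"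
    using assms(3) by (auto simp: even_part_def odd_part_def keys_sum_nat walk_on_def)
  obtain M where N: "N = 2 * M" using assms(1) by blast
  \<comment> \<open>On an initial piece the even edges cover \<open>v 0\<close> to
    \<open>v (2 * m - 1)\<close> and the odd ones \<open>v 1\<close> to \<open>v (2 * m)\<close>.
    The correction terms cancel once the walk closes.\<close>
  have "mono_img (even_part v (2 * m)) = (\<Sum>k<2 * m. single (v k) 1) \<and>
      mono_img (odd_part v (2 * m)) + single (v 0) 1 = (\<Sum>k<2 * m. single (v k) 1) + single (v (2 * m)) 1 \<and>
      wt y (even_part v (2 * m)) - wt y (odd_part v (2 * m)) = walk_sum y v (2 * m)" if "m \<le> M" for m
    using that
  proof (induction m)
    case 0
    then show ?case by (simp add: even_part_def odd_part_def walk_sum_def)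
  next
    case (Suc m)
    have ed: "v (2 * m) \<noteq> v (Suc (2 * m))" "v (Suc (2 * m)) \<noteq> v (Suc (Suc (2 * m)))"
    proof -
      have e: "{v (2 * m), v (Suc (2 * m))} \<in> X" "{v (Suc (2 * m)), v (Suc (Suc (2 * m)))} \<in> X"
        using assms(3) Suc.prems by (auto simp: walk_on_def N)
      show "v (2 * m) \<noteq> v (Suc (2 * m))" by (rule edge_distinct[OF subsetD[OF assms(4) e(1)]])
      show "v (Suc (2 * m)) \<noteq> v (Suc (Suc (2 * m)))" by (rule edge_distinct[OF subsetD[OF assms(4) e(2)]])
    qed
    have ev: "even_part v (2 * Suc m) = single {v (2 * m), v (Suc (2 * m))} 1 + even_part v (2 * m)"
      unfolding even_part_def even_below_Suc by (subst sum.insert) auto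
    have od: "odd_part v (2 * Suc m) = single {v (Suc (2 * m)), v (Suc (Suc (2 * m)))} 1 + odd_part v (2 * m)"
      unfolding odd_part_def even_below_Suc by (subst sum.insert) auto
    have IH: "mono_img (even_part v (2 * m)) = (\<Sum>k<2 * m. single (v k) 1)"
      "mono_img (odd_part v (2 * m)) + single (v 0) 1 = (\<Sum>k<2 * m. single (v k) 1) + single (v (2 * m)) 1"
      "wt y (even_part v (2 * m)) - wt y (odd_part v (2 * m)) = walk_sum y v (2 * m)"
      using Suc.IH Suc.prems by auto
    have s2: "(\<Sum>k<2 * Suc m. single (v k) (1::nat)) = (\<Sum>k<2 * m. single (v k) 1) + single (v (2 * m)) 1 + single (v (Suc (2 * m))) 1"
      by simp
    have "mono_img (even_part v (2 * Suc m)) = (\<Sum>k<2 * Suc m. single (v k) 1)"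
      unfolding ev mono_img_add mono_img_edge[OF ed(1)] IH(1) s2 by (simp only: ac_simps)
    moreover have "mono_img (odd_part v (2 * Suc m)) + single (v 0) 1 =
        single (v (Suc (2 * m))) 1 + single (v (2 * Suc m)) 1 + (mono_img (odd_part v (2 * m)) + single (v 0) 1)"
      unfolding od mono_img_add mono_img_edge[OF ed(2)] by (simp add: add.assoc)
    then have "mono_img (odd_part v (2 * Suc m)) + single (v 0) 1 = (\<Sum>k<2 * Suc m. single (v k) 1) + single (v (2 * Suc m)) 1"
      unfolding IH(2) s2 by (simp only: ac_simps)
    moreover have "walk_sum y v (2 * Suc m) = walk_sum y v (2 * m) + y {v (2 * m), v (Suc (2 * m))} - y {v (Suc (2 * m)), v (Suc (Suc (2 * m)))}"
      by (simp add: walk_sum_def)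
    then have "wt y (even_part v (2 * Suc m)) - wt y (odd_part v (2 * Suc m)) = walk_sum y v (2 * Suc m)"
      unfolding ev od wt_add using IH(3) by simp
    ultimately show ?case by blast
  qed
  from this[of M] show "mono_img (even_part v N) = (\<Sum>k<N. single (v k) 1)"
    "mono_img (odd_part v N) = (\<Sum>k<N. single (v k) 1)"
    "wt y (even_part v N) - wt y (odd_part v N) = walk_sum y v N" using assms(2) by (auto simp: N)
qed

end

section \<open>Dumbbells\<close>

lemma pot_walk:
  assumes "is_pot y X \<phi>" "walk_on X v n"
  shows "\<phi> (v n) = (-1) ^ n * (\<phi> (v 0) - walk_sum y v n)"
  using assms(2)
proof (induction n)
  case 0
  then show ?case by (simp add: walk_sum_def)
next
  case (Suc n)
  then have "\<phi> (v n) = (-1) ^ n * (\<phi> (v 0) - walk_sum y v n)" by (simp add: walk_on_def)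
  moreover have "y {v n, v (Suc n)} = \<phi> (v n) + \<phi> (v (Suc n))"
    using Suc.prems by (intro is_potD[OF assms(1)]) (simp add: walk_on_def)
  ultimately show ?case by (cases "even n") (auto simp: walk_sum_def)
qed

lemma pot_odd_closed_walk:
  assumes "is_pot y X \<phi>" "walk_on X v n" "odd n" "v n = v 0"
  shows "walk_sum y v n = 2 * \<phi> (v 0)"
  using pot_walk[OF assms(1,2)] assms(3,4) by simp

lemma rigid_odd_closed_walk:
  assumes "walk_on X v n" "odd n" "v n = v 0"
  shows "rigid X (v 0)"
  unfolding rigid_def
proof (intro allI impI)
  fix \<psi> :: "'a \<Rightarrow> rat" assume "\<forall>a b. {a, b} \<in> X \<longrightarrow> \<psi> a + \<psi> b = 0"
  then have "is_pot (\<lambda>_. 0) X \<psi>" by (simp add: is_pot_def)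
  from pot_odd_closed_walk[OF this assms] show "\<psi> (v 0) = 0" by (simp add: walk_sum_def)
qed

lemma rigid_transport:
  assumes "rigid X (v 0)" "walk_on X v n"
  shows "rigid X (v n)"
  unfolding rigid_def
proof (intro allI impI)
  fix \<psi> :: "'a \<Rightarrow> rat" assume \<psi>: "\<forall>a b. {a, b} \<in> X \<longrightarrow> \<psi> a + \<psi> b = 0"
  then have "is_pot (\<lambda>_. 0) X \<psi>" by (simp add: is_pot_def)
  moreover have "\<psi> (v 0) = 0" using assms(1) \<psi> by (simp add: rigid_def)
  ultimately show "\<psi> (v n) = 0" using pot_walk[OF _ assms(2)] by (fastforce simp: walk_sum_def)
qed

context edge_set
begin

text \<open>The last clause is the obstruction: potentials of the two sides never agree at
  \<open>c\<close>, hence cannot be glued. Everything is phrased by vertex sets with their induced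
  edges, because degrees control vertices, not individual edges.\<close>

definition dumbbell :: "('v set \<Rightarrow> rat) \<Rightarrow> 'v set \<Rightarrow> 'v \<Rightarrow> 'v set \<Rightarrow> 'v set \<Rightarrow> bool" where
  "dumbbell y S c P Q \<longleftrightarrow> P \<union> Q = S \<and> P \<inter> Q = {c} \<and> (\<forall>e\<in>induced S. e \<subseteq> P \<or> e \<subseteq> Q) \<and>
     rigid (induced P) c \<and> rigid (induced Q) c \<and>
     (\<forall>T. T \<subset> P \<longrightarrow> c \<in> T \<longrightarrow> \<not> rigid (induced T) c) \<and>
     (\<forall>T. T \<subset> Q \<longrightarrow> c \<in> T \<longrightarrow> \<not> rigid (induced T) c) \<and>
     (\<forall>\<phi> \<phi>'. is_pot y (induced P) \<phi> \<longrightarrow> is_pot y (induced Q) \<phi>' \<longrightarrow> \<phi> c \<noteq> \<phi>' c)"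

lemma dumbbellD:
  assumes "dumbbell y S c P Q"
  shows "P \<union> Q = S" "P \<inter> Q = {c}" "c \<in> P" "c \<in> Q" "\<And>e. e \<in> induced S \<Longrightarrow> e \<subseteq> P \<or> e \<subseteq> Q"
    "rigid (induced P) c" "rigid (induced Q) c"
    "\<And>T. T \<subset> P \<Longrightarrow> c \<in> T \<Longrightarrow> \<not> rigid (induced T) c"
    "\<And>T. T \<subset> Q \<Longrightarrow> c \<in> T \<Longrightarrow> \<not> rigid (induced T) c"
    "\<And>\<phi> \<phi>'. is_pot y (induced P) \<phi> \<Longrightarrow> is_pot y (induced Q) \<phi>' \<Longrightarrow> \<phi> c \<noteq> \<phi>' c"
proof -
  show "P \<inter> Q = {c}" using assms by (simp add: dumbbell_def)
  then show "c \<in> P" "c \<in> Q" by blast+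
qed (use assms in \<open>simp_all add: dumbbell_def\<close>)

lemma dumbbell_sym:
  assumes "dumbbell y S c P Q"
  shows "dumbbell y S c Q P"
proof -
  note D = dumbbellD[OF assms]
  show ?thesis
    unfolding dumbbell_def
  proof (intro conjI ballI allI impI)
    show "Q \<union> P = S" "Q \<inter> P = {c}" using D(1,2) by auto
    show "e \<subseteq> Q \<or> e \<subseteq> P" if "e \<in> induced S" for e using D(5)[OF that] by auto
    show "\<phi> c \<noteq> \<phi>' c" if "is_pot y (induced Q) \<phi>" "is_pot y (induced P) \<phi>'" for \<phi> \<phi>'
      using D(10)[OF that(2,1)] by simp
  qed (fact D)+
qed

text \<open>\<open>P\<close> and \<open>Q\<close> are the vertex sets of the two odd closed walks. A
  set not containing \<open>S\<close> carries one common potential, so if the union missed a vertex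
  of \<open>S\<close>, or one side could be shrunk and stay rigid, the two values forced at
  \<open>c\<close> would agree.\<close>

lemma dumbbell_exists:
  assumes nc: "\<not> cob y (induced S)"
    and sub: "\<And>T. \<not> S \<subseteq> T \<Longrightarrow> cob y (induced T)"
    and cyc: "\<And>v N. even N \<Longrightarrow> v N = v 0 \<Longrightarrow> inj_on v {..<N} \<Longrightarrow> walk_on E v N \<Longrightarrow> walk_sum y v N = 0"
  shows "\<exists>c P Q. dumbbell y S c P Q"
proof -
  let ?X = "induced S"
  have loop: "{a} \<notin> ?X" for a using card_edge[of "{a}"] induced_subset by fastforce
  obtain p q :: "nat \<Rightarrow> 'v" and l l' where pq: "odd l" "odd l'" "l > 1" "l' > 1"
    "p l = p 0" "q l' = q 0" "p 0 = q 0" "walk_on ?X p l" "walk_on ?X q l'"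
    and ne: "walk_sum y p l \<noteq> walk_sum y q l'"
    and sep: "\<And>k m. 0 < k \<Longrightarrow> k < l \<Longrightarrow> 0 < m \<Longrightarrow> m < l' \<Longrightarrow> p k \<noteq> q m \<and> {p k, q m} \<notin> ?X"
  proof (rule cut_vertex_of_non_coboundary[OF loop nc])
    show "walk_sum y v N = 0" if "even N" "v N = v 0" "inj_on v {..<N}" "walk_on ?X v N" for v :: "nat \<Rightarrow> 'v" and N
      using that induced_subset[of S] by (intro cyc) (auto simp: walk_on_def)
  qed blast
  define c P Q where "c = p 0" and "P = p ` {..l}" and "Q = q ` {..l'}"
  have wP: "walk_on (induced P) p l" using pq(8) by (auto simp: walk_on_def induced_iff P_def)
  have wQ: "walk_on (induced Q) q l'" using pq(9) by (auto simp: walk_on_def induced_iff Q_def)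
  have in_S: "v k \<in> S" if "walk_on ?X v n" "n > 0" "k \<le> n" for v n k
  proof (cases "k = n")
    case True
    then have "{v (k - 1), v k} \<in> ?X" using that by (metis Suc_pred' diff_less less_numeral_extra(1) walk_on_def)
    then show ?thesis by (auto simp: induced_iff)
  next
    case False
    then have "{v k, v (Suc k)} \<in> ?X" using that by (auto simp: walk_on_def)
    then show ?thesis by (auto simp: induced_iff)
  qed
  have pots: "\<phi> c \<noteq> \<phi>' c" if "is_pot y (induced P) \<phi>" "is_pot y (induced Q) \<phi>'" for \<phi> \<phi>'
    using pot_odd_closed_walk[OF that(1) wP pq(1,5)] pot_odd_closed_walk[OF that(2) wQ pq(2,6)] ne pq(7)
    by (auto simp: c_def)
  have PQS: "P \<union> Q = S"
  proof
    show "P \<union> Q \<subseteq> S" using in_S[OF pq(8)] in_S[OF pq(9)] pq(3,4) by (auto simp: P_def Q_def)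
    show "S \<subseteq> P \<union> Q"
    proof (rule ccontr)
      assume "\<not> ?thesis"
      then obtain \<phi> where "is_pot y (induced (P \<union> Q)) \<phi>" using sub unfolding cob_def by blast
      then have "is_pot y (induced P) \<phi>" "is_pot y (induced Q) \<phi>"
        using is_pot_mono induced_mono by (metis Un_upper1, metis Un_upper2)
      then show False using pots by blast
    qed
  qed
  have pos: "0 < k \<and> k < l" if "k \<le> l" "p k \<noteq> c" for k
    using that pq(5) by (metis c_def le_neq_implies_less neq0_conv)
  have qos: "0 < k \<and> k < l'" if "k \<le> l'" "q k \<noteq> c" for k
    using that pq(6,7) by (metis c_def le_neq_implies_less neq0_conv)
  have "c \<in> P" unfolding c_def P_def by (rule imageI) simp
  moreover have "c \<in> Q" unfolding c_def Q_def pq(7) by (rule imageI) simp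
  ultimately have cPQ: "c \<in> P" "c \<in> Q" by blast+
  have PQ: "P \<inter> Q = {c}"
  proof -
    have "x = c" if "x \<in> P" "x \<in> Q" for x
      using that pos qos sep unfolding P_def Q_def by fastforce
    then show ?thesis using cPQ by blast
  qed
  have edges: "e \<subseteq> P \<or> e \<subseteq> Q" if e: "e \<in> ?X" for e
  proof (rule ccontr)
    assume n: "\<not> ?thesis"
    obtain a b where ab: "e = {a, b}" using edge_ends e induced_subset by blast
    have abS: "a \<in> P \<union> Q" "b \<in> P \<union> Q" using e PQS by (auto simp: ab induced_iff)
    have *: False if "a \<in> P" "b \<in> Q" "a \<noteq> c" "b \<noteq> c" "{a, b} \<in> ?X" for a b
      using that pos qos sep unfolding P_def Q_def by fastforce
    have "(a \<in> P \<and> b \<in> Q \<or> a \<in> Q \<and> b \<in> P) \<and> a \<noteq> c \<and> b \<noteq> c"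
      using n abS cPQ unfolding ab by blast
    then show False using *[of a b] *[of b a] e unfolding ab by (metis insert_commute)
  qed
  have rP: "rigid (induced P) c" using rigid_odd_closed_walk[OF wP pq(1,5)] by (simp add: c_def)
  have rQ: "rigid (induced Q) c" using rigid_odd_closed_walk[OF wQ pq(2,6)] pq(7) by (simp add: c_def)
  have proper: "\<not> S \<subseteq> P" "\<not> S \<subseteq> Q"
  proof -
    have "{q 0, q 1} \<in> ?X" "{p 0, p 1} \<in> ?X" using pq by (auto simp: walk_on_def)
    then have "q 1 \<noteq> c" "p 1 \<noteq> c" using loop pq(7) by (auto simp: c_def)
    moreover have "q 1 \<in> Q" "p 1 \<in> P" using pq by (auto simp: P_def Q_def)
    ultimately show "\<not> S \<subseteq> P" "\<not> S \<subseteq> Q" using PQ PQS by blast+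
  qed
  obtain \<phi>P where \<phi>P: "is_pot y (induced P) \<phi>P" using sub[OF proper(1)] unfolding cob_def by blast
  obtain \<phi>Q where \<phi>Q: "is_pot y (induced Q) \<phi>Q" using sub[OF proper(2)] unfolding cob_def by blast
  have minP: "\<not> rigid (induced T) c" if T: "T \<subset> P" "c \<in> T" for T
  proof
    assume r: "rigid (induced T) c"
    obtain x where x: "x \<in> P" "x \<notin> T" using T by blast
    then have "x \<notin> Q" using T(2) PQ by (metis IntI singletonD)
    then have "\<not> S \<subseteq> T \<union> Q" using x PQS by auto
    then obtain \<phi> where \<phi>: "is_pot y (induced (T \<union> Q)) \<phi>" using sub unfolding cob_def by blast
    have "is_pot y (induced T) \<phi>" using is_pot_mono[OF \<phi> induced_mono] by blast
    moreover have "is_pot y (induced T) \<phi>P" using is_pot_mono[OF \<phi>P induced_mono] T by blast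
    ultimately have "\<phi> c = \<phi>P c" using pot_unique[OF r] by blast
    moreover have "is_pot y (induced Q) \<phi>" using is_pot_mono[OF \<phi> induced_mono] by blast
    ultimately show False using pots[OF \<phi>P] by metis
  qed
  have minQ: "\<not> rigid (induced T) c" if T: "T \<subset> Q" "c \<in> T" for T
  proof
    assume r: "rigid (induced T) c"
    obtain x where x: "x \<in> Q" "x \<notin> T" using T by blast
    then have "x \<notin> P" using T(2) PQ by (metis IntI singletonD)
    then have "\<not> S \<subseteq> P \<union> T" using x PQS by auto
    then obtain \<phi> where \<phi>: "is_pot y (induced (P \<union> T)) \<phi>" using sub unfolding cob_def by blast
    have "is_pot y (induced T) \<phi>" using is_pot_mono[OF \<phi> induced_mono] by blast
    moreover have "is_pot y (induced T) \<phi>Q" using is_pot_mono[OF \<phi>Q induced_mono] T by blast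
    ultimately have "\<phi> c = \<phi>Q c" using pot_unique[OF r] by blast
    moreover have "is_pot y (induced P) \<phi>" using is_pot_mono[OF \<phi> induced_mono] by blast
    ultimately show False using pots[OF _ \<phi>Q] by metis
  qed
  show ?thesis
    by (intro exI[of _ c] exI[of _ P] exI[of _ Q])
       (use PQS PQ edges rP rQ minP minQ pots in \<open>simp add: dumbbell_def\<close>)
qed

text \<open>The two sides interact at \<open>c\<close> only. If the \<open>P\<close> part of the sum
  at \<open>c\<close> is zero, so is the \<open>Q\<close> part, and a minimal rigid side carries no
  nonzero relation.\<close>

lemma dumbbell_cycle_eq_0:
  fixes d :: "'v set \<Rightarrow> rat"
  assumes db: "dumbbell y S c P Q"
    and d: "\<And>v. v \<in> S \<Longrightarrow> (\<Sum>e\<in>{e\<in>induced S. v \<in> e}. d e) = 0"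
    and d0: "(\<Sum>e\<in>{e\<in>induced P. c \<in> e}. d e) = 0" and e: "e \<in> induced S"
  shows "d e = 0"
proof -
  note D = dumbbellD[OF db]
  have fin: "finite (induced T)" for T using fin_E finite_subset[OF induced_subset] by blast
  have at_P: "{e\<in>induced P. v \<in> e} = {e\<in>induced S. v \<in> e}" if "v \<in> P" "v \<noteq> c" for v
    using that D(1,2) D(5) by (auto simp: induced_def)
  have at_Q: "{e\<in>induced Q. v \<in> e} = {e\<in>induced S. v \<in> e}" if "v \<in> Q" "v \<noteq> c" for v
    using that D(1,2) D(5) by (auto simp: induced_def)
  have at_c: "{e\<in>induced S. c \<in> e} = {e\<in>induced P. c \<in> e} \<union> {e\<in>induced Q. c \<in> e}"
    using D(1) D(5) by (auto simp: induced_def)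
  have disj: "{e\<in>induced P. c \<in> e} \<inter> {e\<in>induced Q. c \<in> e} = {}"
  proof -
    have False if "e \<in> induced P" "e \<in> induced Q" for e
    proof -
      have "e \<subseteq> {c}" "e \<in> E" using that D(2) by (auto simp: induced_def)
      then show False using edge_ends[of e] by auto
    qed
    then show ?thesis by blast
  qed
  have "0 = (\<Sum>e\<in>{e\<in>induced S. c \<in> e}. d e)" using d[of c] D(1,3) by auto
  also have "\<dots> = (\<Sum>e\<in>{e\<in>induced P. c \<in> e}. d e) + (\<Sum>e\<in>{e\<in>induced Q. c \<in> e}. d e)"
    unfolding at_c using fin disj by (intro sum.union_disjoint) auto
  finally have d0': "(\<Sum>e\<in>{e\<in>induced Q. c \<in> e}. d e) = 0" using d0 by simp
  have bP: "(\<Sum>e\<in>{e\<in>induced P. v \<in> e}. d e) = 0" if "v \<in> P" for v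
    using d[of v] d0 at_P that D(1) by (cases "v = c") auto
  have bQ: "(\<Sum>e\<in>{e\<in>induced Q. v \<in> e}. d e) = 0" if "v \<in> Q" for v
    using d[of v] d0' at_Q that D(1) by (cases "v = c") auto
  have "e \<in> induced P \<or> e \<in> induced Q" using e D(5) by (auto simp: induced_def)
  then show ?thesis
    using minimal_rigid_no_cycles[OF D(3,6,8) bP] minimal_rigid_no_cycles[OF D(4,7,9) bQ] by blast
qed

text \<open>The sum over the edges of \<open>P\<close> at \<open>c\<close> is the only parameter of
  a relation: the combination \<open>t' * d e - t * d' e\<close> has parameter 0 and
  vanishes.\<close>

lemma dumbbell_rank_one:
  fixes d d' :: "'v set \<Rightarrow> rat"
  assumes db: "dumbbell y S c P Q"
    and d: "\<And>v. v \<in> S \<Longrightarrow> (\<Sum>e\<in>{e\<in>induced S. v \<in> e}. d e) = 0"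
    and d': "\<And>v. v \<in> S \<Longrightarrow> (\<Sum>e\<in>{e\<in>induced S. v \<in> e}. d' e) = 0"
  shows "\<exists>s s'. (s \<noteq> 0 \<or> s' \<noteq> 0) \<and> (\<forall>e\<in>induced S. s * d e = s' * d' e)"
proof -
  define t t' where "t = (\<Sum>e\<in>{e\<in>induced P. c \<in> e}. d e)" and "t' = (\<Sum>e\<in>{e\<in>induced P. c \<in> e}. d' e)"
  show ?thesis
  proof (cases "t = 0")
    case True
    then have "d e = 0" if "e \<in> induced S" for e using dumbbell_cycle_eq_0[OF db d _ that] by (simp add: t_def)
    then show ?thesis by (intro exI[of _ 1] exI[of _ 0]) auto
  next
    case False
    have "t' * d e - t * d' e = 0" if "e \<in> induced S" for e
    proof (rule dumbbell_cycle_eq_0[OF db _ _ that])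
      show "(\<Sum>e\<in>{e\<in>induced S. v \<in> e}. t' * d e - t * d' e) = 0" if "v \<in> S" for v
        using d[OF that] d'[OF that] by (simp add: sum_subtractf sum_distrib_left[symmetric])
      show "(\<Sum>e\<in>{e\<in>induced P. c \<in> e}. t' * d e - t * d' e) = 0"
        by (simp add: sum_subtractf sum_distrib_left[symmetric] t_def[symmetric] t'_def[symmetric])
    qed
    then show ?thesis using False by (intro exI[of _ t'] exI[of _ t]) auto
  qed
qed

end

section \<open>Generators of a complete intersection: even cycles and one exception\<close>

section \<open>Generators of complete intersections\<close>

lemma prod_evar:
  "finite K \<Longrightarrow> (\<Prod>k\<in>K. evar (h k)) = (single (\<Sum>k\<in>K. single (h k) 1) 1 :: ('v, 'k::comm_ring_1) epoly)"
  by (induction K rule: finite_induct) (auto simp: evar_def mult_single)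

locale ci_system = min_system E A for E :: "'v set set" and A :: "('v, 'k::field) epoly set" +
  fixes F :: "'v set set"
  assumes max_F: "max_indep E F" and card_A: "card A \<le> card (E - F)"
begin

definition dual :: "('v, 'k) epoly \<Rightarrow> 'v set \<Rightarrow> rat" where
  "dual f = (SOME y. pair y f = 1 \<and> (\<forall>g\<in>A - {f}. pair y g = 0))"

lemma dual_props:
  assumes "f \<in> A"
  shows "pair (dual f) f = 1" "\<And>g. g \<in> A \<Longrightarrow> g \<noteq> f \<Longrightarrow> pair (dual f) g = 0"
  using someI_ex[OF dual_functional[OF max_F card_A assms]] unfolding dual_def[symmetric] by auto

definition supp :: "('v, 'k) epoly \<Rightarrow> 'v set" where
  "supp f = keys (bin_deg f)"

text \<open>In a degree not above that of \<open>f\<close> only other generators can contribute, and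
  the dual functional vanishes on those.\<close>

lemma dual_wt_eq:
  assumes "f \<in> A" "keys a \<subseteq> E" "keys b \<subseteq> E" "mono_img a = mono_img b" "\<not> pm_le (bin_deg f) (mono_img a)"
  shows "wt (dual f) a = wt (dual f) b"
  using assms dual_props(2)[OF assms(1)] by (intro wt_eq_if_pair_eq_0) auto

lemma keys_A_induced:
  assumes "f \<in> A" "supp f \<subseteq> S"
  shows "keys (bin_lead f) \<subseteq> induced S" "keys (bin_trail f) \<subseteq> induced S"
  using assms A_props[OF assms(1)] keys_induced_iff by (auto simp: supp_def)

text \<open>Cancelling a common edge would give a relation of strictly smaller degree on which the
  dual functional still has the value 1.\<close>

lemma lead_trail_disjoint:
  assumes f: "f \<in> A"
  shows "keys (bin_lead f) \<inter> keys (bin_trail f) = {}"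
proof (rule ccontr)
  note p = A_props[OF f]
  assume "\<not> ?thesis"
  then obtain e where e: "e \<in> keys (bin_lead f)" "e \<in> keys (bin_trail f)" by auto
  have le: "pm_le (single e 1) m" if "e \<in> keys m" for m
    using that by (auto simp: pm_le_def lookup_single when_def in_keys_iff)
  obtain a where a: "bin_lead f = single e 1 + a" using le[OF e(1)] by (metis pm_leE)
  obtain b where b: "bin_trail f = single e 1 + b" using le[OF e(2)] by (metis pm_leE)
  have ab: "keys a \<subseteq> E" "keys b \<subseteq> E" using p(2,3) by (auto simp: a b keys_add_nat)
  have img: "mono_img a = mono_img b" using p(5) by (simp add: a b mono_img_add)
  have "\<not> pm_le (bin_deg f) (mono_img a)"
  proof
    assume "pm_le (bin_deg f) (mono_img a)"
    then have "bin_deg f = mono_img a" by (rule pm_le_antisym) (simp add: a mono_img_add)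
    then have "mono_img (single e 1) = 0" by (simp add: a mono_img_add)
    then have "single e (1::nat) = 0" using e p(2) by (subst (asm) img_eq_0) auto
    then show False by (metis keys_single keys_zero insert_not_empty zero_neq_one)
  qed
  then have "wt (dual f) a = wt (dual f) b" using dual_wt_eq[OF f ab img] by simp
  then have "pair (dual f) f = 0" by (simp add: pair_def a b wt_add)
  then show False using dual_props(1)[OF f] by simp
qed

lemma dual_walk_sum:
  assumes f: "f \<in> A" and v: "even N" "v N = v 0" "walk_on E v N"
    and n: "\<not> pm_le (bin_deg f) (\<Sum>k<N. single (v k) 1)"
  shows "walk_sum (dual f) v N = 0"
proof -
  note m = closed_walk_monomials[OF v order_refl]
  have "wt (dual f) (even_part v N) = wt (dual f) (odd_part v N)"
    by (rule dual_wt_eq[OF f m(1,2)]) (use m(3,4) n in simp_all)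
  then show ?thesis using m(5)[of "dual f"] by simp
qed

text \<open>A closed walk inside \<open>S\<close> has its degree supported in \<open>S\<close>, so
  this degree cannot be above that of \<open>f\<close>.\<close>

lemma dual_cob:
  assumes f: "f \<in> A" and S: "\<not> supp f \<subseteq> S"
  shows "cob (dual f) (induced S)"
proof (rule cob_if_closed_walks_vanish)
  fix n a t assume n: "even n" and "walk (dual f) (induced S) n a a t"
  then obtain v where v: "v 0 = a" "v n = a" "walk_on (induced S) v n" "t = walk_sum (dual f) v n"
    by (auto simp: walk_def)
  have vE: "walk_on E v n" using v(3) induced_subset by (auto simp: walk_on_def)
  have "keys (\<Sum>k<n. single (v k) (1::nat)) \<subseteq> S"
    using v(3) by (auto simp: keys_sum_nat walk_on_def induced_iff)
  then have "\<not> pm_le (bin_deg f) (\<Sum>k<n. single (v k) 1)"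
    using S pm_le_keys unfolding supp_def by blast
  then show "t = 0" using dual_walk_sum[OF f n _ vE] v by simp
qed

lemma dual_not_cob:
  assumes f: "f \<in> A" and S: "supp f \<subseteq> S"
  shows "\<not> cob (dual f) (induced S)"
proof
  assume "cob (dual f) (induced S)"
  then obtain \<phi> where \<phi>: "is_pot (dual f) (induced S) \<phi>" unfolding cob_def by blast
  have "wt (dual f) m = wt \<phi> (mono_img m)" if "keys m \<subseteq> induced S" for m
  proof (rule wt_potential[OF fin_E])
    show "keys m \<subseteq> E" using that induced_subset by blast
    show "\<forall>e\<in>E. finite e" using finite_edge by blast
    show "\<forall>e\<in>keys m. dual f e = sum \<phi> e"
    proof
      fix e assume "e \<in> keys m"
      then have e: "e \<in> induced S" using that by blast
      then obtain a b where ab: "e = {a, b}" "a \<noteq> b" using edge_ends induced_subset by blast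
      show "dual f e = sum \<phi> e" using is_potD[OF \<phi>, of a b] e ab by simp
    qed
  qed
  then have "pair (dual f) f = 0"
    using keys_A_induced[OF f S] A_props(5)[OF f] by (simp add: pair_def)
  then show False using dual_props(1)[OF f] by simp
qed

definition bad :: "('v, 'k) epoly \<Rightarrow> bool" where
  "bad f \<longleftrightarrow> (\<exists>v. lookup (bin_deg f) v > 1)"

lemma lookup_sum_single_inj:
  fixes N :: nat
  assumes "inj_on v {..<N}"
  shows "lookup (\<Sum>k<N. single (v k) (1::nat)) x \<le> 1"
proof -
  have "lookup (\<Sum>k<N. single (v k) (1::nat)) x = (\<Sum>k<N. if v k = x then 1 else 0)"
    unfolding lookup_sum lookup_single when_def ..
  also have "\<dots> = (\<Sum>k\<in>{k\<in>{..<N}. v k = x}. 1)" by (rule sum.inter_filter[symmetric]) simp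
  also have "\<dots> = card {k\<in>{..<N}. v k = x}" by simp
  also have "\<dots> \<le> 1"
    using assms card_le_Suc0_iff_eq[of "{k\<in>{..<N}. v k = x}"] by (auto simp: inj_on_def)
  finally show ?thesis .
qed

text \<open>A cycle visits each vertex once, so its degree is squarefree and never above that of a
  bad generator. This supplies the cycle hypothesis of \<open>dumbbell_exists\<close>.\<close>

lemma bad_dumbbell:
  assumes f: "f \<in> A" and bad: "bad f"
  shows "\<exists>c P Q. dumbbell (dual f) (supp f) c P Q"
proof (rule dumbbell_exists)
  show "\<not> cob (dual f) (induced (supp f))" by (rule dual_not_cob[OF f order_refl])
  show "cob (dual f) (induced T)" if "\<not> supp f \<subseteq> T" for T by (rule dual_cob[OF f that])
  show "walk_sum (dual f) v N = 0"
    if "even N" "v N = v 0" "inj_on v {..<N}" "walk_on E v N" for v :: "nat \<Rightarrow> 'v" and N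
  proof (rule dual_walk_sum[OF f that(1,2,4)])
    show "\<not> pm_le (bin_deg f) (\<Sum>k<N. single (v k) 1)"
      using bad lookup_sum_single_inj[OF that(3)] unfolding bad_def pm_le_def by (meson leD le_trans)
  qed
qed

lemma vec_induced_boundary:
  assumes f: "f \<in> A" "supp f \<subseteq> S"
  shows "(\<Sum>e\<in>{e\<in>induced S. v \<in> e}. vec f e) = 0"
proof -
  have "vec f e = 0" if "e \<notin> induced S" for e
  proof -
    have "e \<notin> keys (bin_lead f)" "e \<notin> keys (bin_trail f)" using keys_A_induced[OF f] that by auto
    then show ?thesis by (simp add: vec_def in_keys_iff)
  qed
  then have "(\<Sum>e\<in>{e\<in>induced S. v \<in> e}. vec f e) = (\<Sum>e\<in>{e\<in>E. v \<in> e}. vec f e)"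
    using fin_E induced_subset by (intro sum.mono_neutral_left) auto
  then show ?thesis using vec_boundary[OF f(1)] by simp
qed

lemma pair_induced:
  assumes f: "f \<in> A" "supp f \<subseteq> S"
  shows "pair y f = (\<Sum>e\<in>induced S. y e * vec f e)"
proof -
  have "vec f e = 0" if "e \<notin> induced S" for e
  proof -
    have "e \<notin> keys (bin_lead f)" "e \<notin> keys (bin_trail f)" using keys_A_induced[OF f] that by auto
    then show ?thesis by (simp add: vec_def in_keys_iff)
  qed
  then show ?thesis unfolding pair_vec[OF f(1)]
    using fin_E induced_subset by (intro sum.mono_neutral_right) auto
qed

lemma vec_nonzero: "f \<in> A \<Longrightarrow> supp f \<subseteq> S \<Longrightarrow> \<exists>e\<in>induced S. vec f e \<noteq> 0"
proof (rule ccontr)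
  assume f: "f \<in> A" "supp f \<subseteq> S" and "\<not> (\<exists>e\<in>induced S. vec f e \<noteq> 0)"
  then have "pair (dual f) f = 0" unfolding pair_induced[OF f] by (intro sum.neutral) auto
  then show False using dual_props(1)[OF f(1)] by simp
qed

lemma lookup_lead_trail:
  assumes "f \<in> A"
  shows "of_nat (lookup (bin_lead f) e) = max (vec f e) 0" "of_nat (lookup (bin_trail f) e) = max (- vec f e) 0"
proof -
  have "lookup (bin_lead f) e = 0 \<or> lookup (bin_trail f) e = 0"
    using lead_trail_disjoint[OF assms] by (auto simp: in_keys_iff disjoint_iff)
  then show "of_nat (lookup (bin_lead f) e) = max (vec f e) 0" "of_nat (lookup (bin_trail f) e) = max (- vec f e) 0"
    by (auto simp: vec_def)
qed

text \<open>On the support of a bad \<open>g\<close> all relations are proportional. The dual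
  functional of \<open>g\<close> is 1 on \<open>g\<close> and 0 on \<open>f\<close>, which would
  force the vector of \<open>f\<close> to be zero.\<close>

lemma supp_not_subset:
  assumes f: "f \<in> A" and g: "g \<in> A" "bad g" and ne: "f \<noteq> g"
  shows "\<not> supp f \<subseteq> supp g"
proof
  assume sub: "supp f \<subseteq> supp g"
  obtain c P Q where db: "dumbbell (dual g) (supp g) c P Q" using bad_dumbbell[OF g] by blast
  obtain s s' where s: "s \<noteq> 0 \<or> s' \<noteq> 0" "\<forall>e\<in>induced (supp g). s * vec g e = s' * vec f e"
    using dumbbell_rank_one[OF db vec_induced_boundary[OF g(1) order_refl] vec_induced_boundary[OF f sub]] by blast
  have "s * pair (dual g) g = s' * pair (dual g) f"
    unfolding pair_induced[OF g(1) order_refl] pair_induced[OF f sub] sum_distrib_left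
    using s(2) by (intro sum.cong) (auto simp: mult.left_commute)
  then have "s = 0" using dual_props[OF g(1)] f ne by simp
  then show False using s vec_nonzero[OF f sub] by auto
qed

text \<open>If \<open>M\<close> missed part of both sides, the dual functional would have potentials
  on the union of \<open>M\<close> with either side. Rigidity of \<open>M\<close> makes them equal
  at \<open>c\<close>, against the last clause of \<open>dumbbell\<close>.\<close>

lemma dumbbell_rigid_contains:
  assumes f: "f \<in> A" and db: "dumbbell (dual f) (supp f) c P Q" and M: "c \<in> M" "rigid (induced M) c"
  shows "P \<subseteq> M \<or> Q \<subseteq> M"
proof (rule ccontr)
  note D = dumbbellD[OF db]
  assume n: "\<not> ?thesis"
  have PQM: "x \<in> M" if "x \<in> P" "x \<in> Q" for x
    using that D(2) M(1) by (metis IntI singletonD)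
  have "\<not> supp f \<subseteq> M \<union> P" using n PQM unfolding D(1)[symmetric] by blast
  then obtain \<phi> where \<phi>: "is_pot (dual f) (induced (M \<union> P)) \<phi>" using dual_cob[OF f] unfolding cob_def by blast
  have "\<not> supp f \<subseteq> M \<union> Q" using n PQM unfolding D(1)[symmetric] by blast
  then obtain \<phi>' where \<phi>': "is_pot (dual f) (induced (M \<union> Q)) \<phi>'" using dual_cob[OF f] unfolding cob_def by blast
  have "\<phi> c = \<phi>' c"
    by (rule pot_unique[OF M(2) is_pot_mono[OF \<phi> induced_mono] is_pot_mono[OF \<phi>' induced_mono]]) auto
  moreover have "is_pot (dual f) (induced P) \<phi>" by (rule is_pot_mono[OF \<phi> induced_mono]) auto
  moreover have "is_pot (dual f) (induced Q) \<phi>'" by (rule is_pot_mono[OF \<phi>' induced_mono]) auto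
  ultimately show False using D(10) by blast
qed

end

text \<open>The support of a bad generator carries a relation lattice of rank one, so the generator is
  indispensable.\<close>
lemma bad_indispensable:
  fixes A B :: "('v, 'k::field) epoly set"
  assumes A: "ci_system E A F" and B: "ci_system E B F" and f: "f \<in> A" and bad: "ci_system.bad f"
  shows "\<exists>g\<in>B. (g = f \<or> g = - f) \<and> bin_deg g = bin_deg f"
proof -
  interpret A: ci_system E A F by (rule A)
  interpret B: ci_system E B F by (rule B)
  have suppBA: "B.supp = A.supp" by (simp add: fun_eq_iff A.supp_def B.supp_def)
  let ?y = "A.dual f" and ?S = "A.supp f"
  note pf = A.A_props[OF f]
  obtain c P Q where db: "A.dumbbell ?y ?S c P Q" using A.bad_dumbbell[OF f bad] by blast
  \<comment> \<open>The system \<open>B\<close> must detect the relation \<open>f\<close> by some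
    \<open>g\<close> of no larger degree. Applied back to \<open>g\<close>, the same argument finds
    an element of \<open>A\<close> on which \<open>?y\<close> is nonzero, which is \<open>f\<close>
    itself; so the degrees coincide.\<close>
  have "\<exists>g\<in>B. pm_le (bin_deg g) (bin_deg f) \<and> pair ?y g \<noteq> 0"
  proof (rule ccontr)
    assume "\<not> ?thesis"
    then have "wt ?y (bin_lead f) = wt ?y (bin_trail f)"
      using pf by (intro B.wt_eq_if_pair_eq_0) auto
    then show False using A.dual_props(1)[OF f] by (simp add: pair_def)
  qed
  then obtain g where g: "g \<in> B" "pm_le (bin_deg g) (bin_deg f)" "pair ?y g \<noteq> 0" by blast
  note pg = B.A_props[OF g(1)]
  have gS: "B.supp g \<subseteq> ?S" using pm_le_keys[OF g(2)] by (simp add: A.supp_def B.supp_def)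
  define \<mu> where "\<mu> = pair ?y g"
  have ind: "vec g e = \<mu> * vec f e" if "e \<in> A.induced ?S" for e
  proof -
    obtain s s' where s: "s \<noteq> 0 \<or> s' \<noteq> 0" "\<forall>e\<in>A.induced ?S. s * vec f e = s' * vec g e"
      using A.dumbbell_rank_one[OF db A.vec_induced_boundary[OF f order_refl] B.vec_induced_boundary[OF g(1) gS]] by blast
    have "s * pair ?y f = s' * pair ?y g"
      unfolding A.pair_induced[OF f order_refl] B.pair_induced[OF g(1) gS] sum_distrib_left
      using s(2) by (intro sum.cong) (auto simp: mult.left_commute)
    then have "s = s' * \<mu>" using A.dual_props(1)[OF f] by (simp add: \<mu>_def)
    then have "s' \<noteq> 0" using s(1) by auto
    moreover have "s' * \<mu> * vec f e = s' * vec g e" using s(2) that \<open>s = s' * \<mu>\<close> by auto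
    ultimately show ?thesis by simp
  qed
  have vec: "vec g e = \<mu> * vec f e" for e
  proof (cases "e \<in> A.induced ?S")
    case False
    then have "e \<notin> keys (bin_lead f)" "e \<notin> keys (bin_trail f)" "e \<notin> keys (bin_lead g)" "e \<notin> keys (bin_trail g)"
      using A.keys_A_induced[OF f order_refl] B.keys_A_induced[OF g(1) gS] by auto
    then show ?thesis by (simp add: vec_def in_keys_iff)
  qed (rule ind)
  have "\<exists>f'\<in>A. pm_le (bin_deg f') (bin_deg g) \<and> pair ?y f' \<noteq> 0"
  proof (rule ccontr)
    assume "\<not> ?thesis"
    then have "wt ?y (bin_lead g) = wt ?y (bin_trail g)"
      using pg by (intro A.wt_eq_if_pair_eq_0) auto
    then show False using g(3) by (simp add: pair_def)
  qed
  then have "pm_le (bin_deg f) (bin_deg g)" using A.dual_props(2)[OF f] by blast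
  then have deg: "bin_deg g = bin_deg f" using g(2) pm_le_antisym by blast
  have img: "rat_of_nat (lookup (mono_img m) v) = (\<Sum>e\<in>{e\<in>E. v \<in> e}. of_nat (lookup m e))" if "keys m \<subseteq> E" for m v
    using A.lookup_img[OF that] by simp
  have "bin_deg f \<noteq> 0"
  proof
    assume "bin_deg f = 0"
    then have "bin_lead f = 0" "bin_trail f = 0" using A.img_eq_0 pf by metis+
    then show False using pf(4) by simp
  qed
  then obtain x where x: "lookup (bin_deg f) x \<noteq> 0" by (metis lookup_zero poly_mapping_eqI)
  have mu0: "\<mu> \<noteq> 0" using g(3) by (simp add: \<mu>_def)
  \<comment> \<open>Each generator has disjoint monomials, so these are the positive and negative
    parts of its vector. Proportional vectors of equal degree then leave only 1 and -1 for
    \<open>\<mu>\<close>.\<close>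
  consider "\<mu> > 0" | "\<mu> < 0" using mu0 by linarith
  then show ?thesis
  proof cases
    case 1
    have l: "rat_of_nat (lookup (bin_lead g) e) = \<mu> * of_nat (lookup (bin_lead f) e)" for e
      unfolding A.lookup_lead_trail[OF f] B.lookup_lead_trail[OF g(1)] vec using 1
      by (simp add: max_def zero_less_mult_iff mult_le_0_iff)
    have t: "rat_of_nat (lookup (bin_trail g) e) = \<mu> * of_nat (lookup (bin_trail f) e)" for e
      unfolding A.lookup_lead_trail[OF f] B.lookup_lead_trail[OF g(1)] vec using 1
      by (simp add: max_def zero_less_mult_iff mult_le_0_iff zero_le_mult_iff)
    have "rat_of_nat (lookup (bin_deg g) x) = \<mu> * of_nat (lookup (bin_deg f) x)"
      unfolding img[OF pg(2)] img[OF pf(2)] l sum_distrib_left ..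
    then have mu: "\<mu> = 1" using x deg by simp
    have "bin_lead g = bin_lead f" "bin_trail g = bin_trail f"
      using l t by (auto intro!: poly_mapping_eqI simp: mu)
    then have "g = f" using pf(1) pg(1) by metis
    then show ?thesis using g(1) deg by blast
  next
    case 2
    have l: "rat_of_nat (lookup (bin_lead g) e) = - \<mu> * of_nat (lookup (bin_trail f) e)" for e
      unfolding A.lookup_lead_trail[OF f] B.lookup_lead_trail[OF g(1)] vec using 2
      by (simp add: max_def zero_less_mult_iff mult_le_0_iff zero_le_mult_iff)
    have t: "rat_of_nat (lookup (bin_trail g) e) = - \<mu> * of_nat (lookup (bin_lead f) e)" for e
      unfolding A.lookup_lead_trail[OF f] B.lookup_lead_trail[OF g(1)] vec using 2
      by (simp add: max_def zero_less_mult_iff mult_le_0_iff zero_le_mult_iff)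
    have "rat_of_nat (lookup (bin_deg g) x) = - \<mu> * of_nat (lookup (mono_img (bin_trail f)) x)"
      unfolding img[OF pg(2)] img[OF pf(3)] l sum_distrib_left ..
    then have "(1 + \<mu>) * of_nat (lookup (bin_deg f) x) = 0" using deg pf(5) by (simp add: distrib_right)
    then have mu: "- \<mu> = 1" using x by simp
    have "bin_lead g = bin_trail f" "bin_trail g = bin_lead f"
      using l t unfolding mu by (auto intro!: poly_mapping_eqI)
    then have "g = - f" using pf(1) pg(1) by (metis minus_diff_eq)
    then show ?thesis using g(1) deg by blast
  qed
qed

context ci_system
begin

lemma bad_unique:
  assumes conn: "\<And>x z. x \<in> \<Union>E \<Longrightarrow> z \<in> \<Union>E \<Longrightarrow> (x, z) \<in> (adj_rel E)\<^sup>*"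
    and f: "f \<in> A" "bad f" and g: "g \<in> A" "bad g"
  shows "f = g"
proof (rule ccontr)
  assume ne: "f \<noteq> g"
  obtain c P Q where db: "dumbbell (dual f) (supp f) c P Q" using bad_dumbbell[OF f] by blast
  obtain c' P0 Q0 where db0: "dumbbell (dual g) (supp g) c' P0 Q0" using bad_dumbbell[OF g] by blast
  note D = dumbbellD[OF db]
  have suppE: "supp h \<subseteq> \<Union>E" if "h \<in> A" for h
    using A_props(2)[OF that] keys_img[OF A_props(2)[OF that]] by (auto simp: supp_def)
  have "c \<in> \<Union>E" "c' \<in> \<Union>E"
    using suppE[OF f(1)] suppE[OF g(1)] D(1,3) dumbbellD(1,3)[OF db0] by blast+
  then have "(c', c) \<in> (adj_rel E)\<^sup>*" using conn by blast
  define \<delta> where "\<delta> x = (LEAST n. (c', x) \<in> adj_rel E ^^ n)" for x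
  have \<delta>le: "\<delta> x \<le> n" if "(c', x) \<in> adj_rel E ^^ n" for x n
    unfolding \<delta>_def using that by (rule Least_le)
  have \<delta>rel: "(c', x) \<in> adj_rel E ^^ \<delta> x" if "(c', x) \<in> adj_rel E ^^ n" for x n
    unfolding \<delta>_def using that by (rule LeastI)
  define n where "n = \<delta> c"
  have "(c', c) \<in> adj_rel E ^^ n" unfolding n_def
    using \<open>(c', c) \<in> (adj_rel E)\<^sup>*\<close> \<delta>rel by (auto simp: rtrancl_power)
  then obtain r where r: "r 0 = c'" "r n = c" "\<And>i. i < n \<Longrightarrow> {r i, r (Suc i)} \<in> E"
    unfolding relpow_fun_conv adj_rel_def by auto
  have rrel: "(c', r i) \<in> adj_rel E ^^ i" if "i \<le> n" for i
    unfolding relpow_fun_conv using that r by (intro exI[of _ r]) (auto simp: adj_rel_def)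
  have level: "\<delta> (r i) = i" if "i \<le> n" for i
  proof (rule antisym)
    show "\<delta> (r i) \<le> i" by (rule \<delta>le[OF rrel[OF that]])
    have "(r i, c) \<in> adj_rel E ^^ (n - i)"
      unfolding relpow_fun_conv using that r by (intro exI[of _ "\<lambda>j. r (i + j)"]) (auto simp: adj_rel_def)
    then have "(c', c) \<in> adj_rel E ^^ (\<delta> (r i) + (n - i))"
      using \<delta>rel[OF rrel[OF that]] by (auto simp: relpow_add)
    then show "i \<le> \<delta> (r i)" using \<delta>le n_def that by fastforce
  qed
  define R where "R = r ` {..n}"
  have cR: "c \<in> R" "c' \<in> R" using r(1,2) by (auto simp: R_def image_iff intro: bexI[of _ n] bexI[of _ 0])
  \<comment> \<open>Edges between vertices of a shortest path join neighbours only, so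
    \<open>R\<close> induces a bipartite graph, which fixes no value anywhere.\<close>
  have "\<not> rigid (induced R) x" for x
  proof
    assume rig: "rigid (induced R) x"
    have "(-1 :: rat) ^ \<delta> a + (-1) ^ \<delta> b = 0" if ab: "{a, b} \<in> induced R" for a b
    proof -
      have abE: "{a, b} \<in> E" "a \<noteq> b" using ab edge_distinct by (auto simp: induced_iff)
      obtain i j where ij: "i \<le> n" "j \<le> n" "a = r i" "b = r j" using ab by (auto simp: induced_iff R_def)
      have "(c', b) \<in> adj_rel E ^^ Suc i" using rrel[OF ij(1)] ij(3) abE(1) by (auto simp: adj_rel_def)
      then have 1: "j \<le> Suc i" using \<delta>le level[OF ij(2)] ij(4) by fastforce
      have "{b, a} \<in> E" using abE(1) by (simp add: insert_commute)
      then have "(c', a) \<in> adj_rel E ^^ Suc j" using rrel[OF ij(2)] ij(4) by (auto simp: adj_rel_def)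
      then have 2: "i \<le> Suc j" using \<delta>le level[OF ij(1)] ij(3) by fastforce
      have "i \<noteq> j" using abE(2) ij by auto
      then have "i = Suc j \<or> j = Suc i" using 1 2 by auto
      then show ?thesis using level ij by auto
    qed
    then have "(-1 :: rat) ^ \<delta> x = 0" using rig[unfolded rigid_def, rule_format, of "\<lambda>x. (-1) ^ \<delta> x"] by blast
    then show False by simp
  qed
  note Rnr = this
  have notR: "\<not> T \<subseteq> R" if "rigid (induced T) x" for T x
    using rigid_mono[OF that induced_mono] Rnr by blast
  have walkR: "walk_on (induced (R \<union> T)) r n" for T
    using r(3) by (auto simp: walk_on_def induced_iff R_def)
  have walkR': "walk_on (induced (R \<union> T)) (\<lambda>i. r (n - i)) n" for T
  proof -
    have "{r (n - i), r (n - Suc i)} \<in> induced (R \<union> T)" if "i < n" for i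
      using r(3)[of "n - Suc i"] that by (auto simp: induced_iff R_def Suc_diff_Suc insert_commute)
    then show ?thesis by (simp add: walk_on_def)
  qed
  have to_c: "rigid (induced (R \<union> T)) c" if "rigid (induced T) c'" for T
    using rigid_transport[OF _ walkR, of T] rigid_mono[OF that induced_mono] r(1,2) by auto
  have to_c': "rigid (induced (R \<union> T)) c'" if "rigid (induced T) c" for T
    using rigid_transport[OF _ walkR', of T] rigid_mono[OF that induced_mono] r(1,2) by auto
  note D0 = dumbbellD[OF db0]
  obtain P' Q' where db': "dumbbell (dual g) (supp g) c' P' Q'" and PP: "P \<subseteq> R \<union> P'" "Q \<subseteq> R \<union> Q'"
  proof -
    \<comment> \<open>Each side of the second dumbbell, joined with \<open>R\<close>, forces a value
      at \<open>c\<close> and so contains a side of the first. No side of the first fits into both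
      unions, since it would then lie in \<open>R\<close>; this matches the sides in pairs.\<close>
    have 1: "P \<subseteq> R \<union> P0 \<or> Q \<subseteq> R \<union> P0"
      using dumbbell_rigid_contains[OF f(1) db _ to_c[OF D0(6)]] cR by blast
    have 2: "P \<subseteq> R \<union> Q0 \<or> Q \<subseteq> R \<union> Q0"
      using dumbbell_rigid_contains[OF f(1) db _ to_c[OF D0(7)]] cR by blast
    have 3: "\<not> (T \<subseteq> R \<union> P0 \<and> T \<subseteq> R \<union> Q0)" if "rigid (induced T) c" for T
    proof -
      have "x \<in> R" if "x \<in> P0" "x \<in> Q0" for x using that D0(2) cR(2) by (metis IntI singletonD)
      then show ?thesis using notR[OF that] by blast
    qed
    have "(P \<subseteq> R \<union> P0 \<and> Q \<subseteq> R \<union> Q0) \<or> (P \<subseteq> R \<union> Q0 \<and> Q \<subseteq> R \<union> P0)"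
      using 1 2 3[OF D(6)] 3[OF D(7)] by blast
    then show thesis using that[OF db0] that[OF dumbbell_sym[OF db0]] by blast
  qed
  note D' = dumbbellD[OF db']
  have PQR: "x \<in> R" if "x \<in> P" "x \<in> Q" for x using that D(2) cR(1) by (metis IntI singletonD)
  have P'P: "P' \<subseteq> R \<union> P"
  proof -
    have "P' \<subseteq> R \<union> P \<or> Q' \<subseteq> R \<union> P"
      using dumbbell_rigid_contains[OF g(1) db' _ to_c'[OF D(6)]] cR by blast
    moreover have "\<not> Q' \<subseteq> R \<union> P" using notR[OF D(7)] PP(2) PQR by blast
    ultimately show ?thesis by blast
  qed
  have Q'Q: "Q' \<subseteq> R \<union> Q"
  proof -
    have "P' \<subseteq> R \<union> Q \<or> Q' \<subseteq> R \<union> Q"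
      using dumbbell_rigid_contains[OF g(1) db' _ to_c'[OF D(7)]] cR by blast
    moreover have "\<not> P' \<subseteq> R \<union> Q" using notR[OF D(6)] PP(1) PQR by blast
    ultimately show ?thesis by blast
  qed
  \<comment> \<open>Three potentials of one weight are compared: \<open>\<phi>\<close> on the second
    support, \<open>\<psi>\<close> and \<open>\<psi>'\<close> on the two sides of the first joined
    with \<open>R\<close>. The sides \<open>P'\<close> and \<open>Q'\<close> force both to agree
    with \<open>\<phi>\<close> at \<open>c'\<close>, and the path carries the agreement to
    \<open>c\<close>.\<close>
  obtain \<phi> where \<phi>: "is_pot (dual f) (induced (supp g)) \<phi>"
    using dual_cob[OF f(1) supp_not_subset[OF f(1) g ne]] unfolding cob_def by blast
  have "\<not> supp f \<subseteq> R \<union> P" using notR[OF D(7)] PQR unfolding D(1)[symmetric] by blast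
  then obtain \<psi> where \<psi>: "is_pot (dual f) (induced (R \<union> P)) \<psi>" using dual_cob[OF f(1)] unfolding cob_def by blast
  have "\<not> supp f \<subseteq> R \<union> Q" using notR[OF D(6)] PQR unfolding D(1)[symmetric] by blast
  then obtain \<psi>' where \<psi>': "is_pot (dual f) (induced (R \<union> Q)) \<psi>'" using dual_cob[OF f(1)] unfolding cob_def by blast
  have "\<psi> c' = \<phi> c'"
    by (rule pot_unique[OF D'(6) is_pot_mono[OF \<psi> induced_mono[OF P'P]] is_pot_mono[OF \<phi> induced_mono]]) (use D'(1) in blast)
  moreover have "\<psi>' c' = \<phi> c'"
    by (rule pot_unique[OF D'(7) is_pot_mono[OF \<psi>' induced_mono[OF Q'Q]] is_pot_mono[OF \<phi> induced_mono]]) (use D'(1) in blast)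
  ultimately have "\<psi> c = \<psi>' c"
    using pot_walk[OF \<psi> walkR] pot_walk[OF \<psi>' walkR] r(1,2) by simp
  moreover have "is_pot (dual f) (induced P) \<psi>" by (rule is_pot_mono[OF \<psi> induced_mono]) auto
  moreover have "is_pot (dual f) (induced Q) \<psi>'" by (rule is_pot_mono[OF \<psi>' induced_mono]) auto
  ultimately show False using D(10) by blast
qed

end

section \<open>Generators of squarefree degree\<close>

lemma (in edge_set) lookup_le_img:
  assumes "keys m \<subseteq> E" "x \<in> e"
  shows "lookup m e \<le> lookup (mono_img m) x"
proof (cases "e \<in> E")
  case True
  then show ?thesis unfolding lookup_img[OF assms(1)]
    using fin_E assms(2) by (intro member_le_sum) auto
next
  case False
  then have "e \<notin> keys m" using assms(1) by auto
  then show ?thesis by (simp add: in_keys_iff)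
qed

lemma (in edge_set) squarefree_matching:
  assumes m: "keys m \<subseteq> E" "lookup (mono_img m) x \<le> 1" and e: "e \<in> keys m" "e' \<in> keys m" "x \<in> e" "x \<in> e'"
  shows "e = e'"
proof (rule ccontr)
  assume ne: "e \<noteq> e'"
  have "(\<Sum>e\<in>{e, e'}. lookup m e) \<le> (\<Sum>e\<in>{e\<in>E. x \<in> e}. lookup m e)"
    using fin_E e m(1) by (intro sum_mono2) auto
  then have "lookup m e + lookup m e' \<le> 1" using ne m(2) unfolding lookup_img[OF m(1)] by simp
  moreover have "lookup m e > 0" "lookup m e' > 0" using e by (auto simp: in_keys_iff)
  ultimately show False by linarith
qed

context ci_system
begin

text \<open>The two matchings given by the monomials of the generator alternate along a maximal
  alternating path, which closes up to an even cycle.\<close>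
lemma squarefree_even_cycle:
  assumes f: "f \<in> A" and nb: "\<not> bad f" and V: "\<Union>E \<subseteq> V"
  shows "\<exists>w. even_cycle V E w \<and> f = B_cycle w"
proof -
  note p = A_props[OF f]
  define U T where "U = keys (bin_lead f)" and "T = keys (bin_trail f)"
  have sq: "lookup (bin_deg f) x \<le> 1" for x using nb by (auto simp: bad_def not_less)
  have suppUT: "supp f = \<Union>U" "supp f = \<Union>T"
    using keys_img[OF p(2)] keys_img[OF p(3)] p(5) by (auto simp: supp_def U_def T_def)
  have UE: "U \<subseteq> E" "T \<subseteq> E" using p by (auto simp: U_def T_def)
  have disj: "U \<inter> T = {}" using lead_trail_disjoint[OF f] by (simp add: U_def T_def)
  have uniqU: "e = e'" if "e \<in> U" "e' \<in> U" "x \<in> e" "x \<in> e'" for e e' x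
    using squarefree_matching[OF p(2) sq] that by (auto simp: U_def)
  have uniqT: "e = e'" if "e \<in> T" "e' \<in> T" "x \<in> e" "x \<in> e'" for e e' x
    using squarefree_matching[OF p(3), unfolded p(5), OF sq] that by (auto simp: T_def)
  define M where "M k = (if even k then U else T)" for k :: nat
  have uniq: "e = e'" if "e \<in> M k" "e' \<in> M k'" "even k \<longleftrightarrow> even k'" "x \<in> e" "x \<in> e'" for e e' x k k'
    using uniqU uniqT that by (auto simp: M_def split: if_splits)
  define alt where "alt w \<longleftrightarrow> w \<noteq> [] \<and> distinct w \<and> set w \<subseteq> supp f \<and>
    (\<forall>k. Suc k < length w \<longrightarrow> {w ! k, w ! Suc k} \<in> M k)" for w
  have finS: "finite (supp f)" by (simp add: supp_def)
  have "bin_lead f \<noteq> 0"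
  proof
    assume "bin_lead f = 0"
    moreover from this have "bin_trail f = 0" using p(5) img_eq_0[OF p(3)] by simp
    ultimately show False using p(4) by simp
  qed
  then obtain e1 where e1: "e1 \<in> U" by (fastforce simp: U_def)
  then have "e1 \<noteq> {}" using UE card_edge[of e1] by auto
  then obtain x0 where "x0 \<in> supp f" using e1 suppUT by auto
  then have "alt [x0]" by (auto simp: alt_def)
  moreover have "length w < Suc (card (supp f))" if "alt w" for w
    using that finS card_mono[of "supp f" "set w"] distinct_card[of w] by (auto simp: alt_def)
  ultimately obtain w where w: "alt w" and wmax: "\<And>w'. alt w' \<Longrightarrow> length w' \<le> length w"
    using ex_has_greatest_nat[of alt "[x0]" length "Suc (card (supp f))"] by blast
  define L where "L = length w"
  have wd: "distinct w" "L > 0" "set w \<subseteq> supp f" using w by (auto simp: alt_def L_def)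
  have wM: "{w ! k, w ! Suc k} \<in> M k" if "Suc k < L" for k using w that by (auto simp: alt_def L_def)
  have winj: "w ! i = w ! j \<longleftrightarrow> i = j" if "i < L" "j < L" for i j
    using nth_eq_iff_index_eq[OF wd(1)] that by (simp add: L_def)
  define z where "z = w ! (L - 1)"
  have "z \<in> supp f" using wd by (auto simp: z_def L_def)
  then have "\<exists>e\<in>M (L - 1). z \<in> e" using suppUT by (auto simp: M_def)
  then obtain e where e: "e \<in> M (L - 1)" "z \<in> e" by blast
  then have eE: "e \<in> E" using UE by (auto simp: M_def split: if_splits)
  obtain x where x: "e = {z, x}" "x \<noteq> z"
  proof -
    obtain a b where "e = {a, b}" "a \<noteq> b" using edge_ends[OF eE] by blast
    then show thesis using e(2) that[of a] that[of b] by auto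
  qed
  have xS: "x \<in> supp f" using e(1) x suppUT by (auto simp: M_def split: if_splits)
  \<comment> \<open>Otherwise the longest alternating path could be prolonged along the matching
    edge \<open>e\<close> at its end.\<close>
  have "x \<in> set w"
  proof (rule ccontr)
    assume nx: "x \<notin> set w"
    have "alt (w @ [x])"
      unfolding alt_def
    proof (intro conjI allI impI)
      fix k assume "Suc k < length (w @ [x])"
      then have "Suc k < L \<or> Suc k = L" by (auto simp: L_def)
      then consider "Suc k < L" | "Suc k = L" by blast
      then show "{(w @ [x]) ! k, (w @ [x]) ! Suc k} \<in> M k"
      proof cases
        case 1
        then show ?thesis using wM[OF 1] by (simp add: nth_append L_def)
      next
        case 2
        then have "k = L - 1" by simp
        then show ?thesis using e(1) x 2 by (auto simp: nth_append L_def z_def)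
      qed
    qed (use wd nx xS in auto)
    then show False using wmax by fastforce
  qed
  then obtain j where j: "j < L" "x = w ! j" by (auto simp: in_set_conv_nth L_def)
  have jL: "j < L - 1" using j x(2) by (cases "j = L - 1") (auto simp: z_def)
  \<comment> \<open>The vertex \<open>x = w ! j\<close> has only one edge in the matching of
    \<open>e\<close>; a path edge at \<open>x\<close> in that matching is \<open>e\<close> itself
    and leads to the end of the path.\<close>
  have hit: "L - 1 = i'" if "{w ! i, w ! i'} \<in> M k" "i = j" "i' < L" "i' \<noteq> i" "even k \<longleftrightarrow> even (L - 1)" for i i' k
  proof -
    have "{w ! i, w ! i'} = e" using uniq[OF that(1) e(1) that(5), of x] that(2) j x by auto
    then have "w ! i' = z" using x that j winj by (auto simp: doubleton_eq_iff)
    then show ?thesis using winj[of i' "L - 1"] that wd(2) by (auto simp: z_def)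
  qed
  have same: "\<not> (even j \<longleftrightarrow> even (L - 1))"
  proof
    assume eq: "even j \<longleftrightarrow> even (L - 1)"
    have "L - 1 = Suc j" using hit[of j "Suc j" j] wM[of j] jL eq by auto
    then show False using eq by auto
  qed
  have j0: "j = 0"
  proof (rule ccontr)
    assume "j \<noteq> 0"
    then obtain i where i: "j = Suc i" by (cases j) auto
    have "{w ! j, w ! i} \<in> M i" using wM[of i] i j(1) by (simp add: insert_commute)
    then have "L - 1 = i" using same i j(1) by (intro hit[of j i i]) auto
    then show False using i jL by simp
  qed
  then have evL: "even L" "odd (L - 1)" using same wd(2) by auto
  have "L \<noteq> 2"
  proof
    assume "L = 2"
    then have "{w ! 0, w ! 1} \<in> U" using wM[of 0] by (simp add: M_def)
    moreover have "{w ! 1, w ! 0} \<in> T" using e(1) x j0 j(2) \<open>L = 2\<close> by (auto simp: M_def z_def)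
    ultimately show False using disj by (auto simp: insert_commute)
  qed
  then have L3: "L \<ge> 3" using evL wd(2) by presburger
  have edges: "cycle_edge w k \<in> M k" if "k < L" for k
  proof (cases "Suc k < L")
    case True
    then show ?thesis using wM[OF True] by (simp add: cycle_edge_def L_def)
  next
    case False
    then have k: "k = L - 1" "Suc k = L" using that by auto
    then have "cycle_edge w k = e" using x j0 j(2) by (simp add: cycle_edge_def z_def L_def[symmetric])
    then show ?thesis using e(1) k by simp
  qed
  have cyc: "even_cycle V E w"
    unfolding even_cycle_def
  proof (intro conjI allI impI)
    show "set w \<subseteq> V" using wd(3) suppUT(1) UE V by blast
    fix k assume "k < length w"
    then have "cycle_edge w k \<in> E" using edges[of k] UE by (auto simp: M_def L_def split: if_splits)
    then show "{w ! k, w ! ((k + 1) mod length w)} \<in> E" by (simp add: cycle_edge_def)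
  qed (use L3 evL wd in \<open>auto simp: L_def\<close>)
  define v where "v k = w ! (k mod L)" for k
  have ve: "{v k, v (Suc k)} = cycle_edge w k" if "k < L" for k
    using that by (simp add: v_def cycle_edge_def L_def)
  have vL: "v L = v 0" by (simp add: v_def)
  have vw: "walk_on E v L"
    unfolding walk_on_def
  proof (intro allI impI)
    fix k assume k: "k < L"
    have "M k \<subseteq> E" using UE by (simp add: M_def)
    then show "{v k, v (Suc k)} \<in> E" unfolding ve[OF k] using edges[OF k] by blast
  qed
  note cm = closed_walk_monomials[OF evL(1) vL vw order_refl]
  let ?a = "even_part v L" and ?b = "odd_part v L"
  have inj: "inj_on v {..<L}" using winj by (auto simp: inj_on_def v_def)
  have "{v k, v (Suc k)} \<in> U" if "k < L" "even k" for k
    unfolding ve[OF that(1)] using edges[OF that(1)] that(2) by (simp add: M_def)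
  then have ka: "keys ?a \<subseteq> U" by (auto simp: even_part_def keys_sum_nat)
  have "{v k, v (Suc k)} \<in> T" if "k < L" "odd k" for k
    unfolding ve[OF that(1)] using edges[OF that(1)] that(2) by (simp add: M_def)
  then have kb: "keys ?b \<subseteq> T" by (auto simp: odd_part_def keys_sum_nat)
  have le1: "lookup m e \<le> 1" if "keys m \<subseteq> E" "mono_img m = (\<Sum>k<L. single (v k) 1)" for m e
  proof (cases "e \<in> E")
    case True
    then obtain x where "x \<in> e" using edge_ends by blast
    then show ?thesis using lookup_le_img[OF that(1), of x e] lookup_sum_single_inj[OF inj, of x] that(2) by simp
  next
    case False
    then have "e \<notin> keys m" using that by auto
    then show ?thesis by (simp add: in_keys_iff)
  qed
  have lea: "pm_le ?a (bin_lead f)"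
    unfolding pm_le_def
  proof
    fix e show "lookup ?a e \<le> lookup (bin_lead f) e"
      using le1[OF cm(1,3), of e] ka by (cases "e \<in> keys ?a") (auto simp: U_def in_keys_iff subset_iff Suc_le_eq intro: le_trans)
  qed
  have leb: "pm_le ?b (bin_trail f)"
    unfolding pm_le_def
  proof
    fix e show "lookup ?b e \<le> lookup (bin_trail f) e"
      using le1[OF cm(2,4), of e] kb by (cases "e \<in> keys ?b") (auto simp: T_def in_keys_iff subset_iff Suc_le_eq intro: le_trans)
  qed
  obtain a' where a': "bin_lead f = ?a + a'" using pm_leE[OF lea] by metis
  obtain b' where b': "bin_trail f = ?b + b'" using pm_leE[OF leb] by metis
  have ab'E: "keys a' \<subseteq> E" "keys b' \<subseteq> E" using p(2,3) unfolding a' b' by (auto simp: keys_add_nat)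
  have imgab: "mono_img ?a = mono_img ?b" using cm(3,4) by simp
  have img': "mono_img a' = mono_img b'" using p(5) imgab unfolding a' b' by (simp add: mono_img_add)
  have deg: "bin_deg f = mono_img ?a + mono_img a'" by (simp add: a' mono_img_add)
  have "cycle_edge w 0 \<in> keys ?a"
    using ve[of 0] wd(2) by (auto simp: even_part_def keys_sum_nat)
  then have "?a \<noteq> 0" by auto
  then have imga: "mono_img ?a \<noteq> 0" using img_eq_0[OF cm(1)] by simp
  \<comment> \<open>If the cycle used only part of the degree, \<open>f\<close> would split into the
    cycle relation and a complementary one, neither of degree above that of \<open>f\<close>, and
    the dual functional would vanish on both.\<close>
  have full: "mono_img ?a = bin_deg f"
  proof (rule ccontr)
    assume ne: "mono_img ?a \<noteq> bin_deg f"
    have "\<not> pm_le (bin_deg f) (mono_img ?a)"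
      using ne pm_le_antisym[of "bin_deg f" "mono_img ?a"] by (auto simp: deg)
    then have 1: "wt (dual f) ?a = wt (dual f) ?b" using dual_wt_eq[OF f cm(1,2) imgab] by simp
    have "\<not> pm_le (bin_deg f) (mono_img a')"
    proof
      assume "pm_le (bin_deg f) (mono_img a')"
      then have "bin_deg f = mono_img a'" by (rule pm_le_antisym) (simp add: deg)
      then show False using imga by (simp add: deg)
    qed
    then have 2: "wt (dual f) a' = wt (dual f) b'" using dual_wt_eq[OF f ab'E img'] by simp
    have "pair (dual f) f = 0" unfolding pair_def a' b' using 1 2 by (simp add: wt_add)
    then show False using dual_props(1)[OF f] by simp
  qed
  then have "mono_img a' = 0" using deg by simp
  then have "a' = 0" "b' = 0" using img' img_eq_0 ab'E by auto
  then have "bin_lead f = ?a" "bin_trail f = ?b" using a' b' by auto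
  moreover have "B_cycle w = single ?a 1 - (single ?b 1 :: ('v, 'k) epoly)"
  proof -
    have "(\<Sum>k\<in>{k. k < L \<and> even k}. single (cycle_edge w k) (1::nat)) = ?a"
      unfolding even_part_def using ve by (intro sum.cong) auto
    moreover have "(\<Sum>k\<in>{k. k < L \<and> odd k}. single (cycle_edge w k) (1::nat)) = ?b"
      unfolding odd_part_def using ve by (intro sum.cong) auto
    ultimately show ?thesis unfolding B_cycle_def L_def[symmetric] by (simp add: prod_evar)
  qed
  ultimately have "f = B_cycle w" using p(1) by simp
  then show ?thesis using cyc by blast
qed

end

section \<open>Blocks and the converse direction\<close>

section \<open>Blocks\<close>

lemma adj_rtrancl_mono: "X \<subseteq> Y \<Longrightarrow> (a, b) \<in> (adj_rel X)\<^sup>* \<Longrightarrow> (a, b) \<in> (adj_rel Y)\<^sup>*"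
  by (rule rtrancl_mono[THEN subsetD]) (auto simp: adj_rel_def)

lemma adj_rtrancl_sym: "(a, b) \<in> (adj_rel X)\<^sup>* \<Longrightarrow> (b, a) \<in> (adj_rel X)\<^sup>*"
  using sym_rtrancl[of "adj_rel X"] by (auto simp: sym_def adj_rel_def insert_commute)

lemma adj_rtrancl_hub:
  assumes "\<And>u. u \<in> S \<Longrightarrow> (u, h) \<in> (adj_rel X)\<^sup>*" "u \<in> S" "v \<in> S"
  shows "(u, v) \<in> (adj_rel X)\<^sup>*"
  using assms(1)[OF assms(2)] adj_rtrancl_sym[OF assms(1)[OF assms(3)]] by (rule rtrancl_trans)

lemma biconnectedD:
  assumes "biconnected V E" "u \<in> V" "v \<in> V"
  shows "(u, v) \<in> (adj_rel E)\<^sup>*" "x \<in> V \<Longrightarrow> u \<noteq> x \<Longrightarrow> v \<noteq> x \<Longrightarrow> (u, v) \<in> (adj_rel {e\<in>E. x \<notin> e})\<^sup>*"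
  using assms by (auto simp: biconnected_def graph_connected_def)

text \<open>Deleting one vertex leaves at least one of \<open>a\<close> and \<open>b\<close>, and
  everything that remains on either side still reaches it.\<close>

lemma biconnected_union:
  assumes B1: "biconnected V1 E1" "\<forall>e\<in>E1. e \<subseteq> V1" and B2: "biconnected V2 E2" "\<forall>e\<in>E2. e \<subseteq> V2"
    and ab: "a \<noteq> b" "a \<in> V1 \<inter> V2" "b \<in> V1 \<inter> V2"
  shows "biconnected (V1 \<union> V2) (E1 \<union> E2)"
proof -
  have "(u, a) \<in> (adj_rel (E1 \<union> E2))\<^sup>*" if "u \<in> V1 \<union> V2" for u
    using that biconnectedD(1)[OF B1(1), of u a] biconnectedD(1)[OF B2(1), of u a] ab(2)
      adj_rtrancl_mono[of E1 "E1 \<union> E2"] adj_rtrancl_mono[of E2 "E1 \<union> E2"] by blast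
  from adj_rtrancl_hub[OF this] have con: "graph_connected (V1 \<union> V2) (E1 \<union> E2)"
    using ab unfolding graph_connected_def by blast
  have rem: "(u, v) \<in> (adj_rel {e\<in>E1 \<union> E2. x \<notin> e})\<^sup>*"
    if uv: "x \<in> V1 \<union> V2" "u \<in> V1 \<union> V2 - {x}" "v \<in> V1 \<union> V2 - {x}" for x u v
  proof -
    obtain z where z: "z \<in> V1" "z \<in> V2" "z \<noteq> x" using ab by blast
    have one: "(u, z) \<in> (adj_rel {e\<in>E1 \<union> E2. x \<notin> e})\<^sup>*"
      if B: "biconnected W D" "\<forall>e\<in>D. e \<subseteq> W" "D \<subseteq> E1 \<union> E2" "z \<in> W" "u \<in> W" "u \<noteq> x" for W D u
    proof (cases "x \<in> W")
      case True
      show ?thesis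
        by (rule adj_rtrancl_mono[OF _ biconnectedD(2)[OF B(1,5,4) True B(6) z(3)]]) (use B(3) in auto)
    next
      case False
      show ?thesis
        by (rule adj_rtrancl_mono[OF _ biconnectedD(1)[OF B(1,5,4)]]) (use B(2,3) False in auto)
    qed
    have "(u, z) \<in> (adj_rel {e\<in>E1 \<union> E2. x \<notin> e})\<^sup>*" if "u \<in> V1 \<union> V2 - {x}" for u
      using that one[OF B1 _ z(1), of u] one[OF B2 _ z(2), of u] by blast
    from adj_rtrancl_hub[OF this uv(2,3)] show ?thesis .
  qed
  then show ?thesis using con unfolding biconnected_def by blast
qed

lemma simple_graph_finite: "simple_graph V E \<Longrightarrow> finite V" "simple_graph V E \<Longrightarrow> finite E"
  by (auto simp: simple_graph_def intro: finite_subset[of E "Pow V"])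

lemma block_exists:
  assumes G: "simple_graph V E" and B: "subgraph V1 E1 V E" "biconnected V1 E1"
  shows "\<exists>V' E'. is_block V E V' E' \<and> V1 \<subseteq> V' \<and> E1 \<subseteq> E'"
proof -
  note fin = simple_graph_finite[OF G]
  define P where "P B \<longleftrightarrow> subgraph (fst B) (snd B) V E \<and> biconnected (fst B) (snd B) \<and> V1 \<subseteq> fst B \<and> E1 \<subseteq> snd B"
    for B :: "'a set \<times> 'a set set"
  define m where "m B = card (fst B) + card (snd B)" for B :: "'a set \<times> 'a set set"
  have bnd: "m B < Suc (card V + card E)" if "P B" for B
    using that fin by (auto simp: P_def m_def subgraph_def less_Suc_eq_le intro!: add_mono card_mono)
  have "P (V1, E1)" using B by (simp add: P_def)
  then obtain W where W: "P W" "\<And>B. P B \<Longrightarrow> m B \<le> m W"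
    using ex_has_greatest_nat[of P "(V1, E1)" m "Suc (card V + card E)"] bnd by blast
  have "is_block V E (fst W) (snd W)"
    unfolding is_block_def
  proof (intro conjI notI)
    show "subgraph (fst W) (snd W) V E" "biconnected (fst W) (snd W)" using W(1) by (auto simp: P_def)
    assume "\<exists>V'' E''. subgraph V'' E'' V E \<and> biconnected V'' E'' \<and> fst W \<subseteq> V'' \<and> snd W \<subseteq> E'' \<and> (V'', E'') \<noteq> (fst W, snd W)"
    then obtain V'' E'' where B: "subgraph V'' E'' V E" "biconnected V'' E''" "fst W \<subseteq> V''" "snd W \<subseteq> E''"
      "(V'', E'') \<noteq> (fst W, snd W)" by blast
    have f: "finite V''" "finite E''" using B(1) fin by (auto simp: subgraph_def intro: finite_subset)
    have "P (V'', E'')" using B W(1) by (auto simp: P_def)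
    then have "card V'' + card E'' \<le> card (fst W) + card (snd W)" using W(2) by (fastforce simp: m_def)
    moreover have "card (fst W) \<le> card V''" "card (snd W) \<le> card E''" using B(3,4) f by (auto intro: card_mono)
    ultimately have "card (fst W) = card V''" "card (snd W) = card E''" by linarith+
    then have "fst W = V''" "snd W = E''" using card_subset_eq[OF f(1) B(3)] card_subset_eq[OF f(2) B(4)] by auto
    then show False using B(5) by simp
  qed
  then show ?thesis using W(1) by (auto simp: P_def)
qed

lemma block_unique:
  assumes B1: "is_block V E V1 E1" and B2: "is_block V E V2 E2"
    and ab: "a \<noteq> b" "a \<in> V1 \<inter> V2" "b \<in> V1 \<inter> V2"
  shows "V1 = V2"
proof -
  have s: "subgraph V1 E1 V E" "subgraph V2 E2 V E" "biconnected V1 E1" "biconnected V2 E2"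
    using B1 B2 by (auto simp: is_block_def)
  then have u: "biconnected (V1 \<union> V2) (E1 \<union> E2)"
    using ab by (intro biconnected_union[of _ _ _ _ a b]) (auto simp: subgraph_def)
  have su: "subgraph (V1 \<union> V2) (E1 \<union> E2) V E" using s by (auto simp: subgraph_def)
  have "(V1 \<union> V2, E1 \<union> E2) = (V1, E1)" using B1 u su unfolding is_block_def by blast
  moreover have "(V1 \<union> V2, E1 \<union> E2) = (V2, E2)" using B2 u su unfolding is_block_def by blast
  ultimately show ?thesis by simp
qed

text \<open>Adding the missing edges between vertices of a block preserves biconnectivity, so
  maximality has already included them. This is what puts blocks under the restriction of minimal
  systems to induced subgraphs.\<close>

lemma block_induced:
  assumes B: "is_block V E V1 E1"
  shows "E1 = {e\<in>E. e \<subseteq> V1}"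
proof -
  let ?E = "{e\<in>E. e \<subseteq> V1}"
  have s: "subgraph V1 E1 V E" "biconnected V1 E1" using B by (auto simp: is_block_def)
  then have sub: "E1 \<subseteq> ?E" by (auto simp: subgraph_def)
  have "biconnected V1 ?E"
    unfolding biconnected_def graph_connected_def
  proof (intro conjI ballI)
    show "V1 \<noteq> {}" using s(2) by (auto simp: biconnected_def graph_connected_def)
    show "(u, v) \<in> (adj_rel ?E)\<^sup>*" if "u \<in> V1" "v \<in> V1" for u v
      by (rule adj_rtrancl_mono[OF sub biconnectedD(1)[OF s(2) that]])
    show "(u, v) \<in> (adj_rel {e\<in>?E. x \<notin> e})\<^sup>*" if x: "x \<in> V1" "u \<in> V1 - {x}" "v \<in> V1 - {x}" for x u v
      by (rule adj_rtrancl_mono[OF _ biconnectedD(2)[OF s(2), of u v x]]) (use sub x in auto)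
  qed
  moreover have "subgraph V1 ?E V E" using s(1) by (auto simp: subgraph_def)
  ultimately have "(V1, ?E) = (V1, E1)" using B sub unfolding is_block_def by blast
  then show ?thesis by simp
qed

lemma edge_in_block:
  assumes G: "simple_graph V E" and e: "e \<in> E"
  shows "\<exists>V' E'. is_block V E V' E' \<and> e \<in> E'"
proof -
  have "card e = 2" "e \<subseteq> V" using G e by (auto simp: simple_graph_def)
  then obtain a b where ab: "e = {a, b}" "a \<noteq> b" by (auto simp: card_2_iff)
  have adj: "(a, b) \<in> (adj_rel {e})\<^sup>*" "(b, a) \<in> (adj_rel {e})\<^sup>*"
    using ab by (auto simp: adj_rel_def insert_commute)
  have "graph_connected e {e}" using adj by (auto simp: graph_connected_def ab(1))
  moreover have "u = v" if "x \<in> e" "u \<in> e - {x}" "v \<in> e - {x}" for x u v using that ab by auto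
  ultimately have "biconnected e {e}" unfolding biconnected_def by blast
  moreover have "subgraph e {e} V E" using e \<open>e \<subseteq> V\<close> by (auto simp: subgraph_def)
  ultimately show ?thesis using block_exists[OF G] by (metis insert_subset)
qed

lemma cycle_in_block:
  assumes G: "simple_graph V E" and w: "even_cycle V E w"
  shows "\<exists>V' E'. is_block V E V' E' \<and> (\<forall>k<length w. cycle_edge w k \<in> E')"
proof -
  define n where "n = length w"
  define C where "C = cycle_edge w ` {..<n}"
  have n3: "n \<ge> 3" and dw: "distinct w" and wV: "set w \<subseteq> V" using w by (auto simp: even_cycle_def n_def)
  have CE: "C \<subseteq> E" using w by (auto simp: C_def even_cycle_def cycle_edge_def n_def)
  have winj: "w ! i = w ! j \<longleftrightarrow> i = j" if "i < n" "j < n" for i j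
    using nth_eq_iff_index_eq[OF dw] that by (simp add: n_def)
  have rem: "(u, v) \<in> (adj_rel {e\<in>C. w ! k \<notin> e})\<^sup>*"
    if k: "k < n" and uv: "u \<in> set w - {w ! k}" "v \<in> set w - {w ! k}" for k u v
  proof -
    let ?R = "(adj_rel {e\<in>C. w ! k \<notin> e})\<^sup>*"
    have stp: "(w ! i, w ! Suc i) \<in> ?R" if "Suc i < n" "i \<noteq> k" "Suc i \<noteq> k" for i
    proof -
      have "cycle_edge w i = {w ! i, w ! Suc i}" using that by (simp add: cycle_edge_def n_def)
      moreover have "cycle_edge w i \<in> C" using that by (auto simp: C_def)
      moreover have "w ! k \<noteq> w ! i" "w ! k \<noteq> w ! Suc i" using winj k that by auto
      ultimately show ?thesis by (intro r_into_rtrancl) (auto simp: adj_rel_def)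
    qed
    have seg: "(w ! i, w ! j) \<in> ?R" if "i \<le> j" "j < n" "\<forall>m. i \<le> m \<and> m \<le> j \<longrightarrow> m \<noteq> k" for i j
      using that
    proof (induction j rule: dec_induct)
      case (step j)
      have "(w ! i, w ! j) \<in> ?R" using step by (intro step.IH) auto
      moreover have "(w ! j, w ! Suc j) \<in> ?R" using step.hyps step.prems by (intro stp) auto
      ultimately show ?case by (rule rtrancl_trans)
    qed auto
    have wrap: "(w ! 0, w ! (n - 1)) \<in> ?R" if "k \<noteq> 0" "k \<noteq> n - 1"
    proof -
      have "n - 1 + 1 = length w" using n3 by (simp add: n_def)
      then have "(n - 1 + 1) mod length w = 0" by (simp only: mod_self)
      then have "cycle_edge w (n - 1) = {w ! (n - 1), w ! 0}" by (simp add: cycle_edge_def)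
      moreover have "cycle_edge w (n - 1) \<in> C" using n3 by (auto simp: C_def)
      moreover have "w ! k \<noteq> w ! 0" "w ! k \<noteq> w ! (n - 1)" using winj k that n3 by auto
      ultimately show ?thesis by (intro r_into_rtrancl) (auto simp: adj_rel_def insert_commute)
    qed
    \<comment> \<open>Deleting \<open>w ! k\<close> turns the cycle into a path. The hub is the last
      vertex of the list, or the first one if the last is deleted.\<close>
    define h where "h = (if k = n - 1 then w ! 0 else w ! (n - 1))"
    have "(u, h) \<in> ?R" if u: "u \<in> set w - {w ! k}" for u
    proof -
      obtain i where i: "i < n" "u = w ! i" "i \<noteq> k" using u by (auto simp: in_set_conv_nth n_def)
      show ?thesis
      proof (cases "i < k")
        case True
        then have 0: "(u, w ! 0) \<in> ?R" using seg[of 0 i] i adj_rtrancl_sym by auto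
        then show ?thesis using wrap True by (auto simp: h_def intro: rtrancl_trans)
      next
        case False
        then have "k \<noteq> n - 1" using i by auto
        moreover have "(u, w ! (n - 1)) \<in> ?R" using seg[of i "n - 1"] i False by auto
        ultimately show ?thesis by (simp add: h_def)
      qed
    qed
    from adj_rtrancl_hub[OF this uv] show ?thesis .
  qed
  have "(u, v) \<in> (adj_rel C)\<^sup>*" if uv: "u \<in> set w" "v \<in> set w" for u v
  proof -
    have "card (set w) \<ge> 3" using distinct_card[OF dw] n3 by (simp add: n_def)
    moreover have "card {u, v} \<le> 2" by (simp add: card_insert_if)
    ultimately have "\<not> set w \<subseteq> {u, v}" using card_mono[of "{u, v}" "set w"] by fastforce
    then obtain x where "x \<in> set w" "x \<noteq> u" "x \<noteq> v" by auto
    then obtain k where k: "k < n" "w ! k \<noteq> u" "w ! k \<noteq> v" by (auto simp: in_set_conv_nth n_def)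
    show ?thesis by (rule adj_rtrancl_mono[OF _ rem[OF k(1), of u v]]) (use k uv in auto)
  qed
  then have "graph_connected (set w) C" using n3 by (auto simp: graph_connected_def n_def)
  moreover have "(u, v) \<in> (adj_rel {e\<in>C. x \<notin> e})\<^sup>*"
    if x: "x \<in> set w" "u \<in> set w - {x}" "v \<in> set w - {x}" for x u v
  proof -
    obtain k where "k < n" "x = w ! k" using x(1) by (auto simp: in_set_conv_nth n_def)
    then show ?thesis using rem x by blast
  qed
  ultimately have "biconnected (set w) C" unfolding biconnected_def by blast
  moreover have "subgraph (set w) C V E"
  proof -
    have "cycle_edge w k \<subseteq> set w" if "k < n" for k
      using that by (auto simp: cycle_edge_def n_def intro!: nth_mem mod_less_divisor)
    then show ?thesis using wV CE by (auto simp: subgraph_def C_def)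
  qed
  ultimately obtain V' E' where "is_block V E V' E'" "C \<subseteq> E'" using block_exists[OF G] by blast
  then show ?thesis by (auto simp: C_def n_def)
qed

section \<open>Linear relations between generators\<close>

lemma lookup_sum_const: "lookup (\<Sum>i<n. m) e = n * lookup m e" for m :: "'a \<Rightarrow>\<^sub>0 nat" and n :: nat
  by (simp add: lookup_sum)

context min_system
begin

text \<open>A rational combination of exponent vectors that vanishes off \<open>F\<close> is, after
  clearing denominators, a difference of two exponent vectors of equal degree. Cancelling their
  common part outside \<open>F\<close> leaves a relation on the independent set
  \<open>F\<close>.\<close>

lemma relation_vanishes:
  fixes \<mu> :: "('v, 'k) epoly \<Rightarrow> rat"
  assumes F: "max_indep E F" and rel: "\<And>e. e \<in> E - F \<Longrightarrow> (\<Sum>f\<in>A. \<mu> f * vec f e) = 0"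
  shows "(\<Sum>f\<in>A. \<mu> f * vec f e) = 0"
proof -
  obtain N :: nat where N: "N > 0" "\<forall>f\<in>A. \<exists>k::int. \<mu> f * of_nat N = of_int k"
    using clear_denominators[OF fin_A] by blast
  then obtain \<kappa> where \<kappa>: "\<And>f. f \<in> A \<Longrightarrow> \<mu> f * of_nat N = of_int (\<kappa> f)" by metis
  \<comment> \<open>At most one of \<open>nat (\<kappa> f)\<close> and
    \<open>nat (- \<kappa> f)\<close> is nonzero; a negative multiple is realised by exchanging the
    two monomials of \<open>f\<close>.\<close>
  define u where "u = (\<Sum>f\<in>A. (\<Sum>i<nat (\<kappa> f). bin_lead f) + (\<Sum>i<nat (- \<kappa> f). bin_trail f))"
  define v where "v = (\<Sum>f\<in>A. (\<Sum>i<nat (\<kappa> f). bin_trail f) + (\<Sum>i<nat (- \<kappa> f). bin_lead f))"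
  have diff: "rat_of_nat (lookup u e) - of_nat (lookup v e) = of_nat N * (\<Sum>f\<in>A. \<mu> f * vec f e)" for e
  proof -
    have nn: "rat_of_nat (nat k) - of_nat (nat (- k)) = of_int k" for k :: int by (cases "k \<ge> 0") auto
    have "rat_of_nat (lookup u e) - of_nat (lookup v e) =
      (\<Sum>f\<in>A. (of_nat (nat (\<kappa> f)) - of_nat (nat (- \<kappa> f))) * vec f e)"
      unfolding u_def v_def lookup_sum[of _ A] lookup_add lookup_sum_const of_nat_sum sum_subtractf[symmetric]
      by (intro sum.cong) (auto simp: vec_def algebra_simps)
    also have "\<dots> = (\<Sum>f\<in>A. of_nat N * (\<mu> f * vec f e))"
      unfolding nn using \<kappa> by (intro sum.cong) (auto simp flip: \<kappa>)
    finally show ?thesis by (simp add: sum_distrib_left)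
  qed
  have uvE: "keys u \<subseteq> E" "keys v \<subseteq> E"
    using A_props(2)[THEN subsetD] A_props(3)[THEN subsetD] unfolding u_def v_def
    by (auto simp: keys_sum_nat[OF fin_A] keys_add_nat keys_sum_nat split: if_splits)
  have img: "mono_img u = mono_img v"
    unfolding u_def v_def mono_img_sum[of _ A] mono_img_add mono_img_sum
    using A_props(5) by (intro sum.cong) auto
  let ?in = "poly_filter (\<lambda>e. e \<in> F)" and ?out = "poly_filter (\<lambda>e. e \<notin> F)"
  have split: "m = ?in m + ?out m" for m :: "'v set \<Rightarrow>\<^sub>0 nat"
    by (rule poly_mapping_eqI) (simp add: lookup_poly_filter lookup_add)
  have out: "?out u = ?out v"
  proof (rule poly_mapping_eqI)
    fix e
    have "lookup u e = lookup v e" if "e \<notin> F"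
    proof (cases "e \<in> E")
      case True
      then show ?thesis using diff[of e] rel[of e] that by simp
    next
      case False
      then have "e \<notin> keys u" "e \<notin> keys v" using uvE by auto
      then show ?thesis by (simp add: in_keys_iff)
    qed
    then show "lookup (?out u) e = lookup (?out v) e" by (simp add: lookup_poly_filter)
  qed
  have "mono_img (?in u) + mono_img (?out u) = mono_img (?in v) + mono_img (?out v)"
    using img split[of u] split[of v] by (metis mono_img_add)
  then have "mono_img (?in u) = mono_img (?in v)" by (simp add: out)
  then have "?in u = ?in v"
    using F by (intro mindepD[of F]) (auto simp: max_indep_def keys_poly_filter)
  then have "u = v" using split[of u] split[of v] out by metis
  then show ?thesis using diff[of e] N(1) by simp
qed

lemma pair_relation:
  assumes "\<And>e. (\<Sum>f\<in>A. \<mu> f * vec f e) = 0"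
  shows "(\<Sum>f\<in>A. \<mu> f * pair y f) = 0"
proof -
  have "(\<Sum>f\<in>A. \<mu> f * pair y f) = (\<Sum>f\<in>A. \<Sum>e\<in>E. y e * (\<mu> f * vec f e))"
    by (intro sum.cong) (auto simp: pair_vec sum_distrib_left mult.left_commute)
  also have "\<dots> = (\<Sum>e\<in>E. y e * (\<Sum>f\<in>A. \<mu> f * vec f e))"
    by (subst sum.swap) (simp add: sum_distrib_left)
  finally show ?thesis using assms by simp
qed

lemma nontrivial_relation:
  assumes F: "max_indep E F" and "card (E - F) < card A"
  shows "\<exists>\<mu>. (\<exists>f\<in>A. \<mu> f \<noteq> 0) \<and> (\<forall>e. (\<Sum>f\<in>A. \<mu> f * vec f e) = 0)"
proof -
  obtain \<mu> where l: "\<exists>f\<in>A. \<mu> f \<noteq> 0" "\<forall>e\<in>E - F. (\<Sum>f\<in>A. \<mu> f * vec f e) = 0"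
    using homogeneous_system_nontrivial[OF _ fin_A assms(2), of "\<lambda>f e. vec f e"] fin_E by auto
  then have "(\<Sum>f\<in>A. \<mu> f * vec f e) = 0" for e using relation_vanishes[OF F] by blast
  then show ?thesis using l(1) by blast
qed

lemma vec_eq_0: "e \<notin> E \<Longrightarrow> f \<in> A \<Longrightarrow> vec f e = 0"
proof -
  assume "e \<notin> E" "f \<in> A"
  then have "e \<notin> keys (bin_lead f)" "e \<notin> keys (bin_trail f)" using A_props(2,3)[of f] by auto
  then show "vec f e = 0" by (simp add: vec_def in_keys_iff)
qed

end

context ci_system
begin

text \<open>In a linear relation between the restricted generators, the dual functional of
  \<open>f\<close> taken from the full system isolates the coefficient of \<open>f\<close>.\<close>

lemma induced_complete_intersection:
  "complete_intersection (poly_ring (induced S)) (toric_ideal (induced S) :: ('v, 'k) epoly set)"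
proof -
  let ?A = "A \<inter> polys_on (induced S)"
  interpret B: min_system "induced S" ?A by (rule min_system_induced)
  obtain F' where F': "max_indep (induced S) F'" using max_indep_exists B.fin_E by blast
  have "card ?A \<le> card (induced S - F')"
  proof (rule ccontr)
    assume "\<not> ?thesis"
    then obtain \<mu> where l: "\<exists>f\<in>?A. \<mu> f \<noteq> 0" "\<forall>e. (\<Sum>f\<in>?A. \<mu> f * vec f e) = 0"
      using B.nontrivial_relation[OF F'] by auto
    obtain f where f: "f \<in> ?A" "\<mu> f \<noteq> 0" using l(1) by blast
    have "0 = (\<Sum>g\<in>?A. \<mu> g * pair (dual f) g)" using B.pair_relation[OF spec[OF l(2)]] by simp
    also have "\<dots> = (\<Sum>g\<in>?A. if g = f then \<mu> f else 0)"
      using dual_props[of f] f by (intro sum.cong) auto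
    also have "\<dots> = \<mu> f" using f(1) fin_A by simp
    finally show False using f(2) by simp
  qed
  then show ?thesis using B.complete_intersection_iff[OF F'] by simp
qed

end

section \<open>Graphs partitioned into blocks\<close>

lemma cycle_in_polys_on:
  assumes "\<And>k. k < length w \<Longrightarrow> cycle_edge w k \<in> E'"
  shows "(B_cycle w :: ('v, 'k::comm_ring_1) epoly) \<in> polys_on E'"
proof -
  have "single (\<Sum>k\<in>K. single (cycle_edge w k) 1) 1 \<in> (polys_on E' :: ('v, 'k) epoly set)"
    if "K \<subseteq> {..<length w}" for K
    using that assms finite_subset[OF that] by (intro single_polys_on) (auto simp: keys_sum_nat)
  then have prods: "(\<Prod>k\<in>K. evar (cycle_edge w k)) \<in> (polys_on E' :: ('v, 'k) epoly set)"
    if "K \<subseteq> {..<length w}" for K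
    using that finite_subset[OF that] by (simp add: prod_evar)
  show ?thesis unfolding B_cycle_def by (intro diff_polys_on prods) auto
qed

text \<open>If a linear relation involves block generators only, a dual functional of one block,
  extended by 0, refutes it. Otherwise it expresses the vector of \<open>g0\<close> through block
  vectors, so the part of \<open>g0\<close> on each block is balanced by itself. These parts lie in
  the block ideals, and together they rebuild \<open>g0\<close> from the other generators.\<close>

lemma (in min_system) complete_intersection_if_blocks:
  assumes fin: "finite Bs"
    and cover: "\<And>e. e \<in> E \<Longrightarrow> \<exists>b\<in>Bs. e \<in> induced b"
    and disj: "\<And>b b'. b \<in> Bs \<Longrightarrow> b' \<in> Bs \<Longrightarrow> b \<noteq> b' \<Longrightarrow> induced b \<inter> induced b' = {}"
    and ci: "\<And>b. b \<in> Bs \<Longrightarrow> complete_intersection (poly_ring (induced b)) (toric_ideal (induced b) :: ('v, 'k) epoly set)"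
    and g0: "\<And>g. g \<in> A \<Longrightarrow> g \<noteq> g0 \<Longrightarrow> \<exists>b\<in>Bs. g \<in> polys_on (induced b)"
  shows "complete_intersection (poly_ring E) (toric_ideal E :: ('v, 'k) epoly set)"
proof -
  obtain F where F: "max_indep E F" using max_indep_exists fin_E by blast
  have "card A \<le> card (E - F)"
  proof (rule ccontr)
    assume "\<not> ?thesis"
    then obtain \<mu> where l: "\<exists>f\<in>A. \<mu> f \<noteq> 0" and rel: "\<And>e. (\<Sum>f\<in>A. \<mu> f * vec f e) = 0"
      using nontrivial_relation[OF F] by auto
    have sysb: "min_system (induced b) (A \<inter> polys_on (induced b))" for b by (rule min_system_induced)
    have vec0: "vec g e = 0" if "g \<in> A" "g \<in> polys_on (induced b)" "e \<notin> induced b" for g b e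
      using min_system.vec_eq_0[OF sysb that(3)] that by blast
    have other: "vec g e = 0" if "g \<in> A" "g \<in> polys_on (induced b')" "b \<in> Bs" "b' \<in> Bs" "b \<noteq> b'" "e \<in> induced b" for g b b' e
      using vec0[OF that(1,2), of e] disj[OF that(3,4,5)] that(6) by blast
    show False
    proof (cases "\<forall>g\<in>A. \<mu> g \<noteq> 0 \<longrightarrow> (\<exists>b\<in>Bs. g \<in> polys_on (induced b))")
      case True
      obtain f where f: "f \<in> A" "\<mu> f \<noteq> 0" using l by blast
      then obtain b where b: "b \<in> Bs" "f \<in> polys_on (induced b)" using True by blast
      let ?A = "A \<inter> polys_on (induced b)"
      interpret B: min_system "induced b" ?A by (rule sysb)
      obtain F' where F': "max_indep (induced b) F'" using max_indep_exists B.fin_E by blast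
      have "card ?A \<le> card (induced b - F')" using B.complete_intersection_iff[OF F'] ci[OF b(1)] by blast
      then obtain y where y: "pair y f = 1" "\<forall>g\<in>?A - {f}. pair y g = 0"
        using B.dual_functional[OF F'] f b by blast
      define y' where "y' e = (if e \<in> induced b then y e else 0)" for e
      have pin: "pair y' g = pair y g" if "g \<in> ?A" for g
        unfolding B.pair_vec[OF that] by (intro sum.cong) (auto simp: y'_def)
      have pout: "\<mu> g * pair y' g = 0" if g: "g \<in> A" "g \<notin> ?A" for g
      proof (cases "\<mu> g = 0")
        case False
        then obtain b' where b': "b' \<in> Bs" "g \<in> polys_on (induced b')" using True g(1) by blast
        then have ne: "b \<noteq> b'" using g by blast
        have "pair y' g = 0"
          unfolding pair_vec[OF g(1)]
        proof (rule sum.neutral, rule ballI)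
          fix e
          show "y' e * vec g e = 0" using other[OF g(1) b'(2) b(1) b'(1) ne, of e] by (auto simp: y'_def)
        qed
        then show ?thesis by simp
      qed simp
      have "0 = (\<Sum>g\<in>A. \<mu> g * pair y' g)" using pair_relation[OF rel] by simp
      also have "\<dots> = (\<Sum>g\<in>A. if g = f then \<mu> f else 0)"
      proof (rule sum.cong[OF refl])
        fix g assume g: "g \<in> A"
        show "\<mu> g * pair y' g = (if g = f then \<mu> f else 0)"
        proof (cases "g \<in> ?A")
          case True
          then show ?thesis using y pin[OF True] by auto
        next
          case False
          then show ?thesis using pout[OF g False] f b by auto
        qed
      qed
      also have "\<dots> = \<mu> f" using f(1) fin_A by simp
      finally show False using f(2) by simp
    next
      case False
      then have g0A: "g0 \<in> A" "\<mu> g0 \<noteq> 0" and g0b: "\<And>b. b \<in> Bs \<Longrightarrow> g0 \<notin> polys_on (induced b)"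
        using g0 by blast+
      note p = A_props[OF g0A(1)]
      define U where "U b = poly_filter (\<lambda>e. e \<in> induced b) (bin_lead g0)" for b
      define W where "W b = poly_filter (\<lambda>e. e \<in> induced b) (bin_trail g0)" for b
      have keysU: "keys (U b) \<subseteq> induced b" "keys (W b) \<subseteq> induced b" for b
        by (auto simp: U_def W_def keys_poly_filter)
      \<comment> \<open>Summed over the edges of block \<open>b\<close> at \<open>x\<close>, a
        generator of \<open>b\<close> contributes 0 by balance and one of another block by
        disjointness; the relation thus isolates \<open>g0\<close>.\<close>
      have img: "mono_img (U b) = mono_img (W b)" if b: "b \<in> Bs" for b
      proof (rule poly_mapping_eqI)
        fix x
        interpret B: min_system "induced b" "A \<inter> polys_on (induced b)" by (rule sysb)
        let ?s = "{e\<in>induced b. x \<in> e}"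
        have z: "\<mu> g * (\<Sum>e\<in>?s. vec g e) = 0" if g: "g \<in> A" "g \<noteq> g0" for g
        proof (cases "g \<in> polys_on (induced b)")
          case True
          then show ?thesis using B.vec_boundary[of g x] g by simp
        next
          case False
          then obtain b' where b': "b' \<in> Bs" "g \<in> polys_on (induced b')" "b \<noteq> b'" using g0[OF g] by blast
          then have "(\<Sum>e\<in>?s. vec g e) = 0" using other[OF g(1) b'(2) b b'(1,3)] by (intro sum.neutral) auto
          then show ?thesis by simp
        qed
        have "0 = (\<Sum>e\<in>?s. \<Sum>g\<in>A. \<mu> g * vec g e)" using rel by simp
        also have "\<dots> = (\<Sum>g\<in>A. \<mu> g * (\<Sum>e\<in>?s. vec g e))"
          by (subst sum.swap) (simp add: sum_distrib_left)
        also have "\<dots> = \<mu> g0 * (\<Sum>e\<in>?s. vec g0 e) + (\<Sum>g\<in>A - {g0}. \<mu> g * (\<Sum>e\<in>?s. vec g e))"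
          by (rule sum.remove[OF fin_A g0A(1)])
        also have "(\<Sum>g\<in>A - {g0}. \<mu> g * (\<Sum>e\<in>?s. vec g e)) = 0" using z by (intro sum.neutral) auto
        finally have "(\<Sum>e\<in>?s. vec g0 e) = 0" using g0A(2) by simp
        then have "(\<Sum>e\<in>?s. rat_of_nat (lookup (bin_lead g0) e)) = (\<Sum>e\<in>?s. of_nat (lookup (bin_trail g0) e))"
          by (simp add: vec_def sum_subtractf)
        then have "(\<Sum>e\<in>?s. lookup (bin_lead g0) e) = (\<Sum>e\<in>?s. lookup (bin_trail g0) e)"
          by (simp flip: of_nat_sum)
        moreover have "lookup (mono_img (U b)) x = (\<Sum>e\<in>?s. lookup (bin_lead g0) e)"
          unfolding B.lookup_img[OF keysU(1)] by (intro sum.cong) (auto simp: U_def lookup_poly_filter)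
        moreover have "lookup (mono_img (W b)) x = (\<Sum>e\<in>?s. lookup (bin_trail g0) e)"
          unfolding B.lookup_img[OF keysU(2)] by (intro sum.cong) (auto simp: W_def lookup_poly_filter)
        ultimately show "lookup (mono_img (U b)) x = lookup (mono_img (W b)) x" by simp
      qed
      define J where "J = comb E (A - {g0})"
      have J: "ideal J (poly_ring E)" unfolding J_def using A_polys by (intro ideal_comb) auto
      have mem: "single (U b) 1 - single (W b) 1 \<in> J" if b: "b \<in> Bs" for b
      proof -
        interpret B: min_system "induced b" "A \<inter> polys_on (induced b)" by (rule sysb)
        have "single (U b) 1 - single (W b) 1 \<in> (toric_ideal (induced b) :: ('v, 'k) epoly set)"
          unfolding toric_ideal_eq_kernel by (rule binomial_in_graded_kernel[OF keysU img[OF b]])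
        also have "\<dots> = comb (induced b) (A \<inter> polys_on (induced b))" by (rule B.comb_A[symmetric])
        also have "\<dots> \<subseteq> J" unfolding J_def
          using g0b[OF b] fin_A by (intro comb_mono) (auto simp: induced_def)
        finally show ?thesis .
      qed
      \<comment> \<open>Congruences modulo \<open>J\<close> between the block parts are multiplied,
        one block at a time.\<close>
      have sums: "single (\<Sum>b\<in>C. U b) 1 - single (\<Sum>b\<in>C. W b) 1 \<in> J" if "C \<subseteq> Bs" for C
        using finite_subset[OF that fin] that
      proof (induction C rule: finite_induct)
        case empty
        then show ?case using ideal_poly_ringD(2)[OF J] by simp
      next
        case (insert b C)
        let ?X = "single (\<Sum>b\<in>C. U b) (1::'k)" and ?Y = "single (\<Sum>b\<in>C. W b) (1::'k)"
        have kE: "keys (\<Sum>b\<in>C. U b) \<subseteq> E" "keys (W b) \<subseteq> E"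
          using keysU insert.hyps(1) by (auto simp: keys_sum_nat induced_def)
        have "?X * (single (U b) 1 - single (W b) 1) \<in> J"
          using mem[of b] insert.prems kE by (intro ideal_poly_ringD(4)[OF J] single_polys_on) auto
        moreover have "single (W b) 1 * (?X - ?Y) \<in> J"
          using insert kE by (intro ideal_poly_ringD(4)[OF J] single_polys_on) auto
        ultimately have "?X * (single (U b) 1 - single (W b) 1) + single (W b) 1 * (?X - ?Y) \<in> J"
          by (rule ideal_poly_ringD(3)[OF J])
        moreover have "?X * (single (U b) 1 - single (W b) 1) + single (W b) 1 * (?X - ?Y) =
            single (\<Sum>b\<in>insert b C. U b) 1 - single (\<Sum>b\<in>insert b C. W b) 1"
          using insert.hyps by (simp add: right_diff_distrib mult_single add.commute)
        ultimately show ?case by simp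
      qed
      have one: "lookup (\<Sum>b\<in>Bs. poly_filter (\<lambda>e. e \<in> induced b) m) e = lookup m e" if m: "keys m \<subseteq> E" for m e
      proof (cases "e \<in> E")
        case True
        then obtain b where b: "b \<in> Bs" "e \<in> induced b" using cover by blast
        have "lookup (\<Sum>b\<in>Bs. poly_filter (\<lambda>e. e \<in> induced b) m) e = (\<Sum>b'\<in>Bs. if b' = b then lookup m e else 0)"
          unfolding lookup_sum lookup_poly_filter using b disj by (intro sum.cong) auto
        then show ?thesis using b(1) fin by simp
      next
        case False
        then have "lookup m e = 0" using m by (meson in_keys_iff subsetD)
        then show ?thesis by (auto simp: lookup_sum lookup_poly_filter intro!: sum.neutral)
      qed
      have "(\<Sum>b\<in>Bs. U b) = bin_lead g0" "(\<Sum>b\<in>Bs. W b) = bin_trail g0"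
        unfolding U_def W_def using one p(2,3) by (auto intro: poly_mapping_eqI)
      then have "g0 \<in> J" using sums[OF order_refl] p(1) by simp
      then show False using irredundant[OF g0A(1)] by (simp add: J_def)
    qed
  qed
  then show ?thesis using complete_intersection_iff[OF F] by simp
qed

theorem theorem5p5:
  fixes V :: "'v set" and E :: "'v set set"
  assumes "simple_graph V E" and "graph_connected V E"
  shows "complete_intersection (poly_ring E :: ('v, 'k::field) epoly ring) (toric_ideal E)
     \<longleftrightarrow>
     ((\<exists>f::('v, 'k) epoly. \<forall>g. minimal_generator E (toric_ideal E) g \<longrightarrow>
          g = f \<or> g = - f \<or> (\<exists>w. even_cycle V E w \<and> g = B_cycle w)) \<and>
      (\<forall>V' E'. is_block V E V' E' \<longrightarrow>
          complete_intersection (poly_ring E' :: ('v, 'k) epoly ring) (toric_ideal E')))"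
    (is "?CI \<longleftrightarrow> ?gens \<and> ?blocks")
proof -
  interpret edge_set E
    using assms(1) simple_graph_finite[OF assms(1)] by unfold_locales (auto simp: simple_graph_def)
  have EV: "\<Union>E \<subseteq> V" using assms(1) by (auto simp: simple_graph_def)
  have conn: "(x, z) \<in> (adj_rel E)\<^sup>*" if "x \<in> \<Union>E" "z \<in> \<Union>E" for x z
    using assms(2) that EV by (auto simp: graph_connected_def)
  have blk: "E' = induced V'" if "is_block V E V' E'" for V' E'
    using block_induced[OF that] by (simp add: induced_def)
  obtain F where F: "max_indep E F" using max_indep_exists fin_E by blast
  have sys: "min_system E A" if "minimal_binomial_system E (toric_ideal E :: ('v, 'k) epoly set) A" for A
    using that by unfold_locales
  show ?thesis
  proof
    assume ci: ?CI
    have cisys: "ci_system E A F" if "minimal_binomial_system E (toric_ideal E :: ('v, 'k) epoly set) A" for A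
    proof -
      interpret min_system E A by (rule sys[OF that])
      show ?thesis using F ci complete_intersection_iff[OF F] by unfold_locales auto
    qed
    have ?blocks
    proof (intro allI impI)
      fix V' E' assume B: "is_block V E V' E'"
      obtain A where "minimal_binomial_system E (toric_ideal E :: ('v, 'k) epoly set) A"
        using min_system_toric_exists by blast
      then interpret ci_system E A F by (rule cisys)
      show "complete_intersection (poly_ring E' :: ('v, 'k) epoly ring) (toric_ideal E')"
        unfolding blk[OF B] by (rule induced_complete_intersection)
    qed
    moreover have ?gens
    proof -
      \<comment> \<open>A condition on the generator alone, since two exceptional generators may
        come from different minimal systems.\<close>
      define badgen where "badgen g \<longleftrightarrow> minimal_generator E (toric_ideal E) g \<and> (\<exists>v. lookup (bin_deg g) v > 1)"
        for g :: "('v, 'k) epoly"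
      have good: "\<exists>w. even_cycle V E w \<and> g = B_cycle w"
        if g: "minimal_generator E (toric_ideal E) g" "\<not> badgen g" for g :: "('v, 'k) epoly"
      proof -
        obtain A where A: "minimal_binomial_system E (toric_ideal E) A" "g \<in> A"
          using g(1) by (auto simp: minimal_generator_def)
        interpret ci_system E A F by (rule cisys[OF A(1)])
        show ?thesis using squarefree_even_cycle[OF A(2) _ EV] g by (auto simp: badgen_def bad_def)
      qed
      have uniq: "g = f \<or> g = - f" if f: "badgen f" and g: "badgen g" for f g
      proof -
        obtain A where A: "minimal_binomial_system E (toric_ideal E) A" "f \<in> A"
          using f by (auto simp: badgen_def minimal_generator_def)
        obtain B where B: "minimal_binomial_system E (toric_ideal E) B" "g \<in> B"
          using g by (auto simp: badgen_def minimal_generator_def)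
        interpret A: ci_system E A F by (rule cisys[OF A(1)])
        interpret B: ci_system E B F by (rule cisys[OF B(1)])
        have "B.bad g" using g by (simp add: B.bad_def badgen_def)
        \<comment> \<open>Up to sign \<open>g\<close> also belongs to the system of
          \<open>f\<close>, where two bad generators must coincide.\<close>
        then obtain h where h: "h \<in> A" "h = g \<or> h = - g" "bin_deg h = bin_deg g"
          using bad_indispensable[OF cisys[OF B(1)] cisys[OF A(1)] B(2)] by blast
        have "A.bad h" "A.bad f" using f g h(3) by (simp_all add: A.bad_def badgen_def)
        then have "f = h" using A.bad_unique[OF conn A(2) _ h(1)] by blast
        then show ?thesis using h(2) by auto
      qed
      show ?thesis
      proof (cases "\<exists>f. badgen f")
        case True
        then obtain f where "badgen f" by blast
        then show ?thesis using good uniq by blast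
      next
        case False
        then show ?thesis using good by blast
      qed
    qed
    ultimately show "?gens \<and> ?blocks" by blast
  next
    assume R: "?gens \<and> ?blocks"
    then obtain f :: "('v, 'k) epoly" where f: "\<And>g. minimal_generator E (toric_ideal E) g \<Longrightarrow>
        g = f \<or> g = - f \<or> (\<exists>w. even_cycle V E w \<and> g = B_cycle w)" by blast
    obtain A where A: "minimal_binomial_system E (toric_ideal E :: ('v, 'k) epoly set) A"
      using min_system_toric_exists by blast
    interpret min_system E A by (rule sys[OF A])
    define Bs where "Bs = {V'. \<exists>E'. is_block V E V' E'}"
    have "Bs \<subseteq> Pow V" by (auto simp: Bs_def is_block_def subgraph_def)
    then have fin: "finite Bs" using simple_graph_finite[OF assms(1)] finite_subset by blast
    have incycle: "\<exists>b\<in>Bs. g \<in> polys_on (induced b)" if gw: "even_cycle V E w" "g = B_cycle w" for g :: "('v, 'k) epoly" and w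
    proof -
      obtain V' E' where B: "is_block V E V' E'" "\<forall>k<length w. cycle_edge w k \<in> E'"
        using cycle_in_block[OF assms(1) gw(1)] by blast
      have "g \<in> polys_on (induced V')" unfolding gw(2) using B blk[OF B(1)] by (intro cycle_in_polys_on) auto
      then show ?thesis using B(1) by (auto simp: Bs_def)
    qed
    \<comment> \<open>One of two opposite generators would make the other redundant, unless they are
      equal as in characteristic 2. Hence the single choice \<open>g0\<close> covers both signs of
      the exception.\<close>
    have both: False if "f \<in> A" "- f \<in> A" "f \<noteq> - f"
    proof -
      have "ideal (comb E (A - {f})) (poly_ring E)" using A_polys by (intro ideal_comb) auto
      moreover have "- f \<in> comb E (A - {f})" using subset_comb[of "A - {f}" E] fin_A that by auto
      ultimately have "- (- f) \<in> comb E (A - {f})" by (rule ideal_poly_ring_uminus)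
      then show False using irredundant[OF that(1)] by simp
    qed
    define g0 where "g0 = (if f \<in> A then f else - f)"
    show ?CI
    proof (rule complete_intersection_if_blocks[OF fin])
      show "\<exists>b\<in>Bs. e \<in> induced b" if "e \<in> E" for e
        using edge_in_block[OF assms(1) that] blk by (auto simp: Bs_def)
      show "induced b \<inter> induced b' = {}" if b: "b \<in> Bs" "b' \<in> Bs" "b \<noteq> b'" for b b'
      proof (rule ccontr)
        assume "induced b \<inter> induced b' \<noteq> {}"
        then obtain e where "e \<in> induced b" "e \<in> induced b'" by blast
        moreover from this obtain x z where "e = {x, z}" "x \<noteq> z" using edge_ends induced_subset by blast
        moreover obtain E1 E2 where "is_block V E b E1" "is_block V E b' E2" using b by (auto simp: Bs_def)
        ultimately show False using block_unique[of V E b E1 b' E2 x z] b(3) by (auto simp: induced_def)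
      qed
      show "complete_intersection (poly_ring (induced b)) (toric_ideal (induced b) :: ('v, 'k) epoly set)" if "b \<in> Bs" for b
        using that R blk by (auto simp: Bs_def)
      show "\<exists>b\<in>Bs. g \<in> polys_on (induced b)" if g: "g \<in> A" "g \<noteq> g0" for g
      proof -
        have "minimal_generator E (toric_ideal E) g" using A g(1) by (auto simp: minimal_generator_def)
        then consider "g = f \<or> g = - f" | w where "even_cycle V E w" "g = B_cycle w" using f by blast
        then show ?thesis
        proof cases
          case 1
          then have "f \<in> A" "g = - f" using g by (auto simp: g0_def split: if_splits)
          then show ?thesis using both g by (auto simp: g0_def)
        next
          case 2
          then show ?thesis by (rule incycle)
        qed
      qed
    qed
  qed
qed

end
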